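(* The topological closure in $\mathbb{R}$ of the set $\{\omega_2(\xi)\;:\;\xi\text{ of Sturmian type}\}$ is $$[1+\sqrt5,\,2+\sqrt5]\;\cup\;[2+2\sqrt2,\,3+2\sqrt3]\;\cup\;[3+\sqrt{13},\,+\infty).$$
   Context: For a real number $\xi$ not algebraic of degree $\le2$, $\omega_2(\xi)$ is the supremum of the real $\omega$ such that, for arbitrarily large $X$, there is a non-zero $(x_0,x_1,x_2)\in\mathbb{Z}^3$ with $|x_0+x_1\xi+x_2\xi^2|\le X^{-\omega}$ and $\max(|x_1|,|x_2|)\le X$. Numbers of Sturmian type. Let $(s_k)_{k\ge0}$ be a bounded sequence of integers with $s_0=-1$, $s_1=1$ and $s_k\ge1$ for $k\ge1$; put $t_k=s_0+\dots+s_k$ and $\sigma=1/\limsup_{k\to\infty}[s_{k+1};s_k,\dots,s_1]$ (continued fraction notation). Let $\mathcal{M}$ be the monoid of $2\times2$ integer matrices with non-zero determinant, and let $\|w\|$ be the maximum of the absolute values of the entries of a matrix $w$. Consider a sequence $(w_i)_{i\ge0}$ in $\mathcal{M}$ with $w_{i+1}=w_i^{s_{i+1}}w_{i-1}$ for $i\ge1$. It is admissible if there is $N\in\mathcal{M}$ such that $w_1N$, $w_0{}^tN$ and $w_1w_0{}^tN$ are symmetric. It has multiplicative growth if there are $c_1,c_2>0$ with $c_1\|w_k\|\,\|w_k^{l-1}w_{k-1}\|\le\|w_k^lw_{k-1}\|\le c_2\|w_k\|\,\|w_k^{l-1}w_{k-1}\|$ for all $k\ge1$, $1\le l\le s_{k+1}+1$.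 Given such an admissible sequence with matrix $N$, put $N_k=N$ for $k$ even, $N_k={}^tN$ for $k$ odd, $y_{-2}=w_0{}^tN$, $y_{-1}=w_1N$, and $y_{t_k+l}=w_k^{l+1}w_{k-1}N_k$ for $k\ge1$, $0\le l<s_{k+1}$; these are symmetric matrices, identified with points of $\mathbb{Z}^3$ through $(x_0,x_1,x_2)\leftrightarrow\begin{pmatrix} x_0 & x_1 \\ x_1 & x_2 \end{pmatrix}$. The content of an integer point is the gcd of its coordinates. A real number $\xi$ is of Sturmian type if, for some bounded sequence $(s_k)_{k\ge0}$ of integers with $s_0=-1$, $s_1=1$ and $s_k\ge1$ for $k\ge1$, there is an admissible sequence $(w_i)_{i\ge0}$ in $\mathcal{M}$ satisfying $w_{i+1}=w_i^{s_{i+1}}w_{i-1}$ for $i\ge1$, with multiplicative growth and with a non-symmetric matrix $N$, such that $\|w_i\|\to\infty$, the contents of the $y_i$ are bounded, the real number $\delta\ge0$ with $|\det w_i|\asymp\|w_i\|^{\delta}$ (ratio bounded above and below by positive constants) satisfies $\delta<\sigma/(1+\sigma)$, and $(y_i)$ converges in $\mathbb{P}^2(\mathbb{R})$ to the class of $(1,\xi,\xi^2)$. (Such a $\xi$ is not algebraic of degree $\le2$.) *)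

theory Defs
  imports "HOL-Analysis.Analysis"
begin

section \<open>The exponent of approximation\<close>

text \<open>The supremum is taken in the extended reals, so that an unbounded set of exponents
  gives \<open>\<infinity>\<close> instead of an unspecified real number. (As a real number, \<open>\<infinity>\<close> is read as \<open>0\<close>
  by \<^const>\<open>real_of_ereal\<close>, so a set of values of \<open>real_of_ereal \<circ> omega_2\<close> that avoids
  \<open>0\<close> comes from finite exponents only.)\<close>

definition omega_2 :: "real \<Rightarrow> ereal" where
  "omega_2 \<xi> = Sup {ereal \<omega> | \<omega>. \<exists>\<^sub>F X in (at_top :: real filter).
     \<exists>x0 x1 x2 :: int. (x0, x1, x2) \<noteq> (0, 0, 0) \<and>
       \<bar>of_int x0 + of_int x1 * \<xi> + of_int x2 * \<xi>\<^sup>2\<bar> \<le> X powr (- \<omega>) \<and>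
       of_int (max \<bar>x1\<bar> \<bar>x2\<bar>) \<le> X}"


section \<open>Integer matrices of size two\<close>

type_synonym imat = "int^2^2"

definition mat_monoid :: "imat set" where
  "mat_monoid = {A. det A \<noteq> 0}"

text \<open>The class operations \<open>*\<close> and \<open>^\<close> on \<^typ>\<open>imat\<close> are not the matrix ones,
  hence a separate power.\<close>

primrec mat_pow :: "imat \<Rightarrow> nat \<Rightarrow> imat" where
  "mat_pow A 0 = mat 1"
| "mat_pow A (Suc n) = A ** mat_pow A n"

definition mat_height :: "imat \<Rightarrow> real" where
  "mat_height A = of_int (Max {\<bar>A $ i $ j\<bar> | i j. True})"

definition mat_symmetric :: "imat \<Rightarrow> bool" where
  "mat_symmetric A \<longleftrightarrow> transpose A = A"

text \<open>A symmetric matrix is identified with the point of coordinates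
  \<open>x0 = A $ 1 $ 1\<close>, \<open>x1 = A $ 1 $ 2\<close>, \<open>x2 = A $ 2 $ 2\<close>.\<close>

definition mat_point :: "imat \<Rightarrow> real^3" where
  "mat_point A = vector [of_int (A $ 1 $ 1), of_int (A $ 1 $ 2), of_int (A $ 2 $ 2)]"

definition mat_content :: "imat \<Rightarrow> int" where
  "mat_content A = gcd (A $ 1 $ 1) (gcd (A $ 1 $ 2) (A $ 2 $ 2))"


section \<open>Real projective space\<close>

text \<open>The points are the lines through the origin, and the topology is the quotient
  topology of \<open>- {0}\<close> under \<open>x \<mapsto> span {x}\<close>. For \<open>real^3\<close> this is the projective plane.\<close>

definition proj_topology :: "'a::real_normed_vector set topology" where
  "proj_topology = topology (\<lambda>U. U \<subseteq> (\<lambda>x. span {x}) ` (- {0}) \<and>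
     open {x. x \<noteq> 0 \<and> span {x} \<in> U})"

lemma openin_proj_topology:
  "openin proj_topology U \<longleftrightarrow> U \<subseteq> (\<lambda>x. span {x}) ` (- {0 :: 'a::real_normed_vector}) \<and>
     open {x. x \<noteq> 0 \<and> span {x} \<in> U}"
proof -
  let ?L = "\<lambda>U. U \<subseteq> (\<lambda>x. span {x}) ` (- {0 :: 'a}) \<and> open {x. x \<noteq> 0 \<and> span {x} \<in> U}"
  have "istopology ?L"
    unfolding istopology_def
  proof (intro conjI allI impI)
    fix S T assume S: "?L S" and T: "?L T"
    have *: "{x. x \<noteq> 0 \<and> span {x} \<in> S \<inter> T} =
        {x. x \<noteq> 0 \<and> span {x} \<in> S} \<inter> {x. x \<noteq> 0 \<and> span {x} \<in> T}" by auto
    show "S \<inter> T \<subseteq> (\<lambda>x. span {x}) ` (- {0 :: 'a})" using S by blast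
    show "open {x. x \<noteq> 0 \<and> span {x} \<in> S \<inter> T}" unfolding * using S T by blast
  next
    fix \<K> assume K: "\<forall>K\<in>\<K>. ?L K"
    have *: "{x. x \<noteq> 0 \<and> span {x} \<in> \<Union>\<K>} = (\<Union>K\<in>\<K>. {x. x \<noteq> 0 \<and> span {x} \<in> K})" by auto
    show "\<Union>\<K> \<subseteq> (\<lambda>x. span {x}) ` (- {0 :: 'a})" using K by blast
    show "open {x. x \<noteq> 0 \<and> span {x} \<in> \<Union>\<K>}" unfolding * using K by blast
  qed
  then show ?thesis
    unfolding proj_topology_def by (simp add: topology_inverse')
qed

lemma topspace_proj_topology:
  "topspace proj_topology = (\<lambda>x. span {x}) ` (- {0 :: 'a::real_normed_vector})"
proof -
  have nz: "{x :: 'a. x \<noteq> 0 \<and> span {x} \<in> (\<lambda>x. span {x}) ` (- {0})} = - {0}"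
    by auto
  have "openin proj_topology ((\<lambda>x. span {x}) ` (- {0 :: 'a}))"
    unfolding openin_proj_topology nz by (intro conjI order_refl open_Compl closed_singleton)
  moreover have "topspace proj_topology \<subseteq> (\<lambda>x. span {x}) ` (- {0 :: 'a})"
    using openin_topspace[of proj_topology] unfolding openin_proj_topology by (rule conjunct1)
  ultimately show ?thesis
    by (intro equalityI openin_subset)
qed


section \<open>Sturmian sequences of matrices\<close>

definition sturm_exps :: "(nat \<Rightarrow> int) \<Rightarrow> bool" where
  "sturm_exps s \<longleftrightarrow> (\<exists>B. \<forall>k. \<bar>s k\<bar> \<le> B) \<and> s 0 = -1 \<and> s 1 = 1 \<and> (\<forall>k\<ge>1. s k \<ge> 1)"

definition sturm_t :: "(nat \<Rightarrow> int) \<Rightarrow> nat \<Rightarrow> int" where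
  "sturm_t s k = (\<Sum>i\<le>k. s i)"

fun cont_frac :: "int list \<Rightarrow> real" where
  "cont_frac [] = 0"
| "cont_frac [a] = of_int a"
| "cont_frac (a # b # as) = of_int a + 1 / cont_frac (b # as)"

text \<open>The list below is \<open>[s (k + 1), s k, \<dots>, s 1]\<close>. The upper limit is finite
  because \<open>s\<close> is bounded.\<close>

definition sturm_sigma :: "(nat \<Rightarrow> int) \<Rightarrow> real" where
  "sturm_sigma s =
     1 / real_of_ereal (limsup (\<lambda>k. ereal (cont_frac (map s (rev [1..<k + 2])))))"

definition sturm_seq :: "(nat \<Rightarrow> int) \<Rightarrow> (nat \<Rightarrow> imat) \<Rightarrow> bool" where
  "sturm_seq s w \<longleftrightarrow> (\<forall>i. w i \<in> mat_monoid) \<and>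
     (\<forall>i\<ge>1. w (i + 1) = mat_pow (w i) (nat (s (i + 1))) ** w (i - 1))"

definition admissible_with :: "(nat \<Rightarrow> imat) \<Rightarrow> imat \<Rightarrow> bool" where
  "admissible_with w N \<longleftrightarrow> N \<in> mat_monoid \<and> mat_symmetric (w 1 ** N) \<and>
     mat_symmetric (w 0 ** transpose N) \<and> mat_symmetric (w 1 ** w 0 ** transpose N)"

definition mult_growth :: "(nat \<Rightarrow> int) \<Rightarrow> (nat \<Rightarrow> imat) \<Rightarrow> bool" where
  "mult_growth s w \<longleftrightarrow> (\<exists>c1>0. \<exists>c2>0. \<forall>k\<ge>1. \<forall>l::nat. 1 \<le> l \<and> int l \<le> s (k + 1) + 1 \<longrightarrow>
     c1 * mat_height (w k) * mat_height (mat_pow (w k) (l - 1) ** w (k - 1))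
       \<le> mat_height (mat_pow (w k) l ** w (k - 1)) \<and>
     mat_height (mat_pow (w k) l ** w (k - 1))
       \<le> c2 * mat_height (w k) * mat_height (mat_pow (w k) (l - 1) ** w (k - 1)))"

definition sturm_N :: "imat \<Rightarrow> nat \<Rightarrow> imat" where
  "sturm_N N k = (if even k then N else transpose N)"

text \<open>Only the indices \<open>i \<ge> -2\<close> are meaningful. For \<open>i \<ge> 0\<close>, the number \<open>k\<close> is the unique
  one with \<open>k \<ge> 1\<close> and \<open>sturm_t s k \<le> i < sturm_t s (k + 1)\<close>.\<close>

definition sturm_y :: "(nat \<Rightarrow> int) \<Rightarrow> (nat \<Rightarrow> imat) \<Rightarrow> imat \<Rightarrow> int \<Rightarrow> imat" where
  "sturm_y s w N i =
     (if i = -2 then w 0 ** transpose N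
      else if i = -1 then w 1 ** N
      else let k = (LEAST k. k \<ge> 1 \<and> i < sturm_t s (k + 1)); l = nat (i - sturm_t s k)
           in mat_pow (w k) (l + 1) ** w (k - 1) ** sturm_N N k)"

lemma sturm_y_eq:
  assumes "sturm_exps s" "k \<ge> 1" "int l < s (k + 1)"
  shows "sturm_y s w N (sturm_t s k + int l) =
    mat_pow (w k) (l + 1) ** w (k - 1) ** sturm_N N k"
proof -
  have pos: "s j \<ge> 1" if "j \<ge> 1" for j using assms(1) that by (auto simp: sturm_exps_def)
  have t_Suc: "sturm_t s (Suc j) = sturm_t s j + s (Suc j)" for j by (simp add: sturm_t_def)
  have le: "sturm_t s j \<le> sturm_t s m" if "j \<le> m" for j m
    using that
  proof (induction m rule: dec_induct)
    case (step n)
    then show ?case using pos[of "Suc n"] t_Suc[of n] by simp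
  qed simp
  have "sturm_t s 1 = 0" using assms(1) by (simp add: sturm_t_def sturm_exps_def)
  then have nn: "sturm_t s k \<ge> 0" using le[OF assms(2)] by simp
  have "(LEAST j. j \<ge> 1 \<and> sturm_t s k + int l < sturm_t s (j + 1)) = k"
  proof (rule Least_equality)
    show "k \<ge> 1 \<and> sturm_t s k + int l < sturm_t s (k + 1)" using assms t_Suc by simp
    show "k \<le> j" if "j \<ge> 1 \<and> sturm_t s k + int l < sturm_t s (j + 1)" for j
      using that le[of "j + 1" k] by (cases "k \<le> j") auto
  qed
  then show ?thesis using nn by (simp add: sturm_y_def Let_def)
qed


section \<open>Numbers of Sturmian type\<close>

definition sturmian_type :: "real \<Rightarrow> bool" where
  "sturmian_type \<xi> \<longleftrightarrow> (\<exists>s w N. sturm_exps s \<and> sturm_seq s w \<and> admissible_with w N \<and>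
     mult_growth s w \<and> \<not> mat_symmetric N \<and>
     filterlim (\<lambda>i. mat_height (w i)) at_top sequentially \<and>
     (\<exists>C. \<forall>i\<ge>-2. mat_content (sturm_y s w N i) \<le> C) \<and>
     (\<exists>\<delta>\<ge>0. \<delta> < sturm_sigma s / (1 + sturm_sigma s) \<and>
        (\<exists>c1>0. \<exists>c2>0. \<forall>i. c1 * mat_height (w i) powr \<delta> \<le> of_int \<bar>det (w i)\<bar> \<and>
           of_int \<bar>det (w i)\<bar> \<le> c2 * mat_height (w i) powr \<delta>)) \<and>
     limitin proj_topology (\<lambda>n::nat. span {mat_point (sturm_y s w N (int n))})
       (span {vector [1, \<xi>, \<xi>\<^sup>2]}) sequentially)"

end

theory Submission
  imports Defs
begin

text \<open>Let \<open>L = 1 / \<sigma>\<close> be the upper limit of \<open>[s\<^sub>k\<^sub>+\<^sub>1; s\<^sub>k, \<dots>, s\<^sub>1]\<close>. For \<open>\<xi>\<close> of Sturmian type with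
  parameter \<open>\<delta>\<close> one has \<open>\<omega>\<^sub>2(\<xi>) = 2L + 1 - \<delta>(1 + L)\<close>. The best linear forms are the antisymmetric
  parts \<open>z\<^sub>k\<close> of \<open>y \<mapsto> w\<^sub>k y\<close>, which vanish on the symmetric points \<open>w\<^sub>k\<^sup>j w\<^sub>k\<^sub>-\<^sub>1 N\<^sub>k\<close>. Any other integer
  form takes a non-zero integral value at one of two suitable consecutive \<open>y\<^sub>i\<close>; at the second one this
  value is a multiple of \<open>det w\<^sub>k\<close> by the Cayley-Hamilton recurrence, and the bounded contents keep the
  form from being too short. Neither kind of value can be too small.

  Since \<open>0 \<le> \<delta> < 1 / (1 + L)\<close>, a given \<open>L\<close> yields exponents in \<open>(2L, 2L + 1]\<close>. If \<open>m\<close> is the largest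
  integer occurring infinitely often in \<open>s\<close>, then \<open>m + 1 / L \<le> L \<le> m + 1 / (1 + 1 / L)\<close>, which gives one
  inclusion. Conversely, two-periodic \<open>s\<close> yield enough values of \<open>L\<close> for the intervals \<open>[2L, 2L + 1]\<close> to
  cover the right-hand side, and for each of them the matrices with rows \<open>(1, x)\<close> and \<open>(a, a(x + 1))\<close>
  give a dense set of \<open>\<delta>\<close>.\<close>

section \<open>Integer matrices\<close>

text \<open>Where the value of the exponent comes from: let W_k be the logarithmic height of w_k.
  The form z_k has logarithmic size W_k and vanishes at a point of logarithmic height W_k + W_(k+1),
  but not at the next one. A point of height exp h is within exp (- (1 - \<delta>) h) of the line
  through (1, \<xi>, \<xi>^2), because the cross product of consecutive points is det y_i times a
  form of the size of w. So the value of z_k at \<xi> has logarithm about W_k - (2 - \<delta>) (W_k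
  + W_(k+1)), and W_(k+1) / W_k has upper limit L. The competing forms only reach the exponents 2 /
  (1 - \<delta>) and 3. Both stay below the claimed value because L^2 \<ge> L + 1 and \<delta> (1 +
  L) < 1. In the examples the difficulty is to keep contents bounded while determinants grow. All
  letters have determinant a, second row 0 modulo a and upper left entry 1, which makes the contents
  divide a. Determinants are then exact powers of a, and \<delta> = ln a / \<rho>, where \<rho> is
  the growth of the logarithmic height per letter. The value of \<rho> is never computed, only
  enclosed between two logarithms, and choosing a and b as large powers makes the enclosure as tight
  as needed.\<close>

lemma mult_nth_2: "(A ** B) $ i $ j = A $ i $ 1 * B $ 1 $ j + A $ i $ 2 * B $ 2 $ j"
  for A B :: "'a::comm_semiring_1^2^2"
  by (simp add: matrix_matrix_mult_def sum_2)

lemma mat_eq_iff_2: "A = B \<longleftrightarrow> A$1$1 = B$1$1 \<and> A$1$2 = B$1$2 \<and> A$2$1 = B$2$1 \<and> A$2$2 = B$2$2"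
  for A B :: "'a^2^2"
  by (auto simp: vec_eq_iff forall_2)

lemma mat_symmetric_iff: "mat_symmetric A \<longleftrightarrow> A$2$1 = A$1$2"
  by (auto simp: mat_symmetric_def mat_eq_iff_2 transpose_def)

lemma mat_height_set:
  "{\<bar>A $ i $ j\<bar> | i j. True} = {\<bar>A$1$1\<bar>, \<bar>A$1$2\<bar>, \<bar>A$2$1\<bar>, \<bar>A$2$2\<bar>}"
  for A :: imat
proof -
  have ex_2: "(\<exists>i::2. P i) \<longleftrightarrow> P 1 \<or> P 2" for P by (metis exhaust_2)
  show ?thesis by (simp only: set_eq_iff mem_Collect_eq ex_2 insert_iff empty_iff simp_thms disj_assoc)
qed

lemma mat_height_le_iff:
  "mat_height A \<le> c \<longleftrightarrow> of_int \<bar>A$1$1\<bar> \<le> c \<and> of_int \<bar>A$1$2\<bar> \<le> c \<and> of_int \<bar>A$2$1\<bar> \<le> c \<and> of_int \<bar>A$2$2\<bar> \<le> c"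
proof -
  have "mat_height A = max \<bar>of_int (A$1$1)\<bar> (max \<bar>of_int (A$1$2)\<bar> (max \<bar>of_int (A$2$1)\<bar> \<bar>of_int (A$2$2)\<bar>))"
    unfolding mat_height_def mat_height_set by (simp add: of_int_max)
  then show ?thesis by (simp only: max.bounded_iff of_int_abs)
qed

lemma mat_height_ge: "\<bar>of_int (A $ i $ j)\<bar> \<le> mat_height A"
  using mat_height_le_iff[of A "mat_height A"] exhaust_2[of i] exhaust_2[of j] by auto

lemma mat_height_nonneg: "0 \<le> mat_height A"
  using mat_height_ge[of A 1 1] by linarith

lemma mat_height_mult: "mat_height (A ** B) \<le> 2 * mat_height A * mat_height B"
proof -
  have "\<bar>of_int ((A ** B) $ i $ j)\<bar> \<le> 2 * mat_height A * mat_height B" for i j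
  proof -
    have "\<bar>of_int ((A ** B) $ i $ j)\<bar> \<le> \<bar>real_of_int (A$i$1)\<bar> * \<bar>of_int (B$1$j)\<bar> + \<bar>real_of_int (A$i$2)\<bar> * \<bar>of_int (B$2$j)\<bar>"
      by (simp add: mult_nth_2 abs_mult[symmetric])
    also have "\<dots> \<le> mat_height A * mat_height B + mat_height A * mat_height B"
      by (intro add_mono mult_mono mat_height_ge mat_height_nonneg) auto
    finally show ?thesis by simp
  qed
  then show ?thesis by (simp add: mat_height_le_iff)
qed

lemma mat_height_ge_1: "det A \<noteq> 0 \<Longrightarrow> 1 \<le> mat_height A"
proof (rule ccontr)
  assume d: "det A \<noteq> 0" and "\<not> 1 \<le> mat_height A"
  then have *: "\<bar>real_of_int (A$i$j)\<bar> < 1" for i j using mat_height_ge[of A i j] by linarith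
  have "A$i$j = 0" for i j
    using *[of i j] unfolding of_int_abs[symmetric] of_int_less_1_iff by simp
  then show False using d by (simp add: det_2)
qed

lemma mat_height_transpose: "mat_height (transpose A) = mat_height A"
proof -
  have le: "mat_height (transpose B) \<le> mat_height B" for B
    unfolding mat_height_le_iff[of "transpose B"] using mat_height_ge[of B] by (simp add: transpose_def)
  from le[of A] le[of "transpose A"] show ?thesis by (simp add: transpose_transpose)
qed

text \<open>With the adjugate \<open>C\<close> of \<open>B\<close>, the product
  \<open>A ** B ** C\<close> is \<open>det B\<close> times \<open>A\<close>, and a non-zero integer
  has absolute value at least 1.\<close>

lemma mat_height_mult_ge:
  assumes "det B \<noteq> 0"
  shows "mat_height A \<le> 2 * mat_height B * mat_height (A ** B)"
proof -
  define C :: imat where "C = vector [vector [B$2$2, - B$1$2], vector [- B$2$1, B$1$1]]"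
  have C: "C$1$1 = B$2$2" "C$1$2 = - B$1$2" "C$2$1 = - B$2$1" "C$2$2 = B$1$1"
    by (simp_all add: C_def)
  have hC: "mat_height C \<le> mat_height B"
    using mat_height_ge[of B] by (auto simp: mat_height_le_iff C)
  have "of_int \<bar>A$i$j\<bar> \<le> mat_height (A ** B ** C)" for i j
  proof -
    have "(A ** B ** C) $ i $ j = det B * A $ i $ j"
      using exhaust_2[of j] by (auto simp: mult_nth_2 C det_2 algebra_simps)
    then have "\<bar>of_int (A$i$j)\<bar> * 1 \<le> \<bar>real_of_int ((A ** B ** C) $ i $ j)\<bar>"
      using assms mult_left_mono[of 1 "\<bar>real_of_int (det B)\<bar>" "\<bar>of_int (A$i$j)\<bar>"]
      by (simp add: abs_mult mult.commute)
    then show ?thesis using mat_height_ge[of "A ** B ** C" i j] by simp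
  qed
  then have "mat_height A \<le> mat_height (A ** B ** C)" by (simp add: mat_height_le_iff)
  also have "\<dots> \<le> 2 * mat_height (A ** B) * mat_height C" by (rule mat_height_mult)
  also have "\<dots> \<le> 2 * mat_height (A ** B) * mat_height B"
    by (intro mult_left_mono hC) (simp add: mat_height_nonneg)
  finally show ?thesis by (simp add: mult_ac)
qed

lemma mat_height_sym:
  assumes "mat_symmetric A"
  shows "mat_height A = max \<bar>of_int (A$1$1)\<bar> (max \<bar>of_int (A$1$2)\<bar> \<bar>of_int (A$2$2)\<bar>)"
  using assms mat_height_ge[of A] by (intro antisym) (auto simp: mat_height_le_iff mat_symmetric_iff)

lemma det_mat_pow: "det (mat_pow A n) = det A ^ n"
  by (induction n) (simp_all add: det_mul)

lemma mat_pow_Suc_mult: "mat_pow A (Suc n) ** B = A ** (mat_pow A n ** B)"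
  by (simp add: matrix_mul_assoc)

section \<open>Linear forms on symmetric matrices and the forms attached to a matrix w\<close>

definition form :: "int \<Rightarrow> int \<Rightarrow> int \<Rightarrow> imat \<Rightarrow> int" where
  "form x0 x1 x2 y = x0 * y$1$1 + x1 * y$1$2 + x2 * y$2$2"

lemma cayley_hamilton_2:
  "A ** (A ** B) = (\<chi> i j. trace A * (A ** B)$i$j - det A * B$i$j)" for A B :: "'a::comm_ring_1^2^2"
  by (simp add: mat_eq_iff_2 mult_nth_2 det_2 trace_def sum_2 algebra_simps)

lemma form_cayley_hamilton:
  "form x0 x1 x2 (A ** (A ** B)) = trace A * form x0 x1 x2 (A ** B) - det A * form x0 x1 x2 B"
  by (subst cayley_hamilton_2) (simp add: form_def algebra_simps)

text \<open>By Cayley-Hamilton \<open>A ** (A ** B)\<close> is a linear combination of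
  \<open>A ** B\<close> and \<open>B\<close>.\<close>

lemma symmetric_cayley_hamilton:
  "mat_symmetric B \<Longrightarrow> mat_symmetric (A ** B) \<Longrightarrow> mat_symmetric (A ** (A ** B))"
  by (subst cayley_hamilton_2) (simp add: mat_symmetric_iff)

text \<open>For symmetric y this is the difference of the entries (1,2) and (2,1) of
  \<open>w ** y\<close>. It is written as a form so that its integer coefficients can be compared
  with those of other forms.\<close>

definition skew :: "imat \<Rightarrow> imat \<Rightarrow> int" where
  "skew w y = form (- w$2$1) (w$1$1 - w$2$2) (w$1$2) y"

lemma skew_eq_0_iff: "mat_symmetric y \<Longrightarrow> skew w y = 0 \<longleftrightarrow> mat_symmetric (w ** y)"
  by (auto simp: skew_def form_def mat_symmetric_iff mult_nth_2 algebra_simps)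

text \<open>Together these say that the cross product of the points y and \<open>w ** y\<close> is
  \<open>det y\<close> times the coefficient vector of \<open>skew w\<close>. This governs both the
  speed of convergence of the points and the forms vanishing at two consecutive points.\<close>

lemma form_minor:
  assumes "mat_symmetric y" "mat_symmetric (w ** y)"
  shows "y$1$1 * (w ** y)$1$2 - y$1$2 * (w ** y)$1$1 = det y * w$1$2"
    and "y$1$1 * (w ** y)$2$2 - y$2$2 * (w ** y)$1$1 = det y * (w$2$2 - w$1$1)"
    and "y$1$2 * (w ** y)$2$2 - y$2$2 * (w ** y)$1$2 = - (det y * w$2$1)"
proof -
  have s: "y$2$1 = y$1$2" and t: "w$2$1 * y$1$1 + w$2$2 * y$1$2 = w$1$1 * y$1$2 + w$1$2 * y$2$2"
    using assms by (auto simp: mat_symmetric_iff mult_nth_2)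
  show "y$1$1 * (w ** y)$1$2 - y$1$2 * (w ** y)$1$1 = det y * w$1$2"
    by (simp add: mult_nth_2 det_2 s algebra_simps)
  show "y$1$1 * (w ** y)$2$2 - y$2$2 * (w ** y)$1$1 = det y * (w$2$2 - w$1$1)"
    using t unfolding mult_nth_2 det_2 s by algebra
  show "y$1$2 * (w ** y)$2$2 - y$2$2 * (w ** y)$1$2 = - (det y * w$2$1)"
    using t unfolding mult_nth_2 det_2 s by algebra
qed

text \<open>Apply Cayley-Hamilton to \<open>w ** (w ** M)\<close>: the term with the trace is
  symmetric by assumption, so only - det w times \<open>M\<close> contributes to the antisymmetric
  part.\<close>

lemma skew_twist:
  assumes "mat_symmetric (w ** M)"
  shows "skew w (w ** M) = det w * (M$2$1 - M$1$2)"
proof -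
  have "w$2$1 * M$1$1 + w$2$2 * M$2$1 = w$1$1 * M$1$2 + w$1$2 * M$2$2"
    using assms by (auto simp: mat_symmetric_iff mult_nth_2)
  then show ?thesis unfolding skew_def form_def mult_nth_2 det_2 by algebra
qed

section \<open>Sturmian sequences\<close>

lemma ln_mult_bounds:
  fixes a b c1 c2 :: real
  assumes "0 < a" "0 < b" "0 < c1" "0 < c2" "c1 * a \<le> b" "b \<le> c2 * a"
  shows "\<bar>ln b - ln a\<bar> \<le> \<bar>ln c1\<bar> + \<bar>ln c2\<bar>"
proof -
  have "ln (c1 * a) \<le> ln b" "ln b \<le> ln (c2 * a)"
    using assms by (auto simp: ln_le_cancel_iff)
  then show ?thesis using assms by (auto simp: ln_mult)
qed

text \<open>The number \<xi> and the contents are left out, and \<delta> is only assumed to be less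
  than 1: in the construction of examples \<xi> has to be produced inside this locale as a
  limit.\<close>

locale sturmian =
  fixes s :: "nat \<Rightarrow> int" and w :: "nat \<Rightarrow> imat" and N :: imat and \<delta> :: real
  assumes exps: "sturm_exps s" and seq: "sturm_seq s w" and adm: "admissible_with w N"
    and growth: "mult_growth s w" and not_sym: "\<not> mat_symmetric N"
    and height_lim: "filterlim (\<lambda>i. mat_height (w i)) at_top sequentially"
    and delta: "0 \<le> \<delta>" "\<delta> < 1"
    and det_growth: "\<exists>c1>0. \<exists>c2>0. \<forall>i. c1 * mat_height (w i) powr \<delta> \<le> of_int \<bar>det (w i)\<bar> \<and>
           of_int \<bar>det (w i)\<bar> \<le> c2 * mat_height (w i) powr \<delta>"
begin

text \<open>Compared with the paper, \<open>k\<close> is shifted by one, which avoids a predecessor: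
  \<open>u k j\<close> is \<open>w\<^sub>k\<^sub>+\<^sub>1\<^sup>j w\<^sub>k N\<^sub>k\<^sub>+\<^sub>1\<close>.\<close>

definition r :: "nat \<Rightarrow> nat" where "r k = nat (s (k + 2))"

definition u :: "nat \<Rightarrow> nat \<Rightarrow> imat" where
  "u k j = mat_pow (w (Suc k)) j ** w k ** sturm_N N (Suc k)"

definition W :: "nat \<Rightarrow> real" where "W k = ln (mat_height (w k))"

definition ht :: "nat \<Rightarrow> nat \<Rightarrow> real" where "ht k j = ln (mat_height (u k j))"

lemma r_ge_1: "1 \<le> r k"
proof -
  have "1 \<le> s (k + 2)" using exps by (auto simp: sturm_exps_def)
  then show ?thesis by (simp add: r_def)
qed

lemma s_eq_r: "s (k + 2) = int (r k)"
  using r_ge_1[of k] by (simp add: r_def)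

lemma r_bounded: obtains B where "\<And>k. r k \<le> B"
proof -
  obtain b where "\<And>k. \<bar>s k\<bar> \<le> b" using exps by (auto simp: sturm_exps_def)
  then have "r k \<le> nat b" for k unfolding r_def by (metis abs_ge_self nat_mono order_trans)
  then show ?thesis by (rule that)
qed

lemma det_w: "det (w k) \<noteq> 0"
  using seq by (auto simp: sturm_seq_def mat_monoid_def)

lemma det_N: "det N \<noteq> 0"
  using adm by (auto simp: admissible_with_def mat_monoid_def)

lemma det_sturm_N: "det (sturm_N N k) = det N"
  by (simp add: sturm_N_def det_transpose)

lemma sturm_N_Suc: "sturm_N N (Suc k) = transpose (sturm_N N k)"
  by (simp add: sturm_N_def transpose_transpose)

lemma sturm_N_Suc_Suc [simp]: "sturm_N N (Suc (Suc k)) = sturm_N N k"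
  by (simp add: sturm_N_def)

lemma height_sturm_N: "mat_height (sturm_N N k) = mat_height N"
  by (simp add: sturm_N_def mat_height_transpose)

lemma w_rec: "w (Suc (Suc k)) = mat_pow (w (Suc k)) (r k) ** w k"
proof -
  have "\<forall>i\<ge>1. w (i + 1) = mat_pow (w i) (nat (s (i + 1))) ** w (i - 1)"
    using seq by (simp add: sturm_seq_def)
  from this[rule_format, of "Suc k"] show ?thesis by (simp add: r_def)
qed

lemma u_Suc: "u k (Suc j) = w (Suc k) ** u k j"
  by (simp add: u_def matrix_mul_assoc)

lemma u_0: "u k 0 = w k ** sturm_N N (Suc k)"
  by (simp add: u_def)

lemma u_r: "u k (r k) = u (Suc (Suc k)) 0"
  by (simp add: u_def w_rec)

lemma det_u: "det (u k j) = det (w (Suc k)) ^ j * det (w k) * det N"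
  by (simp add: u_def det_mul det_mat_pow det_sturm_N)

lemma det_u_nz: "det (u k j) \<noteq> 0"
  by (simp add: det_u det_w det_N)

lemma sym_aux:
  assumes "mat_symmetric (u k 0)" "mat_symmetric (u k 1)"
  shows "mat_symmetric (u k j)"
proof -
  have "mat_symmetric (u k j) \<and> mat_symmetric (u k (Suc j))"
  proof (induction j)
    case (Suc j)
    then show ?case using symmetric_cayley_hamilton[of "u k j" "w (Suc k)"] by (simp add: u_Suc)
  qed (use assms in auto)
  then show ?thesis by simp
qed

text \<open>The symmetric matrix \<open>u k (Suc (r k))\<close> is w_(k+1) times the symmetric
  matrix w_(k+2) N. Transposing it and using the symmetry of both \<open>u (Suc (Suc k)) 0\<close>
  and \<open>u (Suc k) 0\<close> moves w_(k+2) to the front. This is how the chain at level k runs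
  into the chain at level k + 1.\<close>

lemma sym_step:
  assumes "mat_symmetric (u k 0)" "mat_symmetric (u k 1)" "mat_symmetric (u (Suc k) 0)"
  shows "mat_symmetric (u (Suc k) 1) \<and> u k (Suc (r k)) = u (Suc k) 1"
proof -
  have *: "w (Suc k) ** sturm_N N k = transpose (w (Suc k) ** sturm_N N k)"
    using assms(3) by (simp add: u_0 mat_symmetric_def)
  have **: "w (Suc (Suc k)) ** sturm_N N (Suc k) = transpose (w (Suc (Suc k)) ** sturm_N N (Suc k))"
    using sym_aux[OF assms(1,2), of "r k"] by (simp add: u_r u_0 mat_symmetric_def)
  have "u k (Suc (r k)) = transpose (u k (Suc (r k)))"
    using sym_aux[OF assms(1,2), of "Suc (r k)"] by (simp add: mat_symmetric_def)
  also have "\<dots> = transpose (w (Suc (Suc k)) ** sturm_N N (Suc k)) ** transpose (w (Suc k))"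
    by (simp add: u_Suc u_r u_0 matrix_transpose_mul)
  also have "\<dots> = w (Suc (Suc k)) ** (sturm_N N (Suc k) ** transpose (w (Suc k)))"
    by (simp add: **[symmetric] matrix_mul_assoc)
  also have "sturm_N N (Suc k) ** transpose (w (Suc k)) = transpose (w (Suc k) ** sturm_N N k)"
    by (simp add: matrix_transpose_mul sturm_N_Suc)
  also have "\<dots> = w (Suc k) ** sturm_N N k" using * by simp
  finally have "u k (Suc (r k)) = u (Suc k) 1" by (simp add: u_Suc u_0)
  with sym_aux[OF assms(1,2), of "Suc (r k)"] show ?thesis by simp
qed

text \<open>At k = 0 these are the three symmetry conditions of admissibility;
  \<open>sym_step\<close> carries them on.\<close>

lemma u_sym_aux: "mat_symmetric (u k 0) \<and> mat_symmetric (u k 1) \<and> mat_symmetric (u (Suc k) 0)"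
proof (induction k)
  case 0
  show ?case using adm by (simp add: admissible_with_def u_0 u_Suc sturm_N_def matrix_mul_assoc)
next
  case (Suc k)
  with sym_step[of k] sym_aux[of k "r k"] show ?case by (simp add: u_r)
qed

lemma u_sym: "mat_symmetric (u k j)"
  using sym_aux[of k] u_sym_aux[of k] by blast

lemma u_Suc_r: "u k (Suc (r k)) = u (Suc k) 1"
  using sym_step u_sym by blast

lemma skew_u: "skew (w (Suc k)) (u k j) = 0"
  using u_sym[of k j] u_sym[of k "Suc j"] by (simp add: skew_eq_0_iff u_Suc)

lemma abs_skew_u_Suc: "\<bar>skew (w (Suc k)) (u (Suc k) 0)\<bar> = \<bar>det (w (Suc k))\<bar> * \<bar>N$1$2 - N$2$1\<bar>"
proof -
  have "\<bar>skew (w (Suc k)) (u (Suc k) 0)\<bar> = \<bar>det (w (Suc k))\<bar> * \<bar>sturm_N N k $2$1 - sturm_N N k $1$2\<bar>"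
    using skew_twist[of "w (Suc k)" "sturm_N N k"] u_sym[of "Suc k" 0] by (simp add: u_0 abs_mult)
  also have "\<bar>sturm_N N k $2$1 - sturm_N N k $1$2\<bar> = \<bar>N$1$2 - N$2$1\<bar>"
    by (auto simp: sturm_N_def transpose_def)
  finally show ?thesis .
qed

text \<open>The non-symmetry of \<open>N\<close> enters here: the difference of its off-diagonal
  entries is a non-zero integer.\<close>

lemma abs_skew_u_Suc_ge: "\<bar>det (w (Suc k))\<bar> \<le> \<bar>skew (w (Suc k)) (u (Suc k) 0)\<bar>"
proof -
  have "1 \<le> \<bar>N$1$2 - N$2$1\<bar>" using not_sym by (simp add: mat_symmetric_iff)
  then show ?thesis unfolding abs_skew_u_Suc using mult_left_mono[of 1 "\<bar>N$1$2 - N$2$1\<bar>" "\<bar>det (w (Suc k))\<bar>"] by simp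
qed

lemma skew_u_Suc_nz: "skew (w (Suc k)) (u (Suc k) 0) \<noteq> 0"
  using abs_skew_u_Suc_ge[of k] det_w[of "Suc k"] by auto

lemma form_u_rec:
  "form x0 x1 x2 (u k (Suc (Suc j))) = trace (w (Suc k)) * form x0 x1 x2 (u k (Suc j)) - det (w (Suc k)) * form x0 x1 x2 (u k j)"
  unfolding u_Suc by (rule form_cayley_hamilton)

section \<open>Logarithmic sizes of the matrices and determinants, up to bounded errors\<close>

lemma height_w_ge_1: "1 \<le> mat_height (w k)"
  by (rule mat_height_ge_1[OF det_w])

lemma height_u_ge_1: "1 \<le> mat_height (u k j)"
  by (rule mat_height_ge_1[OF det_u_nz])

lemma exp_W: "exp (W k) = mat_height (w k)"
  using height_w_ge_1[of k] by (simp add: W_def)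

lemma exp_ht: "exp (ht k j) = mat_height (u k j)"
  using height_u_ge_1[of k j] by (simp add: ht_def)

lemma W_nonneg: "0 \<le> W k"
  using height_w_ge_1[of k] by (simp add: W_def)

lemma W_lim: "filterlim W at_top sequentially"
  unfolding W_def by (rule filterlim_compose[OF ln_at_top height_lim])

text \<open>Each further factor \<open>w (Suc k)\<close> costs one bounded error by multiplicative
  growth, and at most B + 1 factors occur because the exponents are bounded.\<close>

lemma height_pow_bound:
  obtains K where "K \<ge> 0" "\<And>k j. j \<le> r k + 1 \<Longrightarrow> \<bar>ln (mat_height (mat_pow (w (Suc k)) j ** w k)) - (j * W (Suc k) + W k)\<bar> \<le> K"
proof -
  obtain c1 c2 where c: "c1 > 0" "c2 > 0" and g: "\<And>k l. k \<ge> 1 \<Longrightarrow> 1 \<le> l \<Longrightarrow> int l \<le> s (k + 1) + 1 \<Longrightarrow>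
     c1 * mat_height (w k) * mat_height (mat_pow (w k) (l - 1) ** w (k - 1))
       \<le> mat_height (mat_pow (w k) l ** w (k - 1)) \<and>
     mat_height (mat_pow (w k) l ** w (k - 1))
       \<le> c2 * mat_height (w k) * mat_height (mat_pow (w k) (l - 1) ** w (k - 1))"
    using growth unfolding mult_growth_def by blast
  obtain B where B: "\<And>k. r k \<le> B" using r_bounded by blast
  let ?h = "\<lambda>k j. mat_height (mat_pow (w (Suc k)) j ** w k)"
  define K0 where "K0 = \<bar>ln c1\<bar> + \<bar>ln c2\<bar>"
  have h1: "1 \<le> ?h k j" for k j by (rule mat_height_ge_1) (simp add: det_mul det_mat_pow det_w)
  have step: "\<bar>ln (?h k (Suc j)) - (W (Suc k) + ln (?h k j))\<bar> \<le> K0" if "j \<le> r k" for k j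
  proof -
    have "c1 * (mat_height (w (Suc k)) * ?h k j) \<le> ?h k (Suc j) \<and> ?h k (Suc j) \<le> c2 * (mat_height (w (Suc k)) * ?h k j)"
      using g[of "Suc k" "Suc j"] that s_eq_r[of k] by (simp add: mult_ac del: mat_pow.simps)
    moreover have "0 < mat_height (w (Suc k))" "0 < ?h k j" "0 < ?h k (Suc j)"
      using h1[of k j] h1[of k "Suc j"] height_w_ge_1[of "Suc k"] by linarith+
    ultimately show ?thesis
      using ln_mult_bounds[of "mat_height (w (Suc k)) * ?h k j" "?h k (Suc j)" c1 c2] c
      unfolding K0_def W_def by (simp add: ln_mult_pos del: mat_pow.simps)
  qed
  have "\<bar>ln (?h k j) - (j * W (Suc k) + W k)\<bar> \<le> j * K0" if "j \<le> r k + 1" for k j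
    using that
  proof (induction j)
    case (Suc j)
    then have "\<bar>ln (?h k j) - (j * W (Suc k) + W k)\<bar> \<le> j * K0" by simp
    moreover have "\<bar>ln (?h k (Suc j)) - (W (Suc k) + ln (?h k j))\<bar> \<le> K0" using step Suc.prems by simp
    ultimately show ?case by (simp add: algebra_simps del: mat_pow.simps)
  qed (simp add: W_def)
  moreover have le:  "j * K0 \<le> (B + 1) * K0" if "j \<le> r k + 1" for k j
  proof -
    have "j \<le> B + 1" using that B[of k] by linarith
    then have "real j \<le> real (B + 1)" by (rule of_nat_mono)
    then show ?thesis by (intro mult_right_mono) (auto simp: K0_def)
  qed
  ultimately have "\<bar>ln (?h k j) - (j * W (Suc k) + W k)\<bar> \<le> (B + 1) * K0" if "j \<le> r k + 1" for k j
    using that order_trans by blast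
  moreover have "(B + 1) * K0 \<ge> 0" by (simp add: K0_def)
  ultimately show ?thesis using that[of "(B + 1) * K0"] by blast
qed

lemma ht_bound:
  obtains K where "K \<ge> 0" "\<And>k j. j \<le> r k + 1 \<Longrightarrow> \<bar>ht k j - (j * W (Suc k) + W k)\<bar> \<le> K"
proof -
  obtain K where K: "K \<ge> 0" "\<And>k j. j \<le> r k + 1 \<Longrightarrow> \<bar>ln (mat_height (mat_pow (w (Suc k)) j ** w k)) - (j * W (Suc k) + W k)\<bar> \<le> K"
    using height_pow_bound by blast
  define n where "n = 2 * mat_height N"
  have n: "n > 0" using mat_height_ge_1[OF det_N] by (simp add: n_def)
  have "\<bar>ht k j - ln (mat_height (mat_pow (w (Suc k)) j ** w k))\<bar> \<le> \<bar>ln (1 / n)\<bar> + \<bar>ln n\<bar>" for k j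
    unfolding ht_def
  proof (rule ln_mult_bounds)
    let ?M = "mat_pow (w (Suc k)) j ** w k"
    have "1 \<le> mat_height ?M" by (rule mat_height_ge_1) (simp add: det_mul det_mat_pow det_w)
    then show "0 < mat_height ?M" by simp
    show "0 < mat_height (u k j)" using height_u_ge_1[of k j] by simp
    show "mat_height (u k j) \<le> n * mat_height ?M"
      using mat_height_mult[of ?M "sturm_N N (Suc k)"] by (simp add: n_def u_def height_sturm_N mult_ac)
    show "1 / n * mat_height ?M \<le> mat_height (u k j)"
      using mat_height_mult_ge[of "sturm_N N (Suc k)" ?M] det_N n
      by (simp add: n_def u_def height_sturm_N det_sturm_N field_simps)
  qed (use n in auto)
  then have "\<bar>ht k j - (j * W (Suc k) + W k)\<bar> \<le> K + (\<bar>ln (1 / n)\<bar> + \<bar>ln n\<bar>)" if "j \<le> r k + 1" for k j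
    using K(2)[OF that] by (smt (verit))
  then show ?thesis using that[of "K + (\<bar>ln (1 / n)\<bar> + \<bar>ln n\<bar>)"] K(1) by force
qed

lemma W_rec_bound:
  obtains K where "K \<ge> 0" "\<And>k. \<bar>W (Suc (Suc k)) - (r k * W (Suc k) + W k)\<bar> \<le> K"
proof -
  obtain K where K: "K \<ge> 0" "\<And>k j. j \<le> r k + 1 \<Longrightarrow> \<bar>ln (mat_height (mat_pow (w (Suc k)) j ** w k)) - (j * W (Suc k) + W k)\<bar> \<le> K"
    using height_pow_bound by blast
  show ?thesis
  proof (rule that[of K])
    show "\<bar>W (Suc (Suc k)) - (r k * W (Suc k) + W k)\<bar> \<le> K" for k
      using K(2)[of "r k" k] unfolding w_rec[symmetric] W_def[of "Suc (Suc k)"] by simp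
  qed (use K(1) in auto)
qed

lemma det_w_bound:
  obtains K where "K \<ge> 0" "\<And>k. \<bar>ln (of_int \<bar>det (w k)\<bar>) - \<delta> * W k\<bar> \<le> K"
proof -
  obtain c1 c2 where c: "c1 > 0" "c2 > 0" and d: "\<And>i. c1 * mat_height (w i) powr \<delta> \<le> of_int \<bar>det (w i)\<bar>"
    "\<And>i. of_int \<bar>det (w i)\<bar> \<le> c2 * mat_height (w i) powr \<delta>"
    using det_growth by blast
  have "\<bar>ln (of_int \<bar>det (w k)\<bar>) - ln (mat_height (w k) powr \<delta>)\<bar> \<le> \<bar>ln c1\<bar> + \<bar>ln c2\<bar>" for k
    using d[of k] det_w[of k] height_w_ge_1[of k] by (intro ln_mult_bounds c) auto
  then have "\<bar>ln (of_int \<bar>det (w k)\<bar>) - \<delta> * W k\<bar> \<le> \<bar>ln c1\<bar> + \<bar>ln c2\<bar>" for k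
    using height_w_ge_1[of k] by (simp add: W_def ln_powr)
  then show ?thesis by (intro that[of "\<bar>ln c1\<bar> + \<bar>ln c2\<bar>"]) simp_all
qed

lemma det_u_bound:
  obtains K where "K \<ge> 0" "\<And>k j. j \<le> r k + 1 \<Longrightarrow> \<bar>ln (of_int \<bar>det (u k j)\<bar>) - \<delta> * (j * W (Suc k) + W k)\<bar> \<le> K"
proof -
  obtain K where K: "K \<ge> 0" "\<And>k. \<bar>ln (of_int \<bar>det (w k)\<bar>) - \<delta> * W k\<bar> \<le> K" using det_w_bound by blast
  obtain B where B: "\<And>k. r k \<le> B" using r_bounded by blast
  define K' where "K' = (B + 2) * K + \<bar>ln (of_int \<bar>det N\<bar>)\<bar>"
  have "\<bar>ln (of_int \<bar>det (u k j)\<bar>) - \<delta> * (j * W (Suc k) + W k)\<bar> \<le> K'" if "j \<le> r k + 1" for k j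
  proof -
    let ?d = "\<lambda>k. ln (real_of_int \<bar>det (w k)\<bar>)"
    have "ln (of_int \<bar>det (u k j)\<bar>) = j * ?d (Suc k) + ?d k + ln (of_int \<bar>det N\<bar>)"
      by (simp add: det_u abs_mult power_abs ln_mult_pos ln_realpow det_w det_N)
    then have "ln (of_int \<bar>det (u k j)\<bar>) - \<delta> * (j * W (Suc k) + W k) =
        j * (?d (Suc k) - \<delta> * W (Suc k)) + (?d k - \<delta> * W k) + ln (of_int \<bar>det N\<bar>)"
      by (simp add: algebra_simps)
    moreover have "\<bar>j * (?d (Suc k) - \<delta> * W (Suc k))\<bar> \<le> (B + 1) * K"
    proof -
      have "j \<le> B + 1" using that B[of k] by linarith
      then have "real j \<le> real (B + 1)" by (rule of_nat_mono)
      then show ?thesis unfolding abs_mult using K(2)[of "Suc k"] by (intro mult_mono) auto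
    qed
    moreover have "\<bar>a + b + c\<bar> \<le> x + y + \<bar>c\<bar>" if "\<bar>a\<bar> \<le> x" "\<bar>b\<bar> \<le> y" for a b c x y :: real
      using that by linarith
    ultimately have "\<bar>ln (of_int \<bar>det (u k j)\<bar>) - \<delta> * (j * W (Suc k) + W k)\<bar> \<le> (B + 1) * K + K + \<bar>ln (of_int \<bar>det N\<bar>)\<bar>"
      using K(2)[of k] by metis
    also have "(B + 1) * K + K = (B + 2) * K" by (simp add: algebra_simps)
    finally show ?thesis by (simp only: K'_def)
  qed
  moreover have "K' \<ge> 0" using K(1) by (simp add: K'_def)
  ultimately show ?thesis by (intro that) auto
qed

end

text \<open>With \<open>Q i = q i / (1 - \<theta>)\<close>, the bound for the remaining geometric
  series, the intervals [a i - Q i, a i + Q i] are nested. The limit of their left ends lies in all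
  of them.\<close>

lemma geometric_error_limit:
  fixes a q :: "nat \<Rightarrow> real"
  assumes \<theta>: "0 \<le> \<theta>" "\<theta> < 1"
    and step: "\<And>i. i \<ge> i0 \<Longrightarrow> \<bar>a (Suc i) - a i\<bar> \<le> q i" "\<And>i. i \<ge> i0 \<Longrightarrow> q (Suc i) \<le> \<theta> * q i"
  obtains l where "\<And>i. i \<ge> i0 \<Longrightarrow> \<bar>a i - l\<bar> \<le> q i / (1 - \<theta>)"
proof -
  define Q where "Q i = q i / (1 - \<theta>)" for i
  have Q: "Q (Suc i) + q i \<le> Q i" if "i \<ge> i0" for i
  proof -
    have "Q (Suc i) \<le> \<theta> * q i / (1 - \<theta>)" unfolding Q_def using step(2)[OF that] \<theta> by (intro divide_right_mono) auto
    moreover have "\<theta> * q i / (1 - \<theta>) + q i = Q i" using \<theta> by (simp add: Q_def field_simps)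
    ultimately show ?thesis by linarith
  qed
  have Q0: "Q i \<ge> 0" if "i \<ge> i0" for i using step(1)[OF that] \<theta> by (simp add: Q_def)
  define A where "A n = a (i0 + n) - Q (i0 + n)" for n
  define B where "B n = a (i0 + n) + Q (i0 + n)" for n
  have A: "A n \<le> A (Suc n)" and B: "B (Suc n) \<le> B n" and AB: "A n \<le> B n" for n
    using step(1)[of "i0 + n"] Q[of "i0 + n"] Q0[of "i0 + n"] by (auto simp: A_def B_def abs_le_iff)
  have inc: "incseq A" and dec: "decseq B" by (rule incseq_SucI, rule A) (rule decseq_SucI, rule B)
  have "\<forall>n. A n \<le> B 0"
    using order_trans[OF AB decseqD[OF dec, of 0]] by blast
  then obtain l where l: "A \<longlonglongrightarrow> l" "\<forall>n. A n \<le> l" using incseq_convergent[OF inc, of "B 0"] by blast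
  have lB: "l \<le> B n" for n
  proof (rule LIMSEQ_le_const2[OF l(1)], intro exI allI impI)
    show "A m \<le> B n" if "n \<le> m" for m by (rule order_trans[OF AB decseqD[OF dec that]])
  qed
  show ?thesis
  proof (rule that[of l])
    show "\<bar>a i - l\<bar> \<le> q i / (1 - \<theta>)" if "i \<ge> i0" for i
      using l(2)[rule_format, of "i - i0"] lB[of "i - i0"] that by (auto simp: A_def B_def Q_def abs_le_iff)
  qed
qed

lemma halving_error_limit:
  fixes a q :: "nat \<Rightarrow> real"
  assumes "\<And>i. i \<ge> i0 \<Longrightarrow> \<bar>a (Suc i) - a i\<bar> \<le> q i" "\<And>i. i \<ge> i0 \<Longrightarrow> q (Suc i) \<le> q i / 2"
  obtains l where "\<And>i. i \<ge> i0 \<Longrightarrow> \<bar>a i - l\<bar> \<le> 2 * q i"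
proof (rule geometric_error_limit[of "1 / 2" i0 a q])
  fix l assume l: "\<And>i. i \<ge> i0 \<Longrightarrow> \<bar>a i - l\<bar> \<le> q i / (1 - 1 / 2)"
  show ?thesis
  proof (rule that[of l])
    show "\<bar>a i - l\<bar> \<le> 2 * q i" if "i \<ge> i0" for i using l[OF that] by simp
  qed
qed (use assms in auto)

section \<open>The sequence of points y and its limit\<close>

context sturmian
begin

text \<open>This is t_(k+1), the position in y where the chain \<open>u k\<close> enters; it enters
  with \<open>u k 1\<close>, not with \<open>u k 0\<close>.\<close>

definition T :: "nat \<Rightarrow> nat" where "T k = (\<Sum>i<k. r i)"

definition y :: "nat \<Rightarrow> imat" where "y i = sturm_y s w N (int i)"

definition \<Lambda> :: "nat \<Rightarrow> real" where "\<Lambda> i = ln (mat_height (y i))"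

lemma T_Suc: "T (Suc k) = T k + r k"
  by (simp add: T_def)

lemma sturm_t_eq: "sturm_t s (Suc k) = int (T k)"
proof (induction k)
  case 0
  then show ?case using exps by (simp add: sturm_t_def T_def sturm_exps_def)
next
  case (Suc k)
  then show ?case using s_eq_r[of k] by (simp add: sturm_t_def T_Suc)
qed

lemma T_mono: "k \<le> l \<Longrightarrow> T k \<le> T l"
  by (auto simp: T_def intro!: sum_mono2)

lemma le_T: "k \<le> T k"
proof (induction k)
  case (Suc k)
  then show ?case using r_ge_1[of k] by (simp add: T_Suc)
qed simp

lemma y_eq_less:
  assumes "l < r k" shows "y (T k + l) = u k (Suc l)"
proof -
  have "sturm_y s w N (sturm_t s (Suc k) + int l) = mat_pow (w (Suc k)) (l + 1) ** w (Suc k - 1) ** sturm_N N (Suc k)"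
    by (rule sturm_y_eq) (use assms s_eq_r[of k] exps in auto)
  then show ?thesis by (simp add: y_def u_def sturm_t_eq)
qed

text \<open>The end point l = r k already belongs to the next block; \<open>u_Suc_r\<close> says
  that both blocks give the same matrix there.\<close>

lemma y_eq:
  assumes "l \<le> r k" shows "y (T k + l) = u k (Suc l)"
proof (cases "l = r k")
  case True
  then show ?thesis using y_eq_less[of 0 "Suc k"] r_ge_1[of "Suc k"] by (simp add: T_Suc u_Suc_r)
qed (use assms y_eq_less in auto)

lemma T_decomp: "\<exists>k l. i = T k + l \<and> l < r k"
proof (induction i)
  case 0
  show ?case using r_ge_1[of 0] by (intro exI[of _ 0]) (auto simp: T_def)
next
  case (Suc i)
  then obtain k l where kl: "i = T k + l" "l < r k" by blast
  show ?case
  proof (cases "Suc l = r k")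
    case True
    then show ?thesis using kl r_ge_1[of "Suc k"] by (intro exI[of _ "Suc k"] exI[of _ 0]) (auto simp: T_Suc)
  next
    case False
    then show ?thesis using kl by (intro exI[of _ k] exI[of _ "Suc l"]) auto
  qed
qed

text \<open>Because blocks overlap in a point, any two consecutive points lie in one chain, so that
  \<open>y (Suc i) = w (Suc k) ** y i\<close> also across block boundaries.\<close>

lemma y_cases:
  obtains k l where "i = T k + l" "l < r k" "y i = u k (Suc l)" "y (Suc i) = u k (Suc (Suc l))"
    "\<And>k0. T k0 \<le> i \<Longrightarrow> k0 \<le> k"
proof -
  obtain k l where kl: "i = T k + l" "l < r k" using T_decomp by blast
  have "k0 \<le> k" if "T k0 \<le> i" for k0
    using T_mono[of "Suc k" k0] that kl by (cases "k0 \<le> k") (auto simp: T_Suc)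
  then show ?thesis using that[OF kl] y_eq[of l k] y_eq[of "Suc l" k] kl by simp
qed

lemma y_sym: "mat_symmetric (y i)"
  by (rule y_cases[of i]) (simp add: u_sym)

lemma height_y_ge_1: "1 \<le> mat_height (y i)"
  by (rule y_cases[of i]) (simp add: height_u_ge_1)

lemma exp_\<Lambda>: "exp (\<Lambda> i) = mat_height (y i)"
  using height_y_ge_1[of i] by (simp add: \<Lambda>_def)

lemma \<Lambda>_T: "l \<le> r k \<Longrightarrow> \<Lambda> (T k + l) = ht k (Suc l)"
  by (simp add: \<Lambda>_def ht_def y_eq)

text \<open>The increment of \<open>\<Lambda>\<close> is \<open>W (Suc k)\<close> up to a bounded
  error, and \<open>W\<close> tends to infinity.\<close>

lemma \<Lambda>_growth:
  shows "eventually (\<lambda>i. \<Lambda> (Suc i) \<ge> \<Lambda> i + M) sequentially"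
proof -
  obtain K where K: "K \<ge> 0" "\<And>k j. j \<le> r k + 1 \<Longrightarrow> \<bar>ht k j - (j * W (Suc k) + W k)\<bar> \<le> K"
    using ht_bound by blast
  obtain k0 where k0: "\<And>k. k \<ge> k0 \<Longrightarrow> W k \<ge> M + 2 * K"
    using W_lim unfolding filterlim_at_top eventually_sequentially by metis
  show ?thesis
  proof (rule eventually_sequentiallyI[of "T k0"])
    fix i assume "T k0 \<le> i"
    then obtain k l where kl: "i = T k + l" "l < r k" "k0 \<le> k" using y_cases[of i] by metis
    have "\<Lambda> i = ht k (Suc l)" "\<Lambda> (Suc i) = ht k (Suc (Suc l))"
      using \<Lambda>_T[of l k] \<Lambda>_T[of "Suc l" k] kl by auto
    moreover have "ht k (Suc (Suc l)) \<ge> ht k (Suc l) + W (Suc k) - 2 * K"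
      using K(2)[of "Suc l" k] K(2)[of "Suc (Suc l)" k] kl by (simp add: algebra_simps abs_le_iff)
    ultimately show "\<Lambda> (Suc i) \<ge> \<Lambda> i + M" using k0[of "Suc k"] kl by simp
  qed
qed

lemma \<Lambda>_lim: "filterlim \<Lambda> at_top sequentially"
proof -
  obtain i0 where i0: "\<And>i. i \<ge> i0 \<Longrightarrow> \<Lambda> (Suc i) \<ge> \<Lambda> i + 1"
    using \<Lambda>_growth[of 1] unfolding eventually_sequentially by blast
  have *: "\<Lambda> (i0 + n) \<ge> real n" for n
  proof (induction n)
    case 0
    then show ?case using height_y_ge_1[of i0] by (simp add: \<Lambda>_def)
  next
    case (Suc n)
    then show ?case using i0[of "i0 + n"] by simp
  qed
  show ?thesis unfolding filterlim_at_top
  proof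
    fix Z :: real
    show "eventually (\<lambda>i. Z \<le> \<Lambda> i) sequentially"
    proof (rule eventually_sequentiallyI[of "i0 + nat \<lceil>Z\<rceil>"])
      fix i assume "i0 + nat \<lceil>Z\<rceil> \<le> i"
      then show "Z \<le> \<Lambda> i" using *[of "i - i0"] by (simp add: le_diff_conv2) linarith
    qed
  qed
qed

lemma det_y_le:
  obtains K where "K \<ge> 0" "\<And>i. of_int \<bar>det (y i)\<bar> \<le> exp (\<delta> * \<Lambda> i + K)"
proof -
  obtain K1 where K1: "K1 \<ge> 0" "\<And>k j. j \<le> r k + 1 \<Longrightarrow> \<bar>ht k j - (j * W (Suc k) + W k)\<bar> \<le> K1"
    using ht_bound by blast
  obtain K2 where K2: "K2 \<ge> 0" "\<And>k j. j \<le> r k + 1 \<Longrightarrow> \<bar>ln (of_int \<bar>det (u k j)\<bar>) - \<delta> * (j * W (Suc k) + W k)\<bar> \<le> K2"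
    using det_u_bound by blast
  have "of_int \<bar>det (y i)\<bar> \<le> exp (\<delta> * \<Lambda> i + (K1 + K2))" for i
  proof -
    obtain k l where kl: "i = T k + l" "l < r k" "y i = u k (Suc l)" using y_cases[of i] by metis
    let ?m = "real (Suc l) * W (Suc k) + W k"
    have "\<Lambda> i = ht k (Suc l)" using \<Lambda>_T[of l k] kl by auto
    with K1(2)[of "Suc l" k] kl have a: "?m \<le> \<Lambda> i + K1" by simp
    then have "\<delta> * ?m \<le> \<delta> * (\<Lambda> i + K1)" using delta by (intro mult_left_mono) auto
    also have "\<dots> \<le> \<delta> * \<Lambda> i + K1" using delta K1(1) by (simp add: distrib_left mult_left_le_one_le)
    finally have "ln (of_int \<bar>det (y i)\<bar>) \<le> \<delta> * \<Lambda> i + (K1 + K2)"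
      using K2(2)[of "Suc l" k] kl by simp
    then have "exp (ln (of_int \<bar>det (y i)\<bar>)) \<le> exp (\<delta> * \<Lambda> i + (K1 + K2))" by simp
    then show ?thesis using det_u_nz[of k "Suc l"] kl(3) by simp
  qed
  then show ?thesis using that[of "K1 + K2"] K1(1) K2(1) by auto
qed

text \<open>By \<open>form_minor\<close>, the quotients of coordinates change from i to i + 1 by det
  y_i times a coefficient of size exp W over the product of the two first coordinates. The
  assumption bounds this product below by a multiple of exp (2 \<Lambda>_i + W). So W cancels and
  exp (- (2 - \<delta>) \<Lambda>_i) remains. The lemma serves twice: it gives the speed of
  convergence for a given \<xi>, and it produces \<xi> in the examples.\<close>

lemma approximation:
  assumes c: "c > 0" "eventually (\<lambda>i. \<bar>of_int (y i $1$1)\<bar> \<ge> c * mat_height (y i)) sequentially"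
  obtains \<xi> K i0 where "K > 0" "\<forall>i\<ge>i0. \<bar>of_int (y i $1$2) - \<xi> * of_int (y i $1$1)\<bar> \<le> K * exp (- ((1 - \<delta>) * \<Lambda> i))"
    "\<forall>i\<ge>i0. \<bar>of_int (y i $2$2) - \<xi>\<^sup>2 * of_int (y i $1$1)\<bar> \<le> K * exp (- ((1 - \<delta>) * \<Lambda> i))"
    "(\<lambda>i. of_int (y i $1$2) / of_int (y i $1$1)) \<longlonglongrightarrow> \<xi>"
    "(\<lambda>i. of_int (y i $2$2) / of_int (y i $1$1)) \<longlonglongrightarrow> \<xi>\<^sup>2"
proof -
  obtain K1 where K1: "K1 \<ge> 0" "\<And>k j. j \<le> r k + 1 \<Longrightarrow> \<bar>ht k j - (j * W (Suc k) + W k)\<bar> \<le> K1"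
    using ht_bound by blast
  obtain K2 where K2: "K2 \<ge> 0" "\<And>i. of_int \<bar>det (y i)\<bar> \<le> exp (\<delta> * \<Lambda> i + K2)"
    using det_y_le by blast
  obtain i1 where i1: "\<And>i. i \<ge> i1 \<Longrightarrow> \<bar>of_int (y i $1$1)\<bar> \<ge> c * mat_height (y i)"
    using c(2) unfolding eventually_sequentially by blast
  obtain i2 where i2: "\<And>i. i \<ge> i2 \<Longrightarrow> \<Lambda> (Suc i) \<ge> \<Lambda> i + 1"
    using \<Lambda>_growth[of 1] unfolding eventually_sequentially by blast
  define i0 where "i0 = max i1 i2"
  define K where "K = 2 * exp (2 * K1 + K2) / c\<^sup>2"
  define q where "q i = K * exp (- ((2 - \<delta>) * \<Lambda> i))" for i
  have K_pos: "K > 0" using c by (simp add: K_def)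
  define a where "a i = real_of_int (y i $1$2) / of_int (y i $1$1)" for i
  define b where "b i = real_of_int (y i $2$2) / of_int (y i $1$1)" for i
  have y0: "c * exp (\<Lambda> i) \<le> \<bar>of_int (y i $1$1)\<bar>" if "i \<ge> i0" for i
    using i1[of i] that by (simp add: exp_\<Lambda> i0_def)
  have y0_pos: "0 < \<bar>real_of_int (y i $1$1)\<bar>" if "i \<ge> i0" for i
    by (rule less_le_trans[OF _ y0[OF that]]) (use c in simp)
  have step: "\<bar>a (Suc i) - a i\<bar> \<le> q i \<and> \<bar>b (Suc i) - b i\<bar> \<le> q i" if i: "i \<ge> i0" for i
  proof -
    obtain k l where kl: "i = T k + l" "l < r k" "y i = u k (Suc l)" "y (Suc i) = u k (Suc (Suc l))"
      using y_cases[of i] by metis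
    let ?w = "w (Suc k)"
    have yS: "y (Suc i) = ?w ** y i" using kl by (simp add: u_Suc)
    have \<Lambda>S: "\<Lambda> (Suc i) \<ge> \<Lambda> i + W (Suc k) - 2 * K1"
      using \<Lambda>_T[of l k] \<Lambda>_T[of "Suc l" k] K1(2)[of "Suc l" k] K1(2)[of "Suc (Suc l)" k] kl
      by (simp add: algebra_simps abs_le_iff)
    note minor = form_minor[OF y_sym[of i] y_sym[of "Suc i", unfolded yS], folded yS]
    let ?P = "\<bar>real_of_int (y i $1$1)\<bar> * \<bar>real_of_int (y (Suc i) $1$1)\<bar>"
    have P_pos: "0 < ?P" using y0_pos[of i] y0_pos[of "Suc i"] i by simp
    have "c\<^sup>2 * exp (2 * \<Lambda> i + W (Suc k) - 2 * K1) \<le> c\<^sup>2 * exp (\<Lambda> i + \<Lambda> (Suc i))"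
      using \<Lambda>S c by simp
    also have "\<dots> = (c * exp (\<Lambda> i)) * (c * exp (\<Lambda> (Suc i)))" by (simp add: power2_eq_square exp_add)
    also have "\<dots> \<le> ?P" by (intro mult_mono y0) (use i c in auto)
    finally have P: "c\<^sup>2 * exp (2 * \<Lambda> i + W (Suc k) - 2 * K1) \<le> ?P" .
    have bound: "\<bar>real_of_int p\<bar> / ?P \<le> q i" if "\<bar>real_of_int p\<bar> \<le> of_int \<bar>det (y i)\<bar> * (2 * exp (W (Suc k)))" for p
    proof -
      have "\<bar>real_of_int p\<bar> \<le> exp (\<delta> * \<Lambda> i + K2) * (2 * exp (W (Suc k)))"
        by (rule order_trans[OF that]) (intro mult_right_mono K2, simp)
      then have "\<bar>real_of_int p\<bar> / ?P \<le> exp (\<delta> * \<Lambda> i + K2) * (2 * exp (W (Suc k))) / (c\<^sup>2 * exp (2 * \<Lambda> i + W (Suc k) - 2 * K1))"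
        using P c by (intro frac_le) auto
      also have "\<dots> = 2 / c\<^sup>2 * (exp (\<delta> * \<Lambda> i + K2) * exp (W (Suc k)) / exp (2 * \<Lambda> i + W (Suc k) - 2 * K1))"
        by simp
      also have "\<dots> = 2 / c\<^sup>2 * exp ((2 * K1 + K2) + - ((2 - \<delta>) * \<Lambda> i))"
        by (simp only: exp_add[symmetric] exp_diff[symmetric]) (simp add: algebra_simps)
      also have "\<dots> = q i" by (simp only: exp_add q_def K_def) simp
      finally show ?thesis .
    qed
    have diff: "m / real_of_int (y (Suc i) $1$1) - n / of_int (y i $1$1) =
        (of_int (y i $1$1) * m - n * of_int (y (Suc i) $1$1)) / (of_int (y i $1$1) * of_int (y (Suc i) $1$1))" for m n
      using y0_pos[of i] y0_pos[of "Suc i"] i by (simp add: diff_frac_eq mult_ac)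
    have H: "\<bar>real_of_int (?w $ i $ j)\<bar> \<le> exp (W (Suc k))" for i j unfolding exp_W by (rule mat_height_ge)
    have "\<bar>a (Suc i) - a i\<bar> = \<bar>of_int (det (y i) * ?w$1$2)\<bar> / ?P"
      unfolding a_def diff minor(1)[symmetric] by (simp add: abs_mult)
    also have "\<dots> \<le> q i"
    proof (rule bound)
      show "\<bar>real_of_int (det (y i) * ?w$1$2)\<bar> \<le> of_int \<bar>det (y i)\<bar> * (2 * exp (W (Suc k)))"
        using H[of 1 2] by (simp add: abs_mult mult_left_mono)
    qed
    finally have A: "\<bar>a (Suc i) - a i\<bar> \<le> q i" .
    have "\<bar>b (Suc i) - b i\<bar> = \<bar>of_int (det (y i) * (?w$2$2 - ?w$1$1))\<bar> / ?P"
      unfolding b_def diff minor(2)[symmetric] by (simp add: abs_mult)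
    also have "\<dots> \<le> q i"
    proof (rule bound)
      have "\<bar>real_of_int (?w$2$2) - of_int (?w$1$1)\<bar> \<le> 2 * exp (W (Suc k))"
        using H[of 1 1] H[of 2 2] by linarith
      then show "\<bar>real_of_int (det (y i) * (?w$2$2 - ?w$1$1))\<bar> \<le> of_int \<bar>det (y i)\<bar> * (2 * exp (W (Suc k)))"
        by (simp add: abs_mult mult_left_mono)
    qed
    finally show ?thesis using A by simp
  qed
  have q_half: "q (Suc i) \<le> q i / 2" if "i \<ge> i0" for i
  proof -
    have "\<Lambda> i + 1 \<le> \<Lambda> (Suc i)" using i2[of i] that by (simp add: i0_def)
    then have "(2 - \<delta>) * (\<Lambda> i + 1) \<le> (2 - \<delta>) * \<Lambda> (Suc i)" using delta by (intro mult_left_mono) auto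
    then have "exp (- ((2 - \<delta>) * \<Lambda> (Suc i))) \<le> exp (- ((2 - \<delta>) * \<Lambda> i) + - 1)"
      using delta by (simp add: distrib_left)
    also have "\<dots> = exp (- ((2 - \<delta>) * \<Lambda> i)) * exp (- 1)" by (rule exp_add)
    also have "\<dots> \<le> exp (- ((2 - \<delta>) * \<Lambda> i)) * (1 / 2)"
      using exp_ge_add_one_self[of 1] by (intro mult_left_mono) (auto simp: exp_minus field_simps)
    finally show ?thesis using K_pos by (simp add: q_def)
  qed
  obtain \<xi> where \<xi>: "\<And>i. i \<ge> i0 \<Longrightarrow> \<bar>a i - \<xi>\<bar> \<le> 2 * q i"
    using halving_error_limit[of i0 a q] step q_half by blast
  obtain \<eta> where \<eta>: "\<And>i. i \<ge> i0 \<Longrightarrow> \<bar>b i - \<eta>\<bar> \<le> 2 * q i"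
    using halving_error_limit[of i0 b q] step q_half by blast
  have e_lim: "(\<lambda>i. exp (- ((2 - \<delta>) * \<Lambda> i))) \<longlonglongrightarrow> 0"
  proof (rule filterlim_compose[OF exp_at_bot])
    have "filterlim (\<lambda>i. (2 - \<delta>) * \<Lambda> i) at_top sequentially"
      by (rule filterlim_tendsto_pos_mult_at_top[OF tendsto_const _ \<Lambda>_lim]) (use delta in simp)
    then show "filterlim (\<lambda>i. - ((2 - \<delta>) * \<Lambda> i)) at_bot sequentially"
      by (simp add: filterlim_uminus_at_bot)
  qed
  have q_lim: "(\<lambda>i. 2 * q i) \<longlonglongrightarrow> 0"
    unfolding q_def using tendsto_mult_left[OF e_lim, of "2 * K"] by (simp add: mult_ac)
  have a_lim: "a \<longlonglongrightarrow> \<xi>"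
    by (rule Lim_transform2[OF tendsto_const]) (rule Lim_null_comparison[OF _ q_lim],
        use \<xi> in \<open>auto simp: eventually_sequentially abs_minus_commute\<close>)
  have b_lim: "b \<longlonglongrightarrow> \<eta>"
    by (rule Lim_transform2[OF tendsto_const]) (rule Lim_null_comparison[OF _ q_lim],
        use \<eta> in \<open>auto simp: eventually_sequentially abs_minus_commute\<close>)
  \<comment> \<open>The difference is det y_i over the square of the first coordinate, which tends
    to 0 since \<delta> < 2. This places the limit point on the conic, so that \<eta> is the square
    of \<xi>.\<close>
  have "(\<lambda>i. b i - (a i)\<^sup>2) \<longlonglongrightarrow> 0"
  proof (rule Lim_null_comparison)
    show "eventually (\<lambda>i. norm (b i - (a i)\<^sup>2) \<le> exp K2 / c\<^sup>2 * exp (- ((2 - \<delta>) * \<Lambda> i))) sequentially"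
    proof (rule eventually_sequentiallyI[of i0])
      fix i assume i: "i0 \<le> i"
      have s: "y i $2$1 = y i $1$2" using y_sym[of i] by (simp add: mat_symmetric_iff)
      have "b i - (a i)\<^sup>2 = of_int (det (y i)) / (of_int (y i $1$1))\<^sup>2"
        using y0_pos[OF i] by (simp add: a_def b_def det_2 s field_simps power2_eq_square)
      then have "norm (b i - (a i)\<^sup>2) = of_int \<bar>det (y i)\<bar> / \<bar>of_int (y i $1$1)\<bar>\<^sup>2"
        by simp
      also have "\<dots> \<le> exp (\<delta> * \<Lambda> i + K2) / (c * exp (\<Lambda> i))\<^sup>2"
        using c by (intro frac_le K2 power_mono y0 i) auto
      also have "\<dots> = 1 / c\<^sup>2 * (exp (\<delta> * \<Lambda> i + K2) / exp (2 * \<Lambda> i))"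
        by (simp add: power_mult_distrib exp_double)
      also have "\<dots> = 1 / c\<^sup>2 * exp (K2 + - ((2 - \<delta>) * \<Lambda> i))"
        by (simp only: exp_diff[symmetric]) (simp add: algebra_simps)
      finally show "norm (b i - (a i)\<^sup>2) \<le> exp K2 / c\<^sup>2 * exp (- ((2 - \<delta>) * \<Lambda> i))"
        by (simp only: exp_add) simp
    qed
    show "(\<lambda>i. exp K2 / c\<^sup>2 * exp (- ((2 - \<delta>) * \<Lambda> i))) \<longlonglongrightarrow> 0"
      using tendsto_mult_left[OF e_lim, of "exp K2 / c\<^sup>2"] by simp
  qed
  moreover have "(\<lambda>i. b i - (a i)\<^sup>2) \<longlonglongrightarrow> \<eta> - \<xi>\<^sup>2" by (intro tendsto_intros a_lim b_lim)
  ultimately have \<eta>_eq: "\<eta> = \<xi>\<^sup>2" using LIMSEQ_unique by fastforce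
  have final: "\<bar>m - \<zeta> * of_int (y i $1$1)\<bar> \<le> (2 * K) * exp (- ((1 - \<delta>) * \<Lambda> i))"
    if i: "i \<ge> i0" and m: "\<bar>m / of_int (y i $1$1) - \<zeta>\<bar> \<le> 2 * q i" for m \<zeta> i
  proof -
    have "m - \<zeta> * of_int (y i $1$1) = of_int (y i $1$1) * (m / of_int (y i $1$1) - \<zeta>)"
      using y0_pos[OF i] by (simp add: field_simps)
    then have "\<bar>m - \<zeta> * of_int (y i $1$1)\<bar> = \<bar>of_int (y i $1$1)\<bar> * \<bar>m / of_int (y i $1$1) - \<zeta>\<bar>"
      by (simp only: abs_mult)
    also have "\<dots> \<le> exp (\<Lambda> i) * (2 * q i)"
      by (intro mult_mono m) (auto simp: exp_\<Lambda> mat_height_ge mat_height_nonneg)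
    also have "\<dots> = (2 * K) * (exp (\<Lambda> i) * exp (- ((2 - \<delta>) * \<Lambda> i)))" by (simp add: q_def)
    also have "\<dots> = (2 * K) * exp (- ((1 - \<delta>) * \<Lambda> i))"
      by (simp only: exp_add[symmetric]) (simp add: algebra_simps)
    finally show ?thesis .
  qed
  show ?thesis
  proof (rule that[of "2 * K" i0 \<xi>])
    show "\<forall>i\<ge>i0. \<bar>of_int (y i $1$2) - \<xi> * of_int (y i $1$1)\<bar> \<le> 2 * K * exp (- ((1 - \<delta>) * \<Lambda> i))"
      using final \<xi> unfolding a_def by blast
    show "\<forall>i\<ge>i0. \<bar>of_int (y i $2$2) - \<xi>\<^sup>2 * of_int (y i $1$1)\<bar> \<le> 2 * K * exp (- ((1 - \<delta>) * \<Lambda> i))"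
      using final \<eta> unfolding b_def \<eta>_eq by blast
    show "(\<lambda>i. of_int (y i $1$2) / of_int (y i $1$1)) \<longlonglongrightarrow> \<xi>"
      using a_lim unfolding a_def[abs_def] .
    show "(\<lambda>i. of_int (y i $2$2) / of_int (y i $1$1)) \<longlonglongrightarrow> \<xi>\<^sup>2"
      using b_lim unfolding b_def[abs_def] \<eta>_eq .
  qed (use K_pos in simp)
qed

end

section \<open>Convergence in the projective plane\<close>

lemma span_scaleR: "c \<noteq> 0 \<Longrightarrow> span {c *\<^sub>R x} = span {x :: 'a::real_vector}"
proof -
  assume c: "c \<noteq> 0"
  have "span {c *\<^sub>R x} \<subseteq> span {x}" for c and x :: 'a
    by (rule span_minimal) (auto intro: span_scale span_base)
  from this[of c x] this[of "inverse c" "c *\<^sub>R x"] c show ?thesis by auto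
qed

lemma span_eq_nonzeroD:
  assumes "span {x} = span {v}" "x \<noteq> (0 :: 'a::real_vector)"
  obtains c where "c \<noteq> 0" "x = c *\<^sub>R v"
proof -
  have "x \<in> span {v}" using assms(1) span_base[of x "{x}"] by simp
  then obtain c where "x = c *\<^sub>R v" by (auto simp: span_singleton)
  then show ?thesis using assms(2) that[of c] by auto
qed

text \<open>\<open>Q\<close> defines an open cone, invariant under non-zero scaling, hence the
  preimage of an open set of lines. The strict inequalities also force the first coordinate to be
  non-zero.\<close>

lemma limitin_projD:
  fixes p :: "nat \<Rightarrow> real^3"
  assumes lim: "limitin proj_topology (\<lambda>n. span {p n}) (span {vector [1, \<xi>, \<eta>]}) sequentially"
    and e: "e > 0"
  shows "eventually (\<lambda>n. \<bar>p n $ 2 - \<xi> * p n $ 1\<bar> < e * \<bar>p n $ 1\<bar> \<and> \<bar>p n $ 3 - \<eta> * p n $ 1\<bar> < e * \<bar>p n $ 1\<bar>) sequentially"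
proof -
  define Q where "Q x \<longleftrightarrow> \<bar>x $ 2 - \<xi> * x $ 1\<bar> < e * \<bar>x $ 1\<bar> \<and> \<bar>x $ 3 - \<eta> * x $ 1\<bar> < e * \<bar>x $ 1\<bar>" for x :: "real^3"
  define U where "U = (\<lambda>x. span {x}) ` {x. Q x}"
  have nz: "x \<noteq> 0" if "Q x" for x using that by (auto simp: Q_def)
  have scale: "Q (c *\<^sub>R x)" if "Q x" "c \<noteq> 0" for c x
  proof -
    have *: "\<bar>c * a - z * (c * b)\<bar> = \<bar>c\<bar> * \<bar>a - z * b\<bar>" for a b z
      by (simp add: abs_mult[symmetric] algebra_simps)
    have "\<bar>c\<bar> * \<bar>x $ 2 - \<xi> * x $ 1\<bar> < \<bar>c\<bar> * (e * \<bar>x $ 1\<bar>)" "\<bar>c\<bar> * \<bar>x $ 3 - \<eta> * x $ 1\<bar> < \<bar>c\<bar> * (e * \<bar>x $ 1\<bar>)"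
      using that by (simp_all add: Q_def)
    then show ?thesis by (simp add: Q_def * abs_mult mult_ac)
  qed
  have mem: "span {x} \<in> U \<longleftrightarrow> Q x" for x
  proof
    assume "span {x} \<in> U"
    then obtain v where v: "Q v" "span {v} = span {x}" by (auto simp: U_def)
    then show "Q x" using span_eq_nonzeroD[of v x] nz scale
      by (metis span_eq_nonzeroD[of x v] span_0 span_empty span_insert_0 singletonD span_base insertI1)
  qed (auto simp: U_def)
  have "{x. x \<noteq> 0 \<and> span {x} \<in> U} = {x. Q x}" using mem nz by auto
  moreover have "open {x. Q x}"
    unfolding Q_def by (intro open_Collect_conj open_Collect_less continuous_intros)
  ultimately have "openin proj_topology U"
    unfolding openin_proj_topology using nz by (auto simp: U_def)
  moreover have "span {vector [1, \<xi>, \<eta>]} \<in> U" unfolding mem using e by (simp add: Q_def vector_3)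
  ultimately have "eventually (\<lambda>n. span {p n} \<in> U) sequentially"
    using lim by (auto simp: limitin_def)
  then show ?thesis unfolding mem Q_def .
qed

lemma limitin_projI:
  fixes p :: "nat \<Rightarrow> real^3"
  assumes nz: "eventually (\<lambda>n. p n $ 1 \<noteq> 0) sequentially"
    and lim: "(\<lambda>n. p n $ 2 / p n $ 1) \<longlonglongrightarrow> \<xi>" "(\<lambda>n. p n $ 3 / p n $ 1) \<longlonglongrightarrow> \<eta>"
  shows "limitin proj_topology (\<lambda>n. span {p n}) (span {vector [1, \<xi>, \<eta>]}) sequentially"
proof -
  let ?v = "vector [1, \<xi>, \<eta>] :: real^3"
  have v: "?v \<noteq> 0" using vector_3(1)[of 1 \<xi> \<eta>] by (metis zero_index zero_neq_one)
  define q :: "nat \<Rightarrow> real^3" where "q n = vector [1, p n $ 2 / p n $ 1, p n $ 3 / p n $ 1]" for n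
  have "q \<longlonglongrightarrow> ?v"
  proof (rule vec_tendstoI)
    show "(\<lambda>n. q n $ i) \<longlonglongrightarrow> ?v $ i" for i
      using exhaust_3[of i] lim by (auto simp: q_def vector_3)
  qed
  have "eventually (\<lambda>n. span {p n} \<in> U) sequentially" if U: "openin proj_topology U" "span {?v} \<in> U" for U
  proof -
    have "open {x. x \<noteq> 0 \<and> span {x} \<in> U}" using U unfolding openin_proj_topology by blast
    then have "eventually (\<lambda>n. q n \<in> {x. x \<noteq> 0 \<and> span {x} \<in> U}) sequentially"
      using \<open>q \<longlonglongrightarrow> ?v\<close> v U(2) by (intro topological_tendstoD) auto
    with nz show ?thesis
    proof eventually_elim
      case (elim n)
      have "q n = inverse (p n $ 1) *\<^sub>R p n"
        using elim by (simp add: q_def vec_eq_iff forall_3 vector_3 field_simps)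
      then show ?case using elim span_scaleR[of "inverse (p n $ 1)" "p n"] by simp
    qed
  qed
  then show ?thesis using v by (auto simp: limitin_def topspace_proj_topology)
qed

section \<open>Linear forms\<close>

text \<open>A point killed by two non-proportional forms is proportional to their cross product c.
  Since y is an integer multiple of a primitive point, c times the content of y is an integer
  multiple of y, and c has size at most 2 A B. The bounded contents are used through this
  lemma.\<close>

lemma form_cross_bound:
  assumes y: "mat_symmetric y" "form x0 x1 x2 y = 0" "form z0 z1 z2 y = 0" "y \<noteq> 0"
    and np: "\<not> (x0 * z1 = x1 * z0 \<and> x0 * z2 = x2 * z0 \<and> x1 * z2 = x2 * z1)"
    and A: "of_int \<bar>x0\<bar> \<le> A" "of_int \<bar>x1\<bar> \<le> A" "of_int \<bar>x2\<bar> \<le> A"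
    and B: "of_int \<bar>z0\<bar> \<le> B" "of_int \<bar>z1\<bar> \<le> B" "of_int \<bar>z2\<bar> \<le> B"
  shows "mat_height y \<le> of_int (mat_content y) * (2 * A * B)"
proof -
  let ?Y0 = "y$1$1" let ?Y1 = "y$1$2" let ?Y2 = "y$2$2" let ?g = "mat_content y"
  define c0 where "c0 = x1 * z2 - x2 * z1"
  define c1 where "c1 = x2 * z0 - x0 * z2"
  define c2 where "c2 = x0 * z1 - x1 * z0"
  have par: "c0 * ?Y1 = c1 * ?Y0" "c0 * ?Y2 = c2 * ?Y0" "c1 * ?Y2 = c2 * ?Y1"
    using y(2,3) unfolding form_def c0_def c1_def c2_def by algebra+
  obtain a b c where bz: "?g = a * ?Y0 + b * ?Y1 + c * ?Y2"
  proof -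
    obtain p q where pq: "p * ?Y1 + q * ?Y2 = gcd ?Y1 ?Y2" using bezout_int by blast
    obtain u v where "u * ?Y0 + v * gcd ?Y1 ?Y2 = ?g" using bezout_int unfolding mat_content_def by blast
    then have "?g = u * ?Y0 + (v * p) * ?Y1 + (v * q) * ?Y2"
      unfolding pq[symmetric] by (simp add: distrib_left mult.assoc)
    then show ?thesis by (rule that)
  qed
  \<comment> \<open>This m satisfies content * c = m * y: substitute the Bezout relation for the
    content and use that c and y are parallel. It is non-zero because c is.\<close>
  define m where "m = a * c0 + b * c1 + c * c2"
  have m: "?g * c0 = m * ?Y0" "?g * c1 = m * ?Y1" "?g * c2 = m * ?Y2"
    unfolding bz m_def using par by algebra+
  have g0: "?g \<ge> 0" by (simp add: mat_content_def)
  have "?g \<noteq> 0" using y(1,4) by (auto simp: mat_content_def mat_symmetric_iff mat_eq_iff_2)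
  then have "m \<noteq> 0" using np m unfolding c0_def c1_def c2_def by auto
  have le: "\<bar>real_of_int Y\<bar> \<le> of_int ?g * (2 * A * B)" if "?g * (p * q - p' * q') = m * Y"
    "\<bar>real_of_int p\<bar> \<le> A" "\<bar>real_of_int p'\<bar> \<le> A" "\<bar>real_of_int q\<bar> \<le> B" "\<bar>real_of_int q'\<bar> \<le> B" for Y p q p' q'
  proof -
    have "\<bar>Y\<bar> \<le> \<bar>m\<bar> * \<bar>Y\<bar>" using \<open>m \<noteq> 0\<close> mult_right_mono[of 1 "\<bar>m\<bar>" "\<bar>Y\<bar>"] by simp
    also have "\<dots> = ?g * \<bar>p * q - p' * q'\<bar>" using that(1) g0 by (metis abs_mult abs_of_nonneg)
    finally have "real_of_int \<bar>Y\<bar> \<le> of_int (?g * \<bar>p * q - p' * q'\<bar>)" by (rule of_int_le_iff[THEN iffD2])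
    then have "\<bar>real_of_int Y\<bar> \<le> of_int ?g * \<bar>real_of_int p * of_int q - of_int p' * of_int q'\<bar>" by simp
    also have "\<dots> \<le> of_int ?g * (2 * A * B)"
    proof (rule mult_left_mono)
      have "\<bar>real_of_int p * of_int q\<bar> \<le> A * B" "\<bar>real_of_int p' * of_int q'\<bar> \<le> A * B"
        using that unfolding abs_mult by (auto intro!: mult_mono)
      then show "\<bar>real_of_int p * of_int q - of_int p' * of_int q'\<bar> \<le> 2 * A * B" by linarith
    qed (use g0 in simp)
    finally show ?thesis .
  qed
  have "\<bar>of_int ?Y0\<bar> \<le> of_int ?g * (2 * A * B)" "\<bar>of_int ?Y1\<bar> \<le> of_int ?g * (2 * A * B)" "\<bar>of_int ?Y2\<bar> \<le> of_int ?g * (2 * A * B)"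
    using le m A B unfolding c0_def c1_def c2_def by auto
  then show ?thesis unfolding mat_height_sym[OF y(1)] by simp
qed

text \<open>\<open>par w x0 x1 x2\<close> says that the form \<open>(x0, x1, x2)\<close> is proportional to \<^term>\<open>skew w\<close>.\<close>

definition par :: "imat \<Rightarrow> int \<Rightarrow> int \<Rightarrow> int \<Rightarrow> bool" where
  "par w x0 x1 x2 \<longleftrightarrow> x0 * (w$1$1 - w$2$2) = x1 * (- w$2$1) \<and> x0 * w$1$2 = x2 * (- w$2$1) \<and>
     x1 * w$1$2 = x2 * (w$1$1 - w$2$2)"

lemma par_form:
  assumes "par w x0 x1 x2"
  shows "form x0 x1 x2 v * (- w$2$1) = x0 * skew w v"
    "form x0 x1 x2 v * (w$1$1 - w$2$2) = x1 * skew w v"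
    "form x0 x1 x2 v * w$1$2 = x2 * skew w v"
  using assms unfolding par_def skew_def form_def by algebra+

text \<open>The vectors y and \<open>w ** y\<close> are independent, with cross product
  \<open>det y\<close> times \<open>skew w\<close>, so a form vanishing at both is proportional to
  \<open>skew w\<close>.\<close>

lemma parI_form:
  assumes "mat_symmetric y" "mat_symmetric (w ** y)" "det y \<noteq> 0"
    "form x0 x1 x2 y = 0" "form x0 x1 x2 (w ** y) = 0"
  shows "par w x0 x1 x2"
proof -
  note minor = form_minor[OF assms(1,2)]
  have "det y * (x0 * (w$1$1 - w$2$2)) = det y * (x1 * (- w$2$1))"
    "det y * (x0 * w$1$2) = det y * (x2 * (- w$2$1))"
    "det y * (x1 * w$1$2) = det y * (x2 * (w$1$1 - w$2$2))"
    using minor assms(4,5) unfolding form_def by algebra+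
  then show ?thesis unfolding par_def mult_left_cancel[OF assms(3)] by blast
qed

lemma skew_height:
  "of_int \<bar>- w$2$1\<bar> \<le> 2 * mat_height w" "of_int \<bar>w$1$1 - w$2$2\<bar> \<le> 2 * mat_height w" "of_int \<bar>w$1$2\<bar> \<le> 2 * mat_height w"
  using mat_height_ge[of w 1 1] mat_height_ge[of w 2 2] mat_height_ge[of w 1 2] mat_height_ge[of w 2 1] mat_height_nonneg[of w]
  by auto

lemma par_cross_bound:
  assumes "mat_symmetric y" "form x0 x1 x2 y = 0" "skew w y = 0" "det y \<noteq> 0" "\<not> par w x0 x1 x2"
    and A: "of_int \<bar>x0\<bar> \<le> A" "of_int \<bar>x1\<bar> \<le> A" "of_int \<bar>x2\<bar> \<le> A"
  shows "mat_height y \<le> 4 * of_int (mat_content y) * A * mat_height w"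
proof -
  have "y \<noteq> 0" using assms(4) by (auto simp: det_2)
  from form_cross_bound[OF assms(1,2) assms(3)[unfolded skew_def] this assms(5)[unfolded par_def] A skew_height]
  show ?thesis by (simp add: mult_ac)
qed

section \<open>Numbers of Sturmian type\<close>

locale sturmian_number = sturmian +
  fixes \<xi> :: real
  assumes content: "\<exists>C. \<forall>i\<ge>-2. mat_content (sturm_y s w N i) \<le> C"
    and lim: "limitin proj_topology (\<lambda>n::nat. span {mat_point (sturm_y s w N (int n))})
       (span {vector [1, \<xi>, \<xi>\<^sup>2]}) sequentially"
begin

definition ev :: "int \<Rightarrow> int \<Rightarrow> int \<Rightarrow> real" where
  "ev x0 x1 x2 = of_int x0 + of_int x1 * \<xi> + of_int x2 * \<xi>\<^sup>2"

lemma y_near: "e > 0 \<Longrightarrow> eventually (\<lambda>i. \<bar>of_int (y i $1$2) - \<xi> * of_int (y i $1$1)\<bar> < e * \<bar>of_int (y i $1$1)\<bar> \<and>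
    \<bar>of_int (y i $2$2) - \<xi>\<^sup>2 * of_int (y i $1$1)\<bar> < e * \<bar>of_int (y i $1$1)\<bar>) sequentially"
  using limitin_projD[OF lim] by (simp add: y_def mat_point_def vector_3)

text \<open>One constant for two purposes: eventually the height of y_i is at most \<open>E\<close>
  times its first coordinate, and a form with |x1|, |x2| \<le> X, X \<ge> 1 and value at most 1 at
  \<xi> has |x0| \<le> E X.\<close>

definition E :: real where "E = 2 + \<bar>\<xi>\<bar> + \<xi>\<^sup>2"

lemma E_ge_1: "1 \<le> E"
  by (simp add: E_def add_nonneg_nonneg)

definition near :: "imat \<Rightarrow> real \<Rightarrow> bool" where
  "near v e \<longleftrightarrow> \<bar>of_int (v $1$2) - \<xi> * of_int (v $1$1)\<bar> \<le> e \<and> \<bar>of_int (v $2$2) - \<xi>\<^sup>2 * of_int (v $1$1)\<bar> \<le> e"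

lemma height_y_le: "eventually (\<lambda>i. mat_height (y i) \<le> E * \<bar>of_int (y i $1$1)\<bar>) sequentially"
  using y_near[OF zero_less_one]
proof eventually_elim
  case (elim i)
  let ?a = "\<bar>real_of_int (y i $1$1)\<bar>"
  have "\<bar>of_int (y i $1$2)\<bar> \<le> (1 + \<bar>\<xi>\<bar>) * ?a"
    unfolding distrib_right using elim abs_mult[of \<xi> "of_int (y i $1$1)"] by linarith
  also have "\<dots> \<le> E * ?a" unfolding E_def by (intro mult_right_mono) auto
  finally have 1: "\<bar>of_int (y i $1$2)\<bar> \<le> E * ?a" .
  have "\<bar>of_int (y i $2$2)\<bar> \<le> (1 + \<bar>\<xi>\<^sup>2\<bar>) * ?a"
    unfolding distrib_right using elim abs_mult[of "\<xi>\<^sup>2" "of_int (y i $1$1)"] by linarith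
  also have "\<dots> \<le> E * ?a" unfolding E_def by (intro mult_right_mono) auto
  finally have 2: "\<bar>of_int (y i $2$2)\<bar> \<le> E * ?a" .
  have "1 * ?a \<le> E * ?a" by (intro mult_right_mono E_ge_1) auto
  then show "mat_height (y i) \<le> E * ?a" unfolding mat_height_sym[OF y_sym] using 1 2 by simp
qed

text \<open>\<open>approximation\<close> supplies a limit of its own, identified with \<xi> by
  uniqueness of limits in the affine chart.\<close>

lemma y_approx: "\<exists>K>0. \<exists>i0. \<forall>i\<ge>i0. near (y i) (K * exp (- ((1 - \<delta>) * \<Lambda> i)))"
proof -
  have c: "1 / E > 0" using E_ge_1 by simp
  have ev: "eventually (\<lambda>i. \<bar>of_int (y i $1$1)\<bar> \<ge> 1 / E * mat_height (y i)) sequentially"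
    using height_y_le by eventually_elim (use E_ge_1 in \<open>simp add: field_simps\<close>)
  have lim_\<xi>: "(\<lambda>i. real_of_int (y i $1$2) / of_int (y i $1$1)) \<longlonglongrightarrow> \<xi>"
  proof (rule tendstoI)
    fix e :: real assume "e > 0"
    show "eventually (\<lambda>i. dist (real_of_int (y i $1$2) / of_int (y i $1$1)) \<xi> < e) sequentially"
      using y_near[OF \<open>e > 0\<close>]
    proof eventually_elim
      case (elim i)
      let ?a = "real_of_int (y i $1$1)"
      have a: "?a \<noteq> 0" using elim by auto
      have "dist (real_of_int (y i $1$2) / ?a) \<xi> = \<bar>(of_int (y i $1$2) - \<xi> * ?a) / ?a\<bar>"
        using a by (simp add: dist_real_def field_simps)
      also have "\<dots> < e" using elim a by (simp add: abs_divide divide_less_eq)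
      finally show ?case .
    qed
  qed
  show ?thesis
  proof (rule approximation[OF c ev])
    fix \<xi>' K i0
    assume K: "K > 0" "\<forall>i\<ge>i0. \<bar>of_int (y i $1$2) - \<xi>' * of_int (y i $1$1)\<bar> \<le> K * exp (- ((1 - \<delta>) * \<Lambda> i))"
    "\<forall>i\<ge>i0. \<bar>of_int (y i $2$2) - \<xi>'\<^sup>2 * of_int (y i $1$1)\<bar> \<le> K * exp (- ((1 - \<delta>) * \<Lambda> i))"
      and lim': "(\<lambda>i. real_of_int (y i $1$2) / of_int (y i $1$1)) \<longlonglongrightarrow> \<xi>'"
    have "\<xi>' = \<xi>" by (rule LIMSEQ_unique[OF lim' lim_\<xi>])
    with K show ?thesis unfolding near_def by blast
  qed
qed

text \<open>A single K replaces all implied constants. Numerical factors such as 4 and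
  \<open>E\<close> are absorbed into exp K, so that later estimates become linear inequalities
  between exponents.\<close>

lemma uniform_bounds:
  "\<exists>K\<ge>0. \<exists>i0. (\<forall>k j. j \<le> r k + 1 \<longrightarrow> \<bar>ht k j - (j * W (Suc k) + W k)\<bar> \<le> K) \<and>
    (\<forall>k. exp (\<delta> * W k - K) \<le> of_int \<bar>det (w k)\<bar>) \<and>
    (\<forall>i\<ge>i0. near (y i) (exp (K - (1 - \<delta>) * \<Lambda> i))) \<and>
    (\<forall>i\<ge>i0. \<Lambda> i \<le> \<Lambda> (Suc i)) \<and>
    (\<forall>i. of_int (mat_content (y i)) \<le> exp K) \<and>
    (\<forall>k. W (Suc k) \<le> W (Suc (Suc k)) + K) \<and>
    E \<le> exp K \<and> 4 \<le> exp K"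
proof -
  obtain K1 where K1: "K1 \<ge> 0" "\<And>k j. j \<le> r k + 1 \<Longrightarrow> \<bar>ht k j - (j * W (Suc k) + W k)\<bar> \<le> K1"
    using ht_bound by blast
  obtain K2 where K2: "K2 \<ge> 0" "\<And>k. \<bar>ln (of_int \<bar>det (w k)\<bar>) - \<delta> * W k\<bar> \<le> K2" using det_w_bound by blast
  obtain K4 i1 where K4: "K4 > 0" "\<forall>i\<ge>i1. near (y i) (K4 * exp (- ((1 - \<delta>) * \<Lambda> i)))"
    using y_approx by blast
  obtain i2 where i2: "\<And>i. i \<ge> i2 \<Longrightarrow> \<Lambda> (Suc i) \<ge> \<Lambda> i + 0"
    using \<Lambda>_growth[of 0] unfolding eventually_sequentially by blast
  obtain C where C: "\<And>i. i \<ge> -2 \<Longrightarrow> mat_content (sturm_y s w N i) \<le> C" using content by blast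
  obtain K5 where K5: "K5 \<ge> 0" "\<And>k. \<bar>W (Suc (Suc k)) - (r k * W (Suc k) + W k)\<bar> \<le> K5" using W_rec_bound by blast
  define D where "D = 4 + E + \<bar>of_int C\<bar> + K4"
  have D: "D \<ge> 4" "D \<ge> K4" "D \<ge> of_int C" "E \<le> D"
    using K4(1) E_ge_1 unfolding D_def by linarith+
  define K where "K = K1 + K2 + K5 + ln D"
  have "ln D \<ge> 0" using D by simp
  then have K: "K \<ge> 0" "K1 \<le> K" "K2 \<le> K" "K5 \<le> K" "ln D \<le> K"
    using K1(1) K2(1) K5(1) by (auto simp: K_def)
  have "exp (ln D) \<le> exp K" using K(5) by simp
  then have DK: "D \<le> exp K" using D(1) by simp
  show ?thesis
  proof (intro exI[of _ K] exI[of _ "max i1 i2"] conjI allI impI)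
    show "\<bar>ht k j - (j * W (Suc k) + W k)\<bar> \<le> K" if "j \<le> r k + 1" for k j using K1(2)[OF that] K by simp
    show "exp (\<delta> * W k - K) \<le> of_int \<bar>det (w k)\<bar>" for k
    proof -
      have "\<delta> * W k - K \<le> ln (of_int \<bar>det (w k)\<bar>)" using K2(2)[of k] K by linarith
      then have "exp (\<delta> * W k - K) \<le> exp (ln (of_int \<bar>det (w k)\<bar>))" by (simp only: exp_le_cancel_iff)
      then show ?thesis using det_w[of k] by simp
    qed
    have *: "K4 * exp (- ((1 - \<delta>) * \<Lambda> i)) \<le> exp (K - (1 - \<delta>) * \<Lambda> i)" for i
    proof -
      have "K4 * exp (- ((1 - \<delta>) * \<Lambda> i)) \<le> exp K * exp (- ((1 - \<delta>) * \<Lambda> i))"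
        using D DK by (intro mult_right_mono) auto
      then show ?thesis by (simp only: exp_add[symmetric]) simp
    qed
    show "near (y i) (exp (K - (1 - \<delta>) * \<Lambda> i))" if "i \<ge> max i1 i2" for i
      using K4(2) *[of i] that unfolding near_def by (meson max.boundedE order_trans)
    show "\<Lambda> i \<le> \<Lambda> (Suc i)" if "i \<ge> max i1 i2" for i using i2[of i] that by simp
    show "of_int (mat_content (y i)) \<le> exp K" for i
    proof -
      have "real_of_int (mat_content (y i)) \<le> of_int C" using C[of "int i"] by (simp add: y_def)
      then show ?thesis using D DK by linarith
    qed
    show "W (Suc k) \<le> W (Suc (Suc k)) + K" for k
    proof -
      have "1 * W (Suc k) \<le> r k * W (Suc k)" using r_ge_1[of k] W_nonneg[of "Suc k"] by (intro mult_right_mono) auto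
      then show ?thesis using K5(2)[of k] K W_nonneg[of k] by linarith
    qed
  qed (use D DK K in auto)
qed

lemma form_near:
  assumes "near v e" "of_int \<bar>x1\<bar> \<le> X" "of_int \<bar>x2\<bar> \<le> X"
  shows "\<bar>of_int (form x0 x1 x2 v) - of_int (v $1$1) * ev x0 x1 x2\<bar> \<le> 2 * X * e"
proof -
  have "of_int (form x0 x1 x2 v) - of_int (v $1$1) * ev x0 x1 x2 =
      of_int x1 * (of_int (v $1$2) - \<xi> * of_int (v $1$1)) + of_int x2 * (of_int (v $2$2) - \<xi>\<^sup>2 * of_int (v $1$1))"
    by (simp add: form_def ev_def algebra_simps)
  moreover have "\<bar>of_int x1 * (of_int (v $1$2) - \<xi> * of_int (v $1$1))\<bar> \<le> X * e"
    "\<bar>of_int x2 * (of_int (v $2$2) - \<xi>\<^sup>2 * of_int (v $1$1))\<bar> \<le> X * e"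
    using assms unfolding near_def abs_mult by (auto intro!: mult_mono)
  ultimately show ?thesis by linarith
qed

text \<open>By \<open>form_near\<close> the value at y_i is the first coordinate of y_i times the
  value at \<xi>, up to an error of at most half the lower bound m.\<close>

lemma ev_lower:
  assumes "near (y i) e" "of_int \<bar>x1\<bar> \<le> X" "of_int \<bar>x2\<bar> \<le> X" "2 * X * e \<le> m / 2" "m \<le> of_int \<bar>form x0 x1 x2 (y i)\<bar>"
  shows "m / 2 * exp (- \<Lambda> i) \<le> \<bar>ev x0 x1 x2\<bar>"
proof -
  have "m / 2 \<le> \<bar>of_int (y i $1$1) * ev x0 x1 x2\<bar>"
    using form_near[OF assms(1-3), of x0] assms(4,5) by simp
  also have "\<dots> \<le> exp (\<Lambda> i) * \<bar>ev x0 x1 x2\<bar>"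
    unfolding abs_mult exp_\<Lambda> by (intro mult_right_mono mat_height_ge) auto
  finally show ?thesis by (simp add: exp_minus field_simps)
qed

text \<open>The matrix \<open>u (Suc k) 0\<close> is a zero of the skew form of w_(k+2) but not of
  that of w_(k+1).\<close>

lemma not_both_par:
  assumes "par (w (Suc k)) x0 x1 x2" "par (w (Suc (Suc k))) x0 x1 x2"
  shows "x0 = 0 \<and> x1 = 0 \<and> x2 = 0"
proof -
  let ?v = "u (Suc k) 0"
  have "\<not> (w (Suc (Suc k)) $2$1 = 0 \<and> w (Suc (Suc k)) $1$1 = w (Suc (Suc k)) $2$2 \<and> w (Suc (Suc k)) $1$2 = 0)"
    using skew_u_Suc_nz[of "Suc k"] by (auto simp: skew_def form_def)
  then have "form x0 x1 x2 ?v = 0"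
    using par_form[OF assms(2), of ?v] skew_u[of "Suc k" 0] by auto
  then show ?thesis using par_form[OF assms(1), of ?v] skew_u_Suc_nz[of k] by auto
qed

text \<open>For proportional forms, coefficient of one times value of the other is symmetric in the
  two.\<close>

lemma par_ev:
  assumes "par (w k) x0 x1 x2" "a \<in> {\<bar>x0\<bar>, \<bar>x1\<bar>, \<bar>x2\<bar>}"
  shows "of_int a * \<bar>ev (- w k $2$1) (w k $1$1 - w k $2$2) (w k $1$2)\<bar> \<le> \<bar>ev x0 x1 x2\<bar> * (2 * mat_height (w k))"
proof -
  let ?z = "ev (- w k $2$1) (w k $1$1 - w k $2$2) (w k $1$2)"
  let ?p = "- w k $2$1" let ?q = "w k $1$1 - w k $2$2" let ?r = "w k $1$2"
  have "of_int x0 * of_int ?q = of_int x1 * real_of_int ?p" "of_int x0 * of_int ?r = of_int x2 * real_of_int ?p"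
     "of_int x1 * of_int ?r = of_int x2 * real_of_int ?q"
    using assms(1) unfolding par_def by (metis of_int_mult)+
  then have *: "of_int x0 * ?z = ev x0 x1 x2 * of_int ?p" "of_int x1 * ?z = ev x0 x1 x2 * of_int ?q"
    "of_int x2 * ?z = ev x0 x1 x2 * of_int ?r"
    unfolding ev_def by algebra+
  have "of_int \<bar>x\<bar> * \<bar>?z\<bar> \<le> \<bar>ev x0 x1 x2\<bar> * (2 * mat_height (w k))"
    if "of_int x * ?z = ev x0 x1 x2 * of_int p" "of_int \<bar>p\<bar> \<le> 2 * mat_height (w k)" for x p
  proof -
    have "of_int \<bar>x\<bar> * \<bar>?z\<bar> = \<bar>ev x0 x1 x2\<bar> * of_int \<bar>p\<bar>" using that(1) by (metis abs_mult of_int_abs)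
    then show ?thesis using that(2) by (simp add: mult_left_mono)
  qed
  from this[OF *(1) skew_height(1)] this[OF *(2) skew_height(2)] this[OF *(3) skew_height(3)] assms(2) show ?thesis by auto
qed

section \<open>The value at \<xi> of the form attached to w_(k+1)\<close>

definition zev :: "nat \<Rightarrow> real" where
  "zev k = \<bar>ev (- w (Suc k) $2$1) (w (Suc k) $1$1 - w (Suc k) $2$2) (w (Suc k) $1$2)\<bar>"

text \<open>This is (2 - \<delta>) h - W_(k+1) with h = W_(k+1) + W_(k+2), the logarithmic height of
  a zero of the form. It is minus the logarithm of \<open>zev k\<close>, up to a bounded
  error.\<close>

definition zexp :: "nat \<Rightarrow> real" where
  "zexp k = 2 * W (Suc (Suc k)) + W (Suc k) - \<delta> * (W (Suc k) + W (Suc (Suc k)))"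

text \<open>Evaluate at y_(T (k+1)), which is both the end of chain k, where the form vanishes, and
  \<open>u (Suc k) 1\<close>, of logarithmic height about W_(k+1) + W_(k+2). Only the approximation
  error is left.\<close>

lemma zev_le: obtains K k0 where "\<And>k. k \<ge> k0 \<Longrightarrow> zev k \<le> exp (K - zexp k)"
proof -
  obtain K i0 where K: "K \<ge> 0"
    "\<forall>k j. j \<le> r k + 1 \<longrightarrow> \<bar>ht k j - (j * W (Suc k) + W k)\<bar> \<le> K"
    "\<forall>i\<ge>i0. near (y i) (exp (K - (1 - \<delta>) * \<Lambda> i))"
    "4 \<le> exp K"
    using uniform_bounds by blast
  note K = K[rule_format]
  obtain i1 where i1: "\<And>i. i \<ge> i1 \<Longrightarrow> mat_height (y i) \<le> E * \<bar>of_int (y i $1$1)\<bar>"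
    using height_y_le unfolding eventually_sequentially by blast
  have E: "E > 0" using E_ge_1 by simp
  have "zev k \<le> exp ((6 * K + ln E) - zexp k)" if "k \<ge> max i0 i1" for k
  proof -
    let ?i = "T (Suc k)"
    have i: "?i \<ge> i0" "?i \<ge> i1" using le_T[of "Suc k"] that by auto
    have yi: "y ?i = u (Suc k) 1" using y_eq[of 0 "Suc k"] by simp
    let ?a = "\<bar>real_of_int (y ?i $1$1)\<bar>"
    have a: "exp (\<Lambda> ?i) \<le> E * ?a" unfolding exp_\<Lambda> by (rule i1[OF i(2)])
    have f0: "form (- w (Suc k) $2$1) (w (Suc k) $1$1 - w (Suc k) $2$2) (w (Suc k) $1$2) (y ?i) = 0"
      unfolding yi using skew_u[of k "Suc (r k)"] by (simp add: u_Suc_r skew_def)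
    from form_near[OF K(3)[OF i(1)] skew_height(2)[of "w (Suc k)"] skew_height(3)[of "w (Suc k)"], of "- w (Suc k) $2$1", unfolded f0]
    have "?a * zev k \<le> 2 * (2 * mat_height (w (Suc k))) * exp (K - (1 - \<delta>) * \<Lambda> ?i)"
      by (simp add: zev_def abs_mult)
    then have "E * (?a * zev k) \<le> E * (4 * exp (W (Suc k)) * exp (K - (1 - \<delta>) * \<Lambda> ?i))"
      using E by (intro mult_left_mono) (auto simp: exp_W)
    moreover have "exp (\<Lambda> ?i) * zev k \<le> E * ?a * zev k"
      by (rule mult_right_mono[OF a]) (simp add: zev_def)
    ultimately have "exp (\<Lambda> ?i) * zev k \<le> E * (4 * exp (W (Suc k)) * exp (K - (1 - \<delta>) * \<Lambda> ?i))"
      by (simp add: mult.assoc)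
    also have "\<dots> \<le> E * (exp K * exp (W (Suc k)) * exp (K - (1 - \<delta>) * \<Lambda> ?i))"
      using K(4) E by (intro mult_left_mono mult_right_mono) auto
    also have "\<dots> = exp (ln E + (K + W (Suc k) + (K - (1 - \<delta>) * \<Lambda> ?i)))"
      using E by (simp only: exp_add) simp
    finally have "zev k \<le> exp (ln E + (K + W (Suc k) + (K - (1 - \<delta>) * \<Lambda> ?i))) * exp (- \<Lambda> ?i)"
      by (simp add: exp_minus field_simps)
    also have "\<dots> = exp (ln E + 2 * K + W (Suc k) - (2 - \<delta>) * \<Lambda> ?i)"
      by (simp only: exp_add[symmetric]) (simp add: algebra_simps)
    also have "\<dots> \<le> exp ((6 * K + ln E) - zexp k)"
    proof -
      have "\<Lambda> ?i = ht (Suc k) 1" using \<Lambda>_T[of 0 "Suc k"] by simp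
      then have "\<Lambda> ?i \<ge> W (Suc (Suc k)) + W (Suc k) - K" using K(2)[of 1 "Suc k"] by simp
      then have "(2 - \<delta>) * (W (Suc (Suc k)) + W (Suc k) - K) \<le> (2 - \<delta>) * \<Lambda> ?i"
        using delta by (intro mult_left_mono) auto
      moreover have "(2 - \<delta>) * K \<le> 2 * K" using delta K(1) by (intro mult_right_mono) auto
      moreover have "(2 - \<delta>) * (W (Suc (Suc k)) + W (Suc k) - K) = W (Suc k) + zexp k - (2 - \<delta>) * K"
        by (simp add: zexp_def algebra_simps)
      ultimately show ?thesis using K(1) by simp
    qed
    finally show ?thesis .
  qed
  then show ?thesis by (rule that)
qed

text \<open>Evaluate at the next point \<open>u (Suc k) 2\<close>. In the Cayley-Hamilton recurrence
  the term with \<open>u (Suc k) 1\<close> vanishes. What remains is det w_(k+2) times the value at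
  \<open>u (Suc k) 0\<close>, itself at least |det w_(k+1)| in absolute value. Dividing by the
  height of that point gives exactly the exponent \<open>zexp k\<close>.\<close>

lemma zev_ge: obtains K k0 where "\<And>k. k \<ge> k0 \<Longrightarrow> zev k \<ge> exp (- K - zexp k)"
proof -
  obtain K i0 where K: "K \<ge> 0"
    "\<forall>k j. j \<le> r k + 1 \<longrightarrow> \<bar>ht k j - (j * W (Suc k) + W k)\<bar> \<le> K"
    "\<forall>k. exp (\<delta> * W k - K) \<le> of_int \<bar>det (w k)\<bar>"
    "\<forall>i\<ge>i0. near (y i) (exp (K - (1 - \<delta>) * \<Lambda> i))"
    "4 \<le> exp K"
    using uniform_bounds by blast
  note K = K[rule_format]
  obtain k1 where k1: "\<And>k. k \<ge> k1 \<Longrightarrow> W k \<ge> 8 * K / (2 - \<delta>)"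
    using W_lim unfolding filterlim_at_top eventually_sequentially by metis
  have "zev k \<ge> exp (- (4 * K) - zexp k)" if "k \<ge> max i0 k1" for k
  proof -
    let ?i = "T (Suc k) + 1"
    have i: "?i \<ge> i0" using le_T[of "Suc k"] that by auto
    have yi: "y ?i = u (Suc k) 2" using y_eq[of 1 "Suc k"] r_ge_1[of "Suc k"] by (simp add: numeral_2_eq_2)
    have \<Lambda>i: "\<bar>\<Lambda> ?i - (2 * W (Suc (Suc k)) + W (Suc k))\<bar> \<le> K"
      using \<Lambda>_T[of 1 "Suc k"] r_ge_1[of "Suc k"] K(2)[of 2 "Suc k"] by (simp add: numeral_2_eq_2)
    let ?A = "skew (w (Suc k)) (y ?i)"
    have "?A = - (det (w (Suc (Suc k))) * skew (w (Suc k)) (u (Suc k) 0))"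
      unfolding yi skew_def numeral_2_eq_2 form_u_rec[of _ _ _ "Suc k" 0]
      using skew_u[of k "Suc (r k)"] by (simp add: skew_def u_Suc_r)
    then have A: "\<bar>det (w (Suc (Suc k)))\<bar> * \<bar>det (w (Suc k))\<bar> \<le> \<bar>?A\<bar>"
      using abs_skew_u_Suc_ge[of k] by (simp add: abs_mult mult_left_mono)
    define m where "m = exp (\<delta> * W (Suc (Suc k)) - K) * exp (\<delta> * W (Suc k) - K)"
    have "m \<le> of_int \<bar>det (w (Suc (Suc k)))\<bar> * of_int \<bar>det (w (Suc k))\<bar>"
      unfolding m_def by (intro mult_mono K(3)) auto
    also have "\<dots> = real_of_int (\<bar>det (w (Suc (Suc k)))\<bar> * \<bar>det (w (Suc k))\<bar>)" by simp
    also have "\<dots> \<le> of_int \<bar>?A\<bar>" using A by (rule of_int_le_iff[THEN iffD2])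
    finally have mA: "m \<le> of_int \<bar>?A\<bar>" .
    \<comment> \<open>The exponent of the error differs from that of m by (2 - \<delta>) W_(k+2), up
      to constants; \<open>k1\<close> was chosen to make this at least 8 K.\<close>
    have small: "2 * (2 * mat_height (w (Suc k))) * exp (K - (1 - \<delta>) * \<Lambda> ?i) \<le> m / 2"
    proof -
      have "(1 - \<delta>) * (2 * W (Suc (Suc k)) + W (Suc k) - K) \<le> (1 - \<delta>) * \<Lambda> ?i"
        using \<Lambda>i delta by (intro mult_left_mono) auto
      moreover have "(1 - \<delta>) * K \<le> K" using K(1) delta by (simp add: mult_left_le_one_le)
      moreover have "(1 - \<delta>) * (2 * W (Suc (Suc k)) + W (Suc k) - K) =
         W (Suc k) + (2 - \<delta>) * W (Suc (Suc k)) - \<delta> * (W (Suc k) + W (Suc (Suc k))) - (1 - \<delta>) * K"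
        by (simp add: algebra_simps)
      moreover have "(2 - \<delta>) * W (Suc (Suc k)) \<ge> 8 * K"
        using k1[of "Suc (Suc k)"] that delta by (simp add: divide_le_eq mult.commute)
      ultimately have "2 * K + W (Suc k) + (K - (1 - \<delta>) * \<Lambda> ?i) \<le> \<delta> * (W (Suc k) + W (Suc (Suc k))) - 2 * K"
        using K(1) by linarith
      then have "exp (2 * K + W (Suc k) + (K - (1 - \<delta>) * \<Lambda> ?i)) \<le> m"
        unfolding m_def exp_add[symmetric] by (simp add: algebra_simps)
      moreover have "exp (2 * K + W (Suc k) + (K - (1 - \<delta>) * \<Lambda> ?i)) = exp K * exp K * (mat_height (w (Suc k)) * exp (K - (1 - \<delta>) * \<Lambda> ?i))"
        by (simp only: exp_add exp_W[symmetric] mult_2)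
      moreover have "8 * (mat_height (w (Suc k)) * exp (K - (1 - \<delta>) * \<Lambda> ?i)) \<le> exp K * exp K * (mat_height (w (Suc k)) * exp (K - (1 - \<delta>) * \<Lambda> ?i))"
        using mult_mono[OF K(5) K(5)] by (intro mult_right_mono) (auto simp: mat_height_nonneg)
      ultimately show ?thesis by simp
    qed
    from ev_lower[OF K(4)[OF i] skew_height(2,3)[of "w (Suc k)"] small mA[unfolded skew_def]]
    have "m / 2 * exp (- \<Lambda> ?i) \<le> zev k" by (simp add: zev_def)
    moreover have "exp (- K) * m * exp (- \<Lambda> ?i) \<le> m / 2 * exp (- \<Lambda> ?i)"
    proof -
      have "exp (- K) \<le> 1 / 2" using K(5) by (simp add: exp_minus field_simps)
      then have "exp (- K) * m \<le> 1 / 2 * m" by (intro mult_right_mono) (auto simp: m_def)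
      then show ?thesis by (intro mult_right_mono) auto
    qed
    moreover have "exp (- (4 * K) - zexp k) \<le> exp (- K) * m * exp (- \<Lambda> ?i)"
      unfolding m_def exp_add[symmetric] using \<Lambda>i by (simp add: zexp_def algebra_simps)
    ultimately show ?thesis by linarith
  qed
  then show ?thesis by (rule that)
qed

end

lemma le_exp_multD: "a \<le> exp q * b \<Longrightarrow> a * exp (- q) \<le> b" for a b q :: real
  by (simp add: exp_minus field_simps)

section \<open>Lower bounds for arbitrary integer forms\<close>

context sturmian_number
begin

lemma mat_content_nonneg: "0 \<le> mat_content A"
  by (simp add: mat_content_def)

lemma skew_nz: "\<not> (w (Suc k) $2$1 = 0 \<and> w (Suc k) $1$1 = w (Suc k) $2$2 \<and> w (Suc k) $1$2 = 0)"
  using skew_u_Suc_nz[of k] by (auto simp: skew_def form_def)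

lemma par_form_u: "par (w (Suc k)) x0 x1 x2 \<Longrightarrow> form x0 x1 x2 (u k j) = 0"
  using par_form[of "w (Suc k)" x0 x1 x2 "u k j"] skew_nz[of k] skew_u[of k j] by auto

text \<open>A form proportional to \<open>skew (w (Suc k))\<close> could be much shorter if the
  coefficients of the latter had a large common divisor. This is excluded as follows: the form is
  not proportional to \<open>skew (w k)\<close>, yet both vanish at y_(T k), of logarithmic height
  about W_k + W_(k+1). So \<open>par_cross_bound\<close> makes its size at least a constant times
  exp W_(k+1).\<close>

lemma par_bounds:
  "\<exists>K\<ge>0. \<exists>k1. \<forall>k\<ge>k1. \<forall>x0 x1 x2 X. (x0, x1, x2) \<noteq> (0, 0, 0) \<and> par (w (Suc k)) x0 x1 x2 \<and> X > 0 \<and>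
     of_int \<bar>x0\<bar> \<le> E * X \<and> of_int \<bar>x1\<bar> \<le> E * X \<and> of_int \<bar>x2\<bar> \<le> E * X \<longrightarrow>
     ln X \<ge> W (Suc k) - K \<and> \<bar>ev x0 x1 x2\<bar> \<ge> exp (- (zexp k + K))"
proof -
  obtain K i0 where K: "K \<ge> 0"
    "\<forall>k j. j \<le> r k + 1 \<longrightarrow> \<bar>ht k j - (j * W (Suc k) + W k)\<bar> \<le> K"
    "\<forall>i. of_int (mat_content (y i)) \<le> exp K"
    "E \<le> exp K" "4 \<le> exp K"
    using uniform_bounds by blast
  note K = K[rule_format]
  obtain K' k1 where K': "\<And>k. k \<ge> k1 \<Longrightarrow> zev k \<ge> exp (- K' - zexp k)" using zev_ge by blast
  define K'' where "K'' = 5 * K + \<bar>K'\<bar>"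
  show ?thesis
  proof (intro exI[of _ K''] exI[of _ "Suc k1"] conjI allI impI; (elim conjE)?)
    show "K'' \<ge> 0" using K(1) by (simp add: K''_def)
    fix k x0 x1 x2 and X :: real
    assume k: "Suc k1 \<le> k" and x: "(x0, x1, x2) \<noteq> (0, 0, 0)" "par (w (Suc k)) x0 x1 x2" and X: "X > 0"
      and xX: "of_int \<bar>x0\<bar> \<le> E * X" "of_int \<bar>x1\<bar> \<le> E * X" "of_int \<bar>x2\<bar> \<le> E * X"
    obtain k' where k': "k = Suc k'" using k by (cases k) auto
    have np: "\<not> par (w (Suc k')) x0 x1 x2" using not_both_par[of k' x0 x1 x2] x k' by auto
    have f: "form x0 x1 x2 (u k 1) = 0" by (rule par_form_u[OF x(2)])
    have s: "skew (w (Suc k')) (u k 1) = 0" using skew_u[of k' "Suc (r k')"] by (simp add: u_Suc_r k')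
    have yk: "y (T k) = u k 1" using y_eq[of 0 k] by simp
    have cont: "of_int (mat_content (u k 1)) \<le> exp K" using K(3)[of "T k"] unfolding yk .
    \<comment> \<open>Needed for two values of A: \<open>E * X\<close> bounds X from below, and the
      largest coefficient itself turns the bound on \<open>zev\<close> into one on the value of the
      form.\<close>
    have key: "exp (W (Suc k) - 3 * K) \<le> A" if A: "of_int \<bar>x0\<bar> \<le> A" "of_int \<bar>x1\<bar> \<le> A" "of_int \<bar>x2\<bar> \<le> A" for A
    proof -
      have A0: "A \<ge> 0" using A(1) by (rule order_trans[rotated]) simp
      have "exp (W (Suc k) + W k - K) \<le> exp (ht k 1)" using K(2)[of 1 k] by simp
      also have "\<dots> \<le> 4 * of_int (mat_content (u k 1)) * A * mat_height (w (Suc k'))"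
        unfolding exp_ht by (rule par_cross_bound[OF u_sym f s det_u_nz np A])
      also have "\<dots> \<le> exp K * exp K * A * exp (W k)"
        unfolding exp_W k' using cont[unfolded k'] K(5) A0
        by (intro mult_mono) (auto simp: mat_content_nonneg mat_height_nonneg)
      also have "\<dots> = exp (K + K + W k) * A" by (simp only: exp_add mult_ac)
      finally have "exp (W (Suc k) + W k - K) * exp (- (K + K + W k)) \<le> A"
        by (rule le_exp_multD)
      then show ?thesis by (simp only: exp_add[symmetric]) (simp add: algebra_simps)
    qed
    have "exp (W (Suc k) - 3 * K) \<le> exp K * X"
      using order_trans[OF key[OF xX] mult_right_mono[OF K(4)]] X by simp
    then have "ln (exp (W (Suc k) - 3 * K)) \<le> ln (exp K * X)"
      using X by (subst ln_le_cancel_iff) auto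
    then have "W (Suc k) - 4 * K \<le> ln X" using X by (simp add: ln_mult)
    then show "W (Suc k) - K'' \<le> ln X" using K(1) by (simp add: K''_def)
    obtain a where a: "a \<in> {\<bar>x0\<bar>, \<bar>x1\<bar>, \<bar>x2\<bar>}" "\<bar>x0\<bar> \<le> a" "\<bar>x1\<bar> \<le> a" "\<bar>x2\<bar> \<le> a"
      by (rule that[of "max \<bar>x0\<bar> (max \<bar>x1\<bar> \<bar>x2\<bar>)"]) (auto simp: max_def)
    have "exp (W (Suc k) - 3 * K) \<le> of_int a" by (rule key) (use a in auto)
    then have "exp (W (Suc k) - 3 * K) * zev k \<le> of_int a * zev k"
      by (rule mult_right_mono) (simp add: zev_def)
    also have "\<dots> \<le> \<bar>ev x0 x1 x2\<bar> * (2 * exp (W (Suc k)))"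
      unfolding exp_W zev_def by (rule par_ev[OF x(2) a(1)])
    also have "\<dots> \<le> \<bar>ev x0 x1 x2\<bar> * (exp K * exp (W (Suc k)))"
      using K(5) by (intro mult_left_mono mult_right_mono) auto
    also have "\<dots> = exp (K + W (Suc k)) * \<bar>ev x0 x1 x2\<bar>" by (simp only: exp_add mult_ac)
    finally have "exp (W (Suc k) - 3 * K) * zev k * exp (- (K + W (Suc k))) \<le> \<bar>ev x0 x1 x2\<bar>"
      by (rule le_exp_multD)
    moreover have "exp (W (Suc k) - 3 * K) * exp (- K' - zexp k) * exp (- (K + W (Suc k))) \<le> exp (W (Suc k) - 3 * K) * zev k * exp (- (K + W (Suc k)))"
      using K'[of k] k by (intro mult_right_mono mult_left_mono) auto
    moreover have "exp (- (zexp k + K'')) \<le> exp (W (Suc k) - 3 * K) * exp (- K' - zexp k) * exp (- (K + W (Suc k)))"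
      unfolding exp_add[symmetric] using K(1) by (simp add: K''_def)
    ultimately show "exp (- (zexp k + K'')) \<le> \<bar>ev x0 x1 x2\<bar>" by linarith
  qed
qed

text \<open>The alternatives are: the form is non-zero at the decisive point y_i; it vanishes there
  but not at the next point; or it is proportional to \<open>skew (w k)\<close>, with exponent
  \<open>zexp (k - 1)\<close>. In the first two, A stands for a logarithmic height, normally that of
  y_(i-1), of which only A \<ge> W k matters later.\<close>

definition small_form_case :: "real \<Rightarrow> nat \<Rightarrow> real \<Rightarrow> real \<Rightarrow> bool" where
  "small_form_case K k X v \<longleftrightarrow>
     (\<exists>A\<ge>W k. ln X \<ge> (1 - \<delta>) * A - K \<and> v \<ge> exp (- (A + W k + K))) \<or>
     (\<exists>A\<ge>W k. ln X \<ge> A - K \<and> v \<ge> exp (- (A + (2 - \<delta>) * W k + K))) \<or>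
     (ln X \<ge> W k - K \<and> v \<ge> exp (- (2 * W (Suc k) + W k - \<delta> * (W k + W (Suc k)) + K)))"

text \<open>The decisive index i is the first one at which the approximation error of a form of size
  X is at most 1/2 of a non-zero integer. Being first, it makes X at least about exp ((1 - \<delta>)
  \<Lambda>_(i-1)). The constant K is fixed before \<open>k0\<close>, so that later
  \<open>k0\<close> can be taken so large that W beats K.\<close>

lemma small_form_cases:
  "\<exists>K\<ge>0. \<forall>k0. \<exists>X0\<ge>1. \<forall>X\<ge>X0. \<forall>x0 x1 x2. (x0, x1, x2) \<noteq> (0, 0, 0) \<and> of_int \<bar>x1\<bar> \<le> X \<and> of_int \<bar>x2\<bar> \<le> X \<and> \<bar>ev x0 x1 x2\<bar> \<le> 1 \<longrightarrow>
     (\<exists>k\<ge>k0. small_form_case K k X \<bar>ev x0 x1 x2\<bar>)"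
proof -
  obtain K i0 where K: "K \<ge> 0"
    "\<forall>k j. j \<le> r k + 1 \<longrightarrow> \<bar>ht k j - (j * W (Suc k) + W k)\<bar> \<le> K"
    "\<forall>k. exp (\<delta> * W k - K) \<le> of_int \<bar>det (w k)\<bar>"
    "\<forall>i\<ge>i0. near (y i) (exp (K - (1 - \<delta>) * \<Lambda> i))"
    "\<forall>i\<ge>i0. \<Lambda> i \<le> \<Lambda> (Suc i)"
    "\<forall>i. of_int (mat_content (y i)) \<le> exp K"
    "\<forall>k. W (Suc k) \<le> W (Suc (Suc k)) + K"
    "E \<le> exp K" "4 \<le> exp K"
    using uniform_bounds by blast
  note K = K[rule_format]
  obtain K' k1 where K': "K' \<ge> 0" "\<forall>k\<ge>k1. \<forall>x0 x1 x2 X. (x0, x1, x2) \<noteq> (0, 0, 0) \<and> par (w (Suc k)) x0 x1 x2 \<and> X > 0 \<and>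
     of_int \<bar>x0\<bar> \<le> E * X \<and> of_int \<bar>x1\<bar> \<le> E * X \<and> of_int \<bar>x2\<bar> \<le> E * X \<longrightarrow>
     ln X \<ge> W (Suc k) - K' \<and> \<bar>ev x0 x1 x2\<bar> \<ge> exp (- (zexp k + K'))"
    using par_bounds by blast
  define M where "M = 5 * K + K'"
  have M: "M \<ge> 0" "5 * K \<le> M" "K' \<le> M" using K(1) K'(1) by (auto simp: M_def)
  have "\<exists>X0\<ge>1. \<forall>X\<ge>X0. \<forall>x0 x1 x2. (x0, x1, x2) \<noteq> (0, 0, 0) \<and> of_int \<bar>x1\<bar> \<le> X \<and> of_int \<bar>x2\<bar> \<le> X \<and> \<bar>ev x0 x1 x2\<bar> \<le> 1 \<longrightarrow>
     (\<exists>k\<ge>k0. small_form_case M k X \<bar>ev x0 x1 x2\<bar>)" for k0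
  proof -
    define i1 where "i1 = max i0 (T (max k0 k1))"
    \<comment> \<open>Chosen so that i1 is not \<open>good\<close> for X \<ge> X0: the least good
      index then has a predecessor h \<ge> i1, where the uniform bounds hold.\<close>
    define X0 where "X0 = exp ((1 - \<delta>) * \<Lambda> i1)"
    have X0: "X0 \<ge> 1" using delta height_y_ge_1[of i1] by (simp add: X0_def \<Lambda>_def)
    have "\<exists>k\<ge>k0. small_form_case M k X \<bar>ev x0 x1 x2\<bar>"
      if X: "X \<ge> X0" and x: "(x0, x1, x2) \<noteq> (0, 0, 0)" and x12: "of_int \<bar>x1\<bar> \<le> X" "of_int \<bar>x2\<bar> \<le> X"
        and ev1: "\<bar>ev x0 x1 x2\<bar> \<le> 1" for X x0 x1 x2
    proof -
      let ?v = "\<bar>ev x0 x1 x2\<bar>"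
      have X1: "X \<ge> 1" using X X0 by simp
      have E1: "1 * X \<le> E * X" using X1 by (intro mult_right_mono E_ge_1) auto
      have xE: "of_int \<bar>x0\<bar> \<le> E * X" "of_int \<bar>x1\<bar> \<le> E * X" "of_int \<bar>x2\<bar> \<le> E * X"
      proof -
        have "\<bar>of_int x1 * \<xi>\<bar> \<le> \<bar>\<xi>\<bar> * X"
          using mult_left_mono[OF x12(1), of "\<bar>\<xi>\<bar>"] by (simp add: abs_mult mult.commute)
        moreover have "\<bar>of_int x2 * \<xi>\<^sup>2\<bar> \<le> \<xi>\<^sup>2 * X"
          using mult_left_mono[OF x12(2), of "\<xi>\<^sup>2"] by (simp add: abs_mult mult.commute)
        moreover have "real_of_int x0 = ev x0 x1 x2 - of_int x1 * \<xi> - of_int x2 * \<xi>\<^sup>2" by (simp add: ev_def)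
        ultimately have "\<bar>real_of_int x0\<bar> \<le> 1 * X + \<bar>\<xi>\<bar> * X + \<xi>\<^sup>2 * X" using ev1 X1 by linarith
        then show "of_int \<bar>x0\<bar> \<le> E * X" using X1 by (simp add: E_def distrib_right)
      qed (use x12 E1 in linarith)+
      define good where "good i \<longleftrightarrow> i \<ge> i1 \<and> 2 * X * exp (K - (1 - \<delta>) * \<Lambda> i) \<le> 1 / 2" for i
      have "\<exists>i. good i"
      proof -
        obtain j where j: "\<And>i. i \<ge> j \<Longrightarrow> \<Lambda> i \<ge> (K + ln (4 * X)) / (1 - \<delta>)"
          using \<Lambda>_lim unfolding filterlim_at_top eventually_sequentially by metis
        let ?i = "max i1 j"
        have "K + ln (4 * X) \<le> (1 - \<delta>) * \<Lambda> ?i" using j[of ?i] delta by (simp add: divide_le_eq mult.commute)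
        then have "exp (K - (1 - \<delta>) * \<Lambda> ?i) \<le> exp (- ln (4 * X))" by simp
        also have "\<dots> = 1 / (4 * X)" using X1 by (simp add: exp_minus inverse_eq_divide)
        finally have "good ?i" using X1 by (simp add: good_def field_simps)
        then show ?thesis ..
      qed
      define i where "i = (LEAST i. good i)"
      have gi: "good i" unfolding i_def using \<open>\<exists>i. good i\<close> by (rule LeastI_ex)
      have "\<not> good i1"
      proof -
        have "1 \<le> X * exp (- ((1 - \<delta>) * \<Lambda> i1))"
          using mult_right_mono[OF X[unfolded X0_def], of "exp (- ((1 - \<delta>) * \<Lambda> i1))"] by (simp only: exp_minus_inverse exp_ge_zero)
        also have "\<dots> \<le> X * exp (K - (1 - \<delta>) * \<Lambda> i1)" using K(1) X1 by (intro mult_left_mono) auto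
        finally show ?thesis by (simp add: good_def)
      qed
      then have "i \<noteq> i1" using gi by auto
      then obtain h where h: "i = Suc h" "h \<ge> i1" using gi by (cases i) (auto simp: good_def)
      have "\<not> good h" using not_less_Least[of h good] h by (simp add: i_def)
      then have nh: "2 * X * exp (K - (1 - \<delta>) * \<Lambda> h) > 1 / 2" using h by (simp add: good_def)
      have lnX: "(1 - \<delta>) * \<Lambda> h - 2 * K \<le> ln X"
      proof -
        have "1 \<le> (4 * X) * exp (K - (1 - \<delta>) * \<Lambda> h)" using nh by simp
        also have "\<dots> \<le> (exp K * X) * exp (K - (1 - \<delta>) * \<Lambda> h)" using K(9) X1 by (intro mult_right_mono) auto
        also have "\<dots> = exp (K + ln X + (K - (1 - \<delta>) * \<Lambda> h))"
          using X1 by (simp only: exp_add) simp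
        finally show ?thesis by simp
      qed
      have i0: "i \<ge> i0" "h \<ge> i0" "Suc i \<ge> i0" using h by (auto simp: i1_def)
      obtain k l where kl: "h = T k + l" "l < r k" "y h = u k (Suc l)" "y i = u k (Suc (Suc l))" and k: "max k0 k1 \<le> k"
        using y_cases[of h] h unfolding i1_def by (metis max.boundedE)
      have \<Lambda>h: "\<Lambda> h = ht k (Suc l)" using \<Lambda>_T[of l k] kl by simp
      have \<Lambda>i: "\<Lambda> i = ht k (Suc (Suc l))" using \<Lambda>_T[of "Suc l" k] kl h by simp
      define A where "A = real (Suc l) * W (Suc k) + W k"
      have "A = W (Suc k) + (real l * W (Suc k) + W k)" by (simp add: A_def algebra_simps)
      then have A: "A \<ge> W (Suc k)" using W_nonneg[of "Suc k"] W_nonneg[of k] by simp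
      have hA: "\<bar>\<Lambda> h - A\<bar> \<le> K" using K(2)[of "Suc l" k] kl(2) unfolding \<Lambda>h A_def by simp
      have iA: "\<bar>\<Lambda> i - (A + W (Suc k))\<bar> \<le> K" using K(2)[of "Suc (Suc l)" k] kl(2) unfolding \<Lambda>i A_def by (simp add: algebra_simps)
      have gi': "2 * X * exp (K - (1 - \<delta>) * \<Lambda> i) \<le> 1 / 2" using gi by (simp add: good_def)
      have eK: "exp (- K) \<le> 1 / 2" using K(9) by (simp add: exp_minus field_simps)
      have par_case: "\<exists>k\<ge>k0. small_form_case M k X ?v" if "par (w (Suc k')) x0 x1 x2" "k' \<ge> k" for k'
      proof -
        have "ln X \<ge> W (Suc k') - K' \<and> ?v \<ge> exp (- (zexp k' + K'))"
          by (rule K'(2)[rule_format]) (use that k x xE X1 in auto)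
        moreover have "exp (- (zexp k' + M)) \<le> exp (- (zexp k' + K'))" using M by simp
        ultimately have "ln X \<ge> W (Suc k') - M \<and> ?v \<ge> exp (- (zexp k' + M))" using M by linarith
        then have "small_form_case M (Suc k') X ?v" by (simp add: small_form_case_def zexp_def)
        then show ?thesis using k that by (intro exI[of _ "Suc k'"]) auto
      qed
      show ?thesis
      proof (cases "form x0 x1 x2 (y i) = 0")
        case False
        then have "1 \<le> \<bar>form x0 x1 x2 (y i)\<bar>" by simp
        then have "1 \<le> real_of_int \<bar>form x0 x1 x2 (y i)\<bar>" by linarith
        from ev_lower[OF K(4)[OF i0(1)] x12 gi' this]
        have "1 / 2 * exp (- \<Lambda> i) \<le> ?v" .
        moreover have "exp (- K) * exp (- \<Lambda> i) \<le> 1 / 2 * exp (- \<Lambda> i)" by (rule mult_right_mono[OF eK]) simp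
        moreover have "exp (- (A + W (Suc k) + M)) \<le> exp (- K) * exp (- \<Lambda> i)"
          unfolding exp_add[symmetric] using iA M K(1) by simp
        ultimately have 1: "exp (- (A + W (Suc k) + M)) \<le> ?v" by linarith
        have "(1 - \<delta>) * (A - K) \<le> (1 - \<delta>) * \<Lambda> h" using hA delta by (intro mult_left_mono) auto
        moreover have "(1 - \<delta>) * K \<le> K" using K(1) delta by (simp add: mult_left_le_one_le)
        ultimately have "(1 - \<delta>) * A - M \<le> ln X" using lnX M K(1) by (simp add: algebra_simps)
        then have "small_form_case M (Suc k) X ?v" unfolding small_form_case_def using 1 A by blast
        then show ?thesis using k by (intro exI[of _ "Suc k"]) auto
      next
        case f0: True
        \<comment> \<open>Both the given form and \<open>skew (w (Suc k))\<close> vanish at y_i and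
          they are not proportional, so y_i cannot be much higher than the product of their
          sizes.\<close>
        have cross: "\<Lambda> i \<le> ln X + W (Suc k) + 3 * K" if "\<not> par (w (Suc k)) x0 x1 x2"
        proof -
          have s: "skew (w (Suc k)) (y i) = 0" "det (y i) \<noteq> 0" using skew_u det_u_nz by (auto simp: kl(4))
          have "exp (\<Lambda> i) \<le> 4 * of_int (mat_content (y i)) * (E * X) * exp (W (Suc k))"
            unfolding exp_\<Lambda> exp_W by (rule par_cross_bound[OF y_sym f0 s that xE])
          also have "\<dots> \<le> exp K * exp K * (exp K * X) * exp (W (Suc k))"
            using K(6)[of i] K(8,9) X1 E_ge_1 by (intro mult_mono) (auto simp: mat_content_nonneg)
          also have "\<dots> = exp (K + K + (K + ln X) + W (Suc k))"
            using X1 by (simp only: exp_add) simp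
          finally show ?thesis by simp
        qed
        \<comment> \<open>The form vanishes at y_i = \<open>u k' (Suc j)\<close> but not at
          \<open>u k' j\<close>, since two consecutive zeros would make it proportional to the skew
          form. By the recurrence its value at the next point is a non-zero multiple of det
          w_(k'+1), which improves the bound by exp (\<delta> W).\<close>
        have low: "exp (\<delta> * W (Suc k') - 2 * K - \<Lambda> (Suc i)) \<le> ?v"
          if "y i = u k' (Suc j)" "y (Suc i) = u k' (Suc (Suc j))" "\<not> par (w (Suc k')) x0 x1 x2" for k' j
        proof -
          have "form x0 x1 x2 (u k' j) \<noteq> 0"
            using parI_form[OF u_sym, of "w (Suc k')" k' j] u_sym[of k' "Suc j"] det_u_nz[of k' j] that f0 by (auto simp: u_Suc)
          then have "1 \<le> \<bar>form x0 x1 x2 (u k' j)\<bar>" by simp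
          then have "\<bar>det (w (Suc k'))\<bar> * 1 \<le> \<bar>det (w (Suc k'))\<bar> * \<bar>form x0 x1 x2 (u k' j)\<bar>" by (intro mult_left_mono) auto
          also have "\<dots> = \<bar>form x0 x1 x2 (y (Suc i))\<bar>"
            using f0 that(1) by (simp add: that(2) form_u_rec abs_mult)
          finally have d: "of_int \<bar>det (w (Suc k'))\<bar> \<le> real_of_int \<bar>form x0 x1 x2 (y (Suc i))\<bar>" by linarith
          have "(1 - \<delta>) * \<Lambda> i \<le> (1 - \<delta>) * \<Lambda> (Suc i)" using K(5)[OF i0(1)] delta by (intro mult_left_mono) auto
          then have "2 * X * exp (K - (1 - \<delta>) * \<Lambda> (Suc i)) \<le> 2 * X * exp (K - (1 - \<delta>) * \<Lambda> i)"
            using X1 by (intro mult_left_mono) auto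
          moreover have "1 \<le> \<bar>det (w (Suc k'))\<bar>" using det_w[of "Suc k'"] by linarith
          then have "1 \<le> real_of_int \<bar>det (w (Suc k'))\<bar>" by linarith
          ultimately have e: "2 * X * exp (K - (1 - \<delta>) * \<Lambda> (Suc i)) \<le> real_of_int \<bar>det (w (Suc k'))\<bar> / 2"
            using gi' by linarith
          have "exp (\<delta> * W (Suc k') - 2 * K - \<Lambda> (Suc i)) = exp (\<delta> * W (Suc k') - K) * exp (- K) * exp (- \<Lambda> (Suc i))"
            unfolding exp_add[symmetric] by simp
          also have "\<dots> \<le> of_int \<bar>det (w (Suc k'))\<bar> * (1 / 2) * exp (- \<Lambda> (Suc i))"
            by (intro mult_right_mono mult_mono K(3) eK) auto
          also have "\<dots> \<le> ?v"
            using ev_lower[OF K(4)[OF i0(3)] x12 e d] by simp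
          finally show ?thesis .
        qed
        show ?thesis
        proof (cases "par (w (Suc k)) x0 x1 x2")
          case True
          then show ?thesis by (rule par_case) simp
        next
          case np: False
          show ?thesis
          \<comment> \<open>If y_i is the junction of two chains, the next point is reached by
            w_(k+2) instead of w_(k+1). Proportionality to the next skew form must then be excluded
            as well.\<close>
          proof (cases "Suc l = r k")
            case False
            then have ys: "y (Suc i) = u k (Suc (Suc (Suc l)))" "\<Lambda> (Suc i) = ht k (Suc (Suc (Suc l)))"
              using y_eq[of "Suc (Suc l)" k] \<Lambda>_T[of "Suc (Suc l)" k] kl h by auto
            have "\<Lambda> (Suc i) \<le> A + 2 * W (Suc k) + K"
              using K(2)[of "Suc (Suc (Suc l))" k] False kl by (simp add: ys A_def algebra_simps)
            then have "exp (- (A + (2 - \<delta>) * W (Suc k) + M)) \<le> exp (\<delta> * W (Suc k) - 2 * K - \<Lambda> (Suc i))"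
              using M K(1) by (simp add: algebra_simps)
            then have "exp (- (A + (2 - \<delta>) * W (Suc k) + M)) \<le> ?v" using low[OF kl(4) ys(1) np] by linarith
            moreover have "A - M \<le> ln X" using cross[OF np] iA M by linarith
            ultimately have "small_form_case M (Suc k) X ?v" unfolding small_form_case_def using A by blast
            then show ?thesis using k by (intro exI[of _ "Suc k"]) auto
          next
            case True
            then have iT: "i = T (Suc k)" using kl h by (simp add: T_Suc)
            have yi: "y i = u (Suc k) (Suc 0)" "\<Lambda> i = ht (Suc k) (Suc 0)" using y_eq[of 0 "Suc k"] \<Lambda>_T[of 0 "Suc k"] by (auto simp: iT)
            have ys: "y (Suc i) = u (Suc k) (Suc (Suc 0))" "\<Lambda> (Suc i) = ht (Suc k) (Suc (Suc 0))"
              using y_eq[of 1 "Suc k"] \<Lambda>_T[of 1 "Suc k"] r_ge_1[of "Suc k"] by (auto simp: iT)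
            show ?thesis
            proof (cases "par (w (Suc (Suc k))) x0 x1 x2")
              case True
              then show ?thesis by (rule par_case) simp
            next
              case np': False
              let ?W = "W (Suc (Suc k))"
              \<comment> \<open>At the junction A is taken to be W_(k+2); W_(k+1) is at most W_(k+2)
                + K, which bounds the height of the next point by 3 A.\<close>
              have "\<Lambda> (Suc i) \<le> 2 * ?W + W (Suc k) + K"
                using K(2)[of "Suc (Suc 0)" "Suc k"] r_ge_1[of "Suc k"] by (simp add: ys)
              then have "exp (- (?W + (2 - \<delta>) * ?W + M)) \<le> exp (\<delta> * ?W - 2 * K - \<Lambda> (Suc i))"
                using M K(1) K(7)[of k] by (simp add: algebra_simps)
              then have "exp (- (?W + (2 - \<delta>) * ?W + M)) \<le> ?v" using low[OF yi(1) ys(1) np'] by linarith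
              moreover have "?W - M \<le> ln X"
                using cross[OF np] K(2)[of "Suc 0" "Suc k"] M K(1) by (simp add: yi)
              ultimately have "small_form_case M (Suc (Suc k)) X ?v" unfolding small_form_case_def by blast
              then show ?thesis using k by (intro exI[of _ "Suc (Suc k)"]) auto
            qed
          qed
        qed
      qed
    qed
    with X0 show ?thesis by blast
  qed
  then show ?thesis using M(1) by blast
qed

text \<open>The skew forms realise the exponent along the k for which W_(k+1) / W_k is close to L.
  For the upper bound, the three cases of \<open>small_form_case\<close> allow exponents up to 2 /
  (1 - \<delta>), 3 and \<Omega>. Since \<delta> (L + 1) < 1, one has \<Omega> > 2 L and 1 -
  \<delta> > L / (L + 1); with L^2 \<ge> L + 1 this gives \<Omega> > 3 and \<Omega> (1 - \<delta>) >
  2.\<close>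

lemma omega_2_eq:
  assumes L: "L > 0" "L\<^sup>2 \<ge> L + 1" "\<delta> * (L + 1) < 1"
    and ev_le: "\<And>\<eta>. \<eta> > 0 \<Longrightarrow> eventually (\<lambda>k. W (Suc k) \<le> (L + \<eta>) * W k) sequentially"
    and fr_ge: "\<And>\<eta>. \<eta> > 0 \<Longrightarrow> frequently (\<lambda>k. W (Suc k) \<ge> (L - \<eta>) * W k) sequentially"
  shows "omega_2 \<xi> = ereal (2 * L + 1 - \<delta> * (1 + L))"
proof -
  define \<Omega> where "\<Omega> = 2 * L + 1 - \<delta> * (1 + L)"
  define Q where "Q \<omega> X \<longleftrightarrow> (\<exists>x0 x1 x2 :: int. (x0, x1, x2) \<noteq> (0, 0, 0) \<and>
    \<bar>of_int x0 + of_int x1 * \<xi> + of_int x2 * \<xi>\<^sup>2\<bar> \<le> X powr (- \<omega>) \<and> of_int (max \<bar>x1\<bar> \<bar>x2\<bar>) \<le> X)" for \<omega> X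
  define P where "P \<omega> \<longleftrightarrow> frequently (Q \<omega>) at_top" for \<omega>
  have upper: "\<omega> \<le> \<Omega>" if "P \<omega>" for \<omega>
  proof (rule ccontr)
    assume "\<not> \<omega> \<le> \<Omega>"
    then have \<omega>: "\<omega> > \<Omega>" by simp
    obtain K where K: "K \<ge> 0" "\<forall>k0. \<exists>X0\<ge>1. \<forall>X\<ge>X0. \<forall>x0 x1 x2. (x0, x1, x2) \<noteq> (0, 0, 0) \<and> of_int \<bar>x1\<bar> \<le> X \<and> of_int \<bar>x2\<bar> \<le> X \<and> \<bar>ev x0 x1 x2\<bar> \<le> 1 \<longrightarrow>
     (\<exists>k\<ge>k0. small_form_case K k X \<bar>ev x0 x1 x2\<bar>)"
      using small_form_cases by blast
    have "L \<ge> 3 / 2"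
    proof (rule ccontr)
      assume "\<not> L \<ge> 3 / 2"
      then have "L * L \<le> 3 / 2 * L" using L(1) by (intro mult_right_mono) auto
      then show False using L(2) \<open>\<not> L \<ge> 3 / 2\<close> unfolding power2_eq_square by linarith
    qed
    moreover have "\<Omega> > 2 * L" using L(3) by (simp add: \<Omega>_def algebra_simps)
    ultimately have \<omega>3: "\<omega> > 3" using \<omega> by linarith
    have \<omega>2: "\<omega> * (1 - \<delta>) > 2"
    proof -
      have "\<delta> * (L + 1) < 1" by (rule L(3))
      then have d: "L / (L + 1) < 1 - \<delta>" using L(1) by (simp add: field_simps)
      have "2 \<le> 2 * L * (L / (L + 1))" using L(1,2) by (simp add: field_simps power2_eq_square)
      also have "\<dots> \<le> \<omega> * (L / (L + 1))" using \<omega> \<open>\<Omega> > 2 * L\<close> L(1) by (intro mult_right_mono) auto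
      also have "\<dots> < \<omega> * (1 - \<delta>)" using d \<omega>3 by (intro mult_strict_left_mono) auto
      finally show ?thesis .
    qed
    \<comment> \<open>The smallest of the margins available in the three cases. For large k, c W_k
      exceeds the accumulated constants (1 + \<omega>) K.\<close>
    define c where "c = Min {\<omega> * (1 - \<delta>) - 2, \<omega> - 3, (\<omega> - \<Omega>) / 2}"
    have cm: "c \<le> x" if "x \<in> {\<omega> * (1 - \<delta>) - 2, \<omega> - 3, (\<omega> - \<Omega>) / 2}" for x
      unfolding c_def using that by (intro Min_le) auto
    have c: "c > 0" "c \<le> \<omega> * (1 - \<delta>) - 2" "c \<le> \<omega> - 3" "c \<le> (\<omega> - \<Omega>) / 2"
      using \<omega> \<omega>2 \<omega>3 by (simp add: c_def) (rule cm, simp)+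
    have e: "eventually (\<lambda>k. W (Suc k) \<le> (L + (\<omega> - \<Omega>) / 4) * W k \<and> W k \<ge> ((1 + \<omega>) * K + 1) / c) sequentially"
      by (intro eventually_conj ev_le) (use \<omega> W_lim in \<open>auto simp: filterlim_at_top\<close>)
    then obtain k0 where k0: "\<And>k. k \<ge> k0 \<Longrightarrow> W (Suc k) \<le> (L + (\<omega> - \<Omega>) / 4) * W k \<and> W k \<ge> ((1 + \<omega>) * K + 1) / c"
      unfolding eventually_sequentially by blast
    obtain X0 where X0: "X0 \<ge> 1" and main: "\<forall>X\<ge>X0. \<forall>x0 x1 x2. (x0, x1, x2) \<noteq> (0, 0, 0) \<and> of_int \<bar>x1\<bar> \<le> X \<and> of_int \<bar>x2\<bar> \<le> X \<and> \<bar>ev x0 x1 x2\<bar> \<le> 1 \<longrightarrow>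
     (\<exists>k\<ge>k0. small_form_case K k X \<bar>ev x0 x1 x2\<bar>)" using K(2) by blast
    have no: False if X: "X \<ge> X0" and x: "(x0, x1, x2) \<noteq> (0, 0, 0)" "\<bar>ev x0 x1 x2\<bar> \<le> X powr (- \<omega>)"
      "of_int (max \<bar>x1\<bar> \<bar>x2\<bar>) \<le> X" for X x0 x1 x2
    proof -
      have X1: "X \<ge> 1" using X X0 by simp
      have small: "\<bar>ev x0 x1 x2\<bar> \<le> exp (- (\<omega> * ln X))" using x(2) X1 by (simp add: powr_def)
      also have "\<dots> \<le> 1" using X1 \<omega>3 by simp
      finally have "\<bar>ev x0 x1 x2\<bar> \<le> 1" .
      moreover have "of_int \<bar>x1\<bar> \<le> X" "of_int \<bar>x2\<bar> \<le> X" using x(3) by (auto simp: of_int_max)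
      ultimately obtain k where k: "k \<ge> k0" "small_form_case K k X \<bar>ev x0 x1 x2\<bar>" using main X x(1) by blast
      have Wk: "c * W k > (1 + \<omega>) * K" using k0[OF k(1)] c(1) by (simp add: divide_le_eq mult.commute)
      have scale: "c * W k \<le> d * B" if "c \<le> d" "W k \<le> B" for d B
        using that c(1) W_nonneg[of k] by (intro mult_mono) auto
      have contra: False if "a \<le> ln X" "\<omega> * a > b" "exp (- b) \<le> \<bar>ev x0 x1 x2\<bar>" for a b
      proof -
        have "\<omega> * a \<le> \<omega> * ln X" using that(1) \<omega>3 by (intro mult_left_mono) auto
        moreover have "exp (- b) \<le> exp (- (\<omega> * ln X))" using that(3) small by linarith
        ultimately show False using that(2) by simp
      qed
      from k(2) consider
          A where "A \<ge> W k" "(1 - \<delta>) * A - K \<le> ln X" "exp (- (A + W k + K)) \<le> \<bar>ev x0 x1 x2\<bar>"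
        | A where "A \<ge> W k" "A - K \<le> ln X" "exp (- (A + (2 - \<delta>) * W k + K)) \<le> \<bar>ev x0 x1 x2\<bar>"
        | "W k - K \<le> ln X" "exp (- (2 * W (Suc k) + W k - \<delta> * (W k + W (Suc k)) + K)) \<le> \<bar>ev x0 x1 x2\<bar>"
        unfolding small_form_case_def by blast
      then show False
      proof cases
        case (1 A)
        have "c * W k \<le> (\<omega> * (1 - \<delta>) - 2) * A" by (rule scale[OF c(2) 1(1)])
        then show False using 1 Wk by (intro contra[OF 1(2) _ 1(3)]) (simp add: algebra_simps)
      next
        case (2 A)
        have "c * W k \<le> (\<omega> - 3) * A" by (rule scale[OF c(3) 2(1)])
        moreover have "(2 - \<delta>) * W k \<le> 2 * A" using 2(1) delta W_nonneg[of k] by (intro mult_mono) auto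
        ultimately show False using Wk by (intro contra[OF 2(2) _ 2(3)]) (simp add: algebra_simps)
      next
        case 3
        define \<eta> where "\<eta> = (\<omega> - \<Omega>) / 4"
        have "c * W k \<le> (2 * \<eta>) * W k" by (rule scale) (use c(4) in \<open>simp_all add: \<eta>_def\<close>)
        moreover have "(2 - \<delta>) * W (Suc k) \<le> (2 - \<delta>) * ((L + \<eta>) * W k)"
          using k0[OF k(1)] delta by (intro mult_left_mono) (auto simp: \<eta>_def)
        moreover have "(2 - \<delta>) * (\<eta> * W k) \<le> 2 * (\<eta> * W k)"
          using delta \<omega> W_nonneg[of k] by (intro mult_right_mono) (auto simp: \<eta>_def)
        moreover have "(2 - \<delta>) * ((L + \<eta>) * W k) + (1 - \<delta>) * W k = \<Omega> * W k + (2 - \<delta>) * (\<eta> * W k)"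
          by (simp add: \<Omega>_def algebra_simps)
        moreover have "2 * W (Suc k) + W k - \<delta> * (W k + W (Suc k)) = (2 - \<delta>) * W (Suc k) + (1 - \<delta>) * W k"
          by (simp add: algebra_simps)
        moreover have "\<omega> * (W k - K) = \<Omega> * W k + 4 * (\<eta> * W k) - \<omega> * K"
          by (simp add: \<eta>_def field_simps)
        moreover have "(1 + \<omega>) * K = K + \<omega> * K" by (simp add: algebra_simps)
        ultimately have "2 * W (Suc k) + W k - \<delta> * (W k + W (Suc k)) + K < \<omega> * (W k - K)"
          using Wk by linarith
        then show False by (rule contra[OF 3(1) _ 3(2)])
      qed
    qed
    have "eventually (\<lambda>X. \<not> Q \<omega> X) at_top"
      using eventually_ge_at_top[of X0]
    proof eventually_elim
      case (elim X)
      then show ?case using no[of X] unfolding Q_def ev_def by blast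
    qed
    then show False using that unfolding P_def frequently_def by blast
  qed
  have lower: "P \<omega>" if \<omega>: "\<omega> < \<Omega>" for \<omega>
    unfolding P_def frequently_def
  proof
    assume "eventually (\<lambda>X. \<not> Q \<omega> X) at_top"
    then obtain X1 where X1: "\<And>X x0 x1 x2. X \<ge> X1 \<Longrightarrow> (x0, x1, x2) \<noteq> (0, 0, 0) \<Longrightarrow>
       \<bar>ev x0 x1 x2\<bar> \<le> X powr (- \<omega>) \<Longrightarrow> of_int (max \<bar>x1\<bar> \<bar>x2\<bar>) \<le> X \<Longrightarrow> False"
      unfolding eventually_at_top_linorder Q_def ev_def by blast
    obtain K k0 where zle: "\<And>k. k \<ge> k0 \<Longrightarrow> zev k \<le> exp (K - zexp k)" using zev_le by blast
    define \<eta> where "\<eta> = (\<Omega> - \<omega>) / 4"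
    have \<eta>: "\<eta> > 0" using \<omega> by (simp add: \<eta>_def)
    have "frequently (\<lambda>k. W (Suc k) \<ge> (L - \<eta>) * W k \<and> (k \<ge> Suc k0 \<and> W k \<ge> X1 \<and> W k \<ge> 2 * (\<bar>\<omega>\<bar> + K) / (\<Omega> - \<omega>))) sequentially"
      by (intro frequently_eventually_frequently fr_ge \<eta> eventually_conj eventually_ge_at_top)
        (use W_lim in \<open>auto simp: filterlim_at_top\<close>)
    then obtain k' where k': "W (Suc k') \<ge> (L - \<eta>) * W k'" "k' \<ge> Suc k0" "W k' \<ge> X1" "W k' \<ge> 2 * (\<bar>\<omega>\<bar> + K) / (\<Omega> - \<omega>)"
      using frequently_ex by blast
    obtain k where k: "k' = Suc k" "k \<ge> k0" using k' by (cases k') auto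
    \<comment> \<open>The coefficients of the skew form are at most twice the height of
      w_(k+1).\<close>
    let ?X = "2 * exp (W (Suc k))"
    have "ln ?X = ln 2 + W (Suc k)" by (simp add: ln_mult)
    have "?X \<ge> X1" using k'(3)[unfolded k(1)] exp_ge_add_one_self[of "W (Suc k)"] W_nonneg[of "Suc k"] by linarith
    moreover have "(- w (Suc k) $2$1, w (Suc k) $1$1 - w (Suc k) $2$2, w (Suc k) $1$2) \<noteq> (0, 0, 0)"
      using skew_nz[of k] by auto
    moreover have "of_int (max \<bar>w (Suc k) $1$1 - w (Suc k) $2$2\<bar> \<bar>w (Suc k) $1$2\<bar>) \<le> ?X"
      using skew_height(2,3)[of "w (Suc k)"] by (simp add: exp_W of_int_max)
    moreover have "zev k \<le> ?X powr (- \<omega>)"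
    proof -
      have "(2 - \<delta>) * ((L - \<eta>) * W (Suc k)) \<le> (2 - \<delta>) * W (Suc (Suc k))"
        using k'(1) delta by (intro mult_left_mono) (auto simp: k)
      moreover have "(2 - \<delta>) * (\<eta> * W (Suc k)) \<le> 2 * (\<eta> * W (Suc k))"
        using delta \<eta> W_nonneg[of "Suc k"] by (intro mult_right_mono) auto
      moreover have "(2 - \<delta>) * ((L - \<eta>) * W (Suc k)) + (1 - \<delta>) * W (Suc k) = \<Omega> * W (Suc k) - (2 - \<delta>) * (\<eta> * W (Suc k))"
        by (simp add: \<Omega>_def algebra_simps)
      moreover have "zexp k = (2 - \<delta>) * W (Suc (Suc k)) + (1 - \<delta>) * W (Suc k)" by (simp add: zexp_def algebra_simps)
      moreover have "(\<Omega> - \<omega>) / 2 * W (Suc k) = 2 * (\<eta> * W (Suc k))" by (simp add: \<eta>_def field_simps)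
      ultimately have "zexp k \<ge> \<Omega> * W (Suc k) - (\<Omega> - \<omega>) / 2 * W (Suc k)" by linarith
      moreover have "(\<Omega> - \<omega>) / 2 * W (Suc k) \<ge> \<bar>\<omega>\<bar> + K" using k'(4) \<omega> by (simp add: k field_simps)
      moreover have "\<Omega> * W (Suc k) - (\<Omega> - \<omega>) / 2 * W (Suc k) = \<omega> * W (Suc k) + (\<Omega> - \<omega>) / 2 * W (Suc k)"
        by (simp add: field_simps)
      ultimately have "zexp k \<ge> \<omega> * W (Suc k) + \<bar>\<omega>\<bar> + K" by linarith
      moreover have "\<omega> * ln 2 \<le> \<bar>\<omega>\<bar>"
      proof -
        have "\<omega> * ln 2 \<le> \<bar>\<omega>\<bar> * ln 2" by (intro mult_right_mono) auto
        also have "\<dots> \<le> \<bar>\<omega>\<bar> * 1" using ln_2_less_1 by (intro mult_left_mono) auto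
        finally show ?thesis by simp
      qed
      ultimately have "K - zexp k \<le> - \<omega> * ln ?X" by (simp add: \<open>ln ?X = _\<close> algebra_simps)
      then have "exp (K - zexp k) \<le> ?X powr (- \<omega>)" by (simp add: powr_def)
      then show ?thesis using zle[OF k(2)] by linarith
    qed
    ultimately show False using X1 unfolding zev_def by blast
  qed
  have "Sup {ereal \<omega> | \<omega>. P \<omega>} = ereal \<Omega>"
  proof (rule antisym)
    show "Sup {ereal \<omega> | \<omega>. P \<omega>} \<le> ereal \<Omega>" by (rule Sup_least) (use upper in auto)
    show "ereal \<Omega> \<le> Sup {ereal \<omega> | \<omega>. P \<omega>}"
    proof (rule ereal_le_epsilon2)
      fix e :: real assume "0 < e"
      then have "ereal (\<Omega> - e) \<le> Sup {ereal \<omega> | \<omega>. P \<omega>}" by (intro Sup_upper) (use lower in auto)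
      then show "ereal \<Omega> \<le> Sup {ereal \<omega> | \<omega>. P \<omega>} + ereal e"
        by (cases "Sup {ereal \<omega> | \<omega>. P \<omega>}") auto
    qed
  qed
  then show ?thesis unfolding omega_2_def P_def Q_def \<Omega>_def .
qed

end

section \<open>Continued fractions\<close>

lemma limsup_ereal_eqI:
  fixes x :: "nat \<Rightarrow> real"
  assumes "\<And>\<eta>. \<eta> > 0 \<Longrightarrow> eventually (\<lambda>k. x k \<le> L + \<eta>) sequentially"
    and "\<And>\<eta>. \<eta> > 0 \<Longrightarrow> frequently (\<lambda>k. x k \<ge> L - \<eta>) sequentially"
  shows "limsup (\<lambda>k. ereal (x k)) = ereal L"
proof (rule antisym)
  show "limsup (\<lambda>k. ereal (x k)) \<le> ereal L"
  proof (rule ereal_le_epsilon2)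
    fix e :: real assume "0 < e"
    then show "limsup (\<lambda>k. ereal (x k)) \<le> ereal L + ereal e"
      using assms(1)[of e] by (intro Limsup_bounded) (simp add: eventually_mono)
  qed
  show "ereal L \<le> limsup (\<lambda>k. ereal (x k))"
  proof (rule ccontr)
    assume "\<not> ereal L \<le> limsup (\<lambda>k. ereal (x k))"
    then have "limsup (\<lambda>k. ereal (x k)) < ereal L" by simp
    then obtain c where c: "limsup (\<lambda>k. ereal (x k)) < ereal c" "c < L"
      using ereal_dense2[of "limsup (\<lambda>k. ereal (x k))" "ereal L"] by auto
    have "eventually (\<lambda>k. ereal (x k) < ereal c) sequentially" by (rule Limsup_lessD[OF c(1)])
    then show False using assms(2)[of "L - c"] c(2) unfolding frequently_def by (simp add: not_le)
  qed
qed

lemma limsup_ereal_bounded: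
  fixes x :: "nat \<Rightarrow> real"
  assumes "\<And>k. a \<le> x k" "\<And>k. x k \<le> b"
  shows "\<exists>L. limsup (\<lambda>k. ereal (x k)) = ereal L \<and> a \<le> L \<and>
    (\<forall>\<eta>>0. eventually (\<lambda>k. x k \<le> L + \<eta>) sequentially) \<and>
    (\<forall>\<eta>>0. frequently (\<lambda>k. x k \<ge> L - \<eta>) sequentially)"
proof -
  let ?l = "limsup (\<lambda>k. ereal (x k))"
  have "?l \<le> ereal b" using assms(2) by (intro Limsup_bounded) auto
  moreover have al: "ereal a \<le> ?l" using assms(1) by (intro le_Limsup) auto
  ultimately obtain L where L: "?l = ereal L" by (cases ?l) auto
  show ?thesis
  proof (intro exI[of _ L] conjI allI impI)
    show "?l = ereal L" by (rule L)
    show "a \<le> L" using al L by simp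
    show "eventually (\<lambda>k. x k \<le> L + \<eta>) sequentially" if "\<eta> > 0" for \<eta>
    proof -
      have "?l < ereal (L + \<eta>)" using L that by simp
      then have "eventually (\<lambda>k. ereal (x k) < ereal (L + \<eta>)) sequentially" by (rule Limsup_lessD)
      then show ?thesis by (rule eventually_mono) simp
    qed
    show "frequently (\<lambda>k. x k \<ge> L - \<eta>) sequentially" if "\<eta> > 0" for \<eta>
    proof (rule ccontr)
      assume "\<not> frequently (\<lambda>k. x k \<ge> L - \<eta>) sequentially"
      then have "eventually (\<lambda>k. ereal (x k) \<le> ereal (L - \<eta>)) sequentially"
        unfolding not_frequently by (rule eventually_mono) simp
      then have "?l \<le> ereal (L - \<eta>)" by (rule Limsup_bounded)
      then show False using L that by simp
    qed
  qed
qed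

lemma perturbed_contraction:
  fixes x e :: "nat \<Rightarrow> real"
  assumes a: "0 \<le> a" "a < 1" and x: "\<And>k. x k \<ge> 0" "eventually (\<lambda>k. x (Suc k) \<le> a * x k + e k) sequentially"
    and e: "e \<longlonglongrightarrow> 0"
  shows "x \<longlonglongrightarrow> 0"
proof (rule LIMSEQ_I)
  fix \<epsilon> :: real assume "\<epsilon> > 0"
  define \<eta> where "\<eta> = \<epsilon> / 2"
  have \<eta>: "\<eta> > 0" using \<open>\<epsilon> > 0\<close> by (simp add: \<eta>_def)
  have "eventually (\<lambda>k. e k < \<eta> * (1 - a)) sequentially" using e \<eta> a by (intro order_tendstoD) auto
  with x(2) have "eventually (\<lambda>k. x (Suc k) \<le> a * x k + \<eta> * (1 - a)) sequentially" by eventually_elim simp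
  then obtain k0 where k0: "\<And>k. k \<ge> k0 \<Longrightarrow> x (Suc k) \<le> a * x k + \<eta> * (1 - a)"
    unfolding eventually_sequentially by blast
  have *: "x (k0 + n) \<le> \<eta> + a ^ n * x k0" for n
  proof (induction n)
    case (Suc n)
    have "x (k0 + Suc n) \<le> a * x (k0 + n) + \<eta> * (1 - a)" using k0[of "k0 + n"] by simp
    also have "\<dots> \<le> a * (\<eta> + a ^ n * x k0) + \<eta> * (1 - a)" using Suc a by (intro add_right_mono mult_left_mono) auto
    finally show ?case by (simp add: algebra_simps)
  qed (use \<eta> x in auto)
  have "(\<lambda>n. a ^ n * x k0) \<longlonglongrightarrow> 0" using a by (intro tendsto_mult_left_zero LIMSEQ_realpow_zero)
  then have "eventually (\<lambda>n. a ^ n * x k0 < \<eta>) sequentially" using \<eta> by (intro order_tendstoD) auto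
  then obtain n0 where n0: "\<And>n. n \<ge> n0 \<Longrightarrow> a ^ n * x k0 < \<eta>" unfolding eventually_sequentially by blast
  show "\<exists>no. \<forall>n\<ge>no. norm (x n - 0) < \<epsilon>"
  proof (intro exI[of _ "k0 + n0"] allI impI)
    fix n assume "n \<ge> k0 + n0"
    then have "x n < \<eta> + \<eta>" using *[of "n - k0"] n0[of "n - k0"] by (simp add: le_diff_conv2)
    then show "norm (x n - 0) < \<epsilon>" using x(1)[of n] by (simp add: \<eta>_def)
  qed
qed

section \<open>The continued fractions [s_(k+1); s_k, ..., s_1] and their upper limit\<close>

definition cf :: "(nat \<Rightarrow> int) \<Rightarrow> nat \<Rightarrow> real" where
  "cf s k = cont_frac (map s (rev [1..<k + 2]))"

lemma cf_0: "cf s 0 = of_int (s 1)"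
  by (simp add: cf_def)

lemma cf_Suc: "cf s (Suc k) = of_int (s (k + 2)) + 1 / cf s k"
proof -
  have "[1..<Suc k + 2] = ([1..<k + 1] @ [k + 1]) @ [k + 2]" "[1..<k + 2] = [1..<k + 1] @ [k + 1]"
    using upt_Suc_append[of 1 "k + 2"] upt_Suc_append[of 1 "k + 1"] by auto
  then show ?thesis by (simp add: cf_def)
qed

context
  fixes s :: "nat \<Rightarrow> int"
  assumes exps: "sturm_exps s"
begin

lemma s_pos: "s (Suc k) \<ge> 1"
  using exps by (simp add: sturm_exps_def)

lemma cf_ge_1: "cf s k \<ge> 1"
proof (induction k)
  case 0
  show ?case using s_pos[of 0] by (simp add: cf_0)
next
  case (Suc k)
  have "1 / cf s k \<ge> 0" using Suc by simp
  moreover have "1 \<le> real_of_int (s (k + 2))" using s_pos[of "k + 1"] by simp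
  ultimately show ?case unfolding cf_Suc by linarith
qed

text \<open>The lower bound, uniformly greater than 1, turns the recursion x \<mapsto> s + 1 / x
  into a contraction in \<open>ratio_cf\<close>.\<close>

lemma cf_bounds:
  "\<exists>B\<ge>1. (\<forall>k. cf s k \<le> B) \<and> (\<forall>k. cf s (Suc k) \<ge> 1 + 1 / B)"
proof -
  obtain b where b: "\<And>k. \<bar>s k\<bar> \<le> b" using exps by (auto simp: sturm_exps_def)
  define B where "B = real_of_int \<bar>b\<bar> + 1"
  have sb: "real_of_int (s k) \<le> B - 1" for k
  proof -
    have "s k \<le> \<bar>b\<bar>" using b[of k] by linarith
    then show ?thesis by (simp add: B_def)
  qed
  have B1: "B \<ge> 1" by (simp add: B_def)
  have le: "cf s k \<le> B" for k
  proof (cases k)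
    case 0
    then show ?thesis using sb[of 1] by (simp add: cf_0)
  next
    case (Suc j)
    have "1 / cf s j \<le> 1" using cf_ge_1[of j] by simp
    then show ?thesis using sb[of "j + 2"] unfolding Suc cf_Suc by linarith
  qed
  have "cf s (Suc k) \<ge> 1 + 1 / B" for k
  proof -
    have "1 / B \<le> 1 / cf s k" using le[of k] cf_ge_1[of k] by (intro divide_left_mono) auto
    then show ?thesis using s_pos[of "k + 1"] unfolding cf_Suc by (intro add_mono) auto
  qed
  then show ?thesis using B1 le by blast
qed

definition cf_limsup :: real where "cf_limsup = real_of_ereal (limsup (\<lambda>k. ereal (cf s k)))"

lemma sturm_sigma_eq: "sturm_sigma s = 1 / cf_limsup"
  by (simp add: sturm_sigma_def cf_limsup_def cf_def)

lemma cf_limsup: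
  shows "\<And>\<eta>. \<eta> > 0 \<Longrightarrow> eventually (\<lambda>k. cf s k \<le> cf_limsup + \<eta>) sequentially"
    and "\<And>\<eta>. \<eta> > 0 \<Longrightarrow> frequently (\<lambda>k. cf s k \<ge> cf_limsup - \<eta>) sequentially"
    and "cf_limsup \<ge> 1"
proof -
  obtain B where "\<forall>k. cf s k \<le> B" using cf_bounds by blast
  then have B: "cf s k \<le> B" for k ..
  obtain L where L: "limsup (\<lambda>k. ereal (cf s k)) = ereal L" "1 \<le> L"
    "\<forall>\<eta>>0. eventually (\<lambda>k. cf s k \<le> L + \<eta>) sequentially"
    "\<forall>\<eta>>0. frequently (\<lambda>k. cf s k \<ge> L - \<eta>) sequentially"
    using limsup_ereal_bounded[of 1 "cf s" B, OF cf_ge_1 B] by blast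
  have eq: "cf_limsup = L" by (simp add: cf_limsup_def L(1))
  show "eventually (\<lambda>k. cf s k \<le> cf_limsup + \<eta>) sequentially" if "\<eta> > 0" for \<eta>
    using L(3) that by (simp add: eq)
  show "frequently (\<lambda>k. cf s k \<ge> cf_limsup - \<eta>) sequentially" if "\<eta> > 0" for \<eta>
    using L(4) that by (simp add: eq)
  show "cf_limsup \<ge> 1" using L(2) by (simp add: eq)
qed

lemma exponent_limsup:
  obtains m where "m \<ge> 1" "eventually (\<lambda>k. s k \<le> m) sequentially" "frequently (\<lambda>k. s k = m) sequentially"
proof -
  obtain b where b: "\<And>k. \<bar>s k\<bar> \<le> b" using exps by (auto simp: sturm_exps_def)
  define P where "P n \<longleftrightarrow> frequently (\<lambda>k. s k \<ge> int n) sequentially" for n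
  have "eventually (\<lambda>k. s k \<ge> 1) sequentially"
    using exps by (auto simp: sturm_exps_def eventually_sequentially)
  then have "P 1" unfolding P_def by (simp add: eventually_frequently)
  moreover have bd: "n \<le> nat b" if Pn: "P n" for n
  proof -
    obtain k where "s k \<ge> int n" using frequently_ex[OF Pn[unfolded P_def]] by blast
    then show ?thesis using b[of k] by linarith
  qed
  ultimately obtain n where n: "P n" "\<And>j. P j \<Longrightarrow> j \<le> n" using GreatestI_nat[of P 1 "nat b"] Greatest_le_nat[of P _ "nat b"] by metis
  have "\<not> P (Suc n)" using n(2)[of "Suc n"] by auto
  then have ev: "eventually (\<lambda>k. s k \<le> int n) sequentially"
    unfolding P_def not_frequently by (rule eventually_mono) simp
  have "frequently (\<lambda>k. s k \<ge> int n \<and> s k \<le> int n) sequentially"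
    using n(1) ev unfolding P_def by (rule frequently_eventually_frequently)
  then have "frequently (\<lambda>k. s k = int n) sequentially" by (rule frequently_elim1) simp
  moreover have "int n \<ge> 1" using n(2)[OF \<open>P 1\<close>] by simp
  ultimately show ?thesis using that ev by blast
qed

lemma limit_at_right_nonneg:
  fixes f :: "real \<Rightarrow> real"
  assumes "isCont f 0" "\<And>\<eta>. \<eta> > 0 \<Longrightarrow> f \<eta> \<ge> 0"
  shows "f 0 \<ge> 0"
proof (rule tendsto_lowerbound)
  show "(f \<longlongrightarrow> f 0) (at_right 0)" using assms(1) by (simp add: isCont_def filterlim_at_split)
  show "eventually (\<lambda>x. f x \<ge> 0) (at_right 0)" using assms(2) by (simp add: eventually_at_filter)
qed simp

text \<open>With m the largest exponent occurring infinitely often, the lower bound comes from the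
  indices with exponent m, where the previous quotient is at most L + \<eta>. For the upper bound
  all late exponents are at most m, and the previous quotient is at least 1 + 1 / (L + \<eta>). Then
  \<eta> tends to 0 and denominators are cleared.\<close>

lemma cf_limsup_bounds:
  obtains m :: int where "m \<ge> 1" "cf_limsup\<^sup>2 \<ge> m * cf_limsup + 1" "cf_limsup\<^sup>2 \<le> m * cf_limsup + m"
proof -
  obtain m where m: "m \<ge> 1" "eventually (\<lambda>k. s k \<le> m) sequentially" "frequently (\<lambda>k. s k = m) sequentially"
    using exponent_limsup by blast
  let ?L = cf_limsup
  have ev: "eventually (\<lambda>k. cf s k \<le> ?L + \<eta>) sequentially" if "\<eta> > 0" for \<eta> using cf_limsup(1) that .
  have Suc: "eventually (\<lambda>k. P (Suc k)) sequentially" if "eventually P sequentially" for P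
    using that by (simp add: eventually_sequentially_Suc)
  have m2: "eventually (\<lambda>k. s (k + 2) \<le> m) sequentially"
    using Suc[OF Suc[OF m(2)]] by simp
  have m3: "frequently (\<lambda>k. s (k + 2) = m) sequentially"
    using m(3) eventually_sequentially_Suc[of "\<lambda>k. s (Suc k) \<noteq> m"] eventually_sequentially_Suc[of "\<lambda>k. s k \<noteq> m"] unfolding frequently_def by simp
  have lower: "?L + \<eta> - (m + 1 / (?L + \<eta>)) \<ge> 0" if \<eta>: "\<eta> > 0" for \<eta>
  proof -
    have "frequently (\<lambda>k. s (k + 2) = m \<and> (cf s k \<le> ?L + \<eta> \<and> cf s (Suc k) \<le> ?L + \<eta>)) sequentially"
      by (intro frequently_eventually_frequently m3 eventually_conj ev \<eta> Suc[OF ev])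
    from frequently_ex[OF this] obtain k where k: "s (k + 2) = m" "cf s k \<le> ?L + \<eta>" "cf s (Suc k) \<le> ?L + \<eta>"
      by blast
    have "1 / (?L + \<eta>) \<le> 1 / cf s k" using k(2) cf_ge_1[of k] by (intro divide_left_mono) auto
    then show ?thesis using k unfolding cf_Suc by simp
  qed
  have "?L + 0 - (m + 1 / (?L + 0)) \<ge> 0"
    by (rule limit_at_right_nonneg[OF _ lower]) (use cf_limsup(3) in \<open>auto intro!: continuous_intros\<close>)
  then have 1: "?L\<^sup>2 \<ge> m * ?L + 1" using cf_limsup(3) by (simp add: field_simps power2_eq_square)
  have upper: "m + 1 / (1 + 1 / (?L + \<eta>)) - (?L - \<eta>) \<ge> 0" if \<eta>: "\<eta> > 0" for \<eta>
  proof -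
    have "eventually (\<lambda>k. s (Suc k + 2) \<le> m \<and> cf s k \<le> ?L + \<eta>) sequentially"
      by (intro eventually_conj ev \<eta> Suc[OF m2])
    then have "eventually (\<lambda>k. cf s (Suc (Suc k)) \<le> m + 1 / (1 + 1 / (?L + \<eta>))) sequentially"
    proof eventually_elim
      case (elim k)
      have "1 / (?L + \<eta>) \<le> 1 / cf s k" using elim cf_ge_1[of k] by (intro divide_left_mono) auto
      then have "1 + 1 / (?L + \<eta>) \<le> cf s (Suc k)" using s_pos[of "k + 1"] unfolding cf_Suc by (intro add_mono) auto
      moreover have "0 < 1 + 1 / (?L + \<eta>)" using cf_limsup(3) \<eta> by (intro add_pos_nonneg) auto
      ultimately have "1 / cf s (Suc k) \<le> 1 / (1 + 1 / (?L + \<eta>))" by (intro divide_left_mono) auto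
      then show ?case using elim unfolding cf_Suc[of s "Suc k"] by (intro add_mono) auto
    qed
    then have "eventually (\<lambda>k. cf s k \<le> m + 1 / (1 + 1 / (?L + \<eta>))) sequentially"
      using eventually_sequentially_Suc[of "\<lambda>k. cf s k \<le> m + 1 / (1 + 1 / (?L + \<eta>))"]
        eventually_sequentially_Suc[of "\<lambda>k. cf s (Suc k) \<le> m + 1 / (1 + 1 / (?L + \<eta>))"] by blast
    from frequently_ex[OF frequently_eventually_frequently[OF cf_limsup(2)[OF \<eta>] this]] obtain k where
      "cf s k \<ge> ?L - \<eta>" "cf s k \<le> m + 1 / (1 + 1 / (?L + \<eta>))" by blast
    then show ?thesis by linarith
  qed
  have "m + 1 / (1 + 1 / (?L + 0)) - (?L - 0) \<ge> 0"
  proof (rule limit_at_right_nonneg[OF _ upper])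
    have "1 + 1 / ?L > 0" using cf_limsup(3) by (intro add_pos_nonneg) auto
    then show "isCont (\<lambda>\<eta>. m + 1 / (1 + 1 / (?L + \<eta>)) - (?L - \<eta>)) 0"
      using cf_limsup(3) by (auto intro!: continuous_intros)
  qed
  then have "?L \<le> m + ?L / (?L + 1)" using cf_limsup(3) by (simp add: field_simps)
  then have "?L * (?L + 1) \<le> (m + ?L / (?L + 1)) * (?L + 1)" using cf_limsup(3) by (intro mult_right_mono) auto
  also have "\<dots> = m * (?L + 1) + ?L" using cf_limsup(3) by (simp add: field_simps)
  finally have 2: "?L\<^sup>2 \<le> m * ?L + m" by (simp add: algebra_simps power2_eq_square)
  show ?thesis using that m(1) 1 2 by blast
qed

end

section \<open>Ratios of consecutive logarithmic heights\<close>

context sturmian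
begin

text \<open>Up to an error O(1 / W), the ratios satisfy the recursion of \<open>cf\<close>. As the
  ratio q is at least 1 and the continued fraction c at least g > 1, inversion shrinks their
  distance by 1 / (q c) \<le> 1 / g.\<close>

lemma ratio_cf: "(\<lambda>k. W (Suc k) / W k - cf s k) \<longlonglongrightarrow> 0"
proof -
  obtain K where K: "K \<ge> 0" "\<And>k. \<bar>W (Suc (Suc k)) - (r k * W (Suc k) + W k)\<bar> \<le> K" using W_rec_bound by blast
  obtain B where B: "B \<ge> 1" "\<forall>k. cf s (Suc k) \<ge> 1 + 1 / B" using cf_bounds[OF exps] by blast
  define g where "g = 1 + 1 / B"
  define a where "a = 1 / g"
  have B0: "g > 1" using B by (simp add: g_def)
  have a: "0 \<le> a" "a < 1" using B0 by (auto simp: a_def)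
  obtain k0 where k0: "\<And>k. k \<ge> k0 \<Longrightarrow> W k \<ge> 1 + K"
    using W_lim unfolding filterlim_at_top eventually_sequentially by metis
  have step: "\<bar>W (Suc (Suc k)) / W (Suc k) - cf s (Suc k)\<bar> \<le> a * \<bar>W (Suc k) / W k - cf s k\<bar> + K / W (Suc k)"
    if k: "k \<ge> Suc k0" for k
  proof -
    obtain k' where k': "k = Suc k'" "k' \<ge> k0" using k by (cases k) auto
    have pos: "W k' \<ge> 1 + K" "W k \<ge> 1 + K" "W (Suc k) \<ge> 1 + K" using k0 k' by auto
    have "1 * W k \<le> r k' * W k" using r_ge_1[of k'] W_nonneg[of k] by (intro mult_right_mono) auto
    then have mono: "W k \<le> W (Suc k)" using K(2)[of k'] pos unfolding k'(1) by linarith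
    define q where "q = W (Suc k) / W k"
    define c where "c = cf s k"
    have q: "q \<ge> 1" using mono pos K(1) by (simp add: q_def)
    have c: "c \<ge> g" using B(2) by (simp add: c_def k' g_def)
    have qc: "q > 0" "c > 0" using q c B0 by linarith+
    have "W (Suc (Suc k)) / W (Suc k) - cf s (Suc k) = (1 / q - 1 / c) + (W (Suc (Suc k)) - (r k * W (Suc k) + W k)) / W (Suc k)"
      using pos K(1) unfolding cf_Suc s_eq_r by (simp add: q_def c_def diff_divide_distrib add_divide_distrib)
    then have "\<bar>W (Suc (Suc k)) / W (Suc k) - cf s (Suc k)\<bar> \<le> \<bar>1 / q - 1 / c\<bar> + \<bar>(W (Suc (Suc k)) - (r k * W (Suc k) + W k)) / W (Suc k)\<bar>"
      by (simp only: abs_triangle_ineq)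
    also have "\<bar>1 / q - 1 / c\<bar> = \<bar>q - c\<bar> / (q * c)"
    proof -
      have "1 / q - 1 / c = (c - q) / (q * c)" using qc by (simp add: diff_frac_eq)
      moreover have "q * c > 0" using qc by simp
      ultimately show ?thesis by (simp only: abs_divide abs_minus_commute abs_of_pos)
    qed
    also have "\<dots> \<le> \<bar>q - c\<bar> / (1 * g)"
      using q c qc B0 by (intro divide_left_mono mult_mono mult_pos_pos) auto
    also have "\<dots> = a * \<bar>q - c\<bar>" by (simp add: a_def)
    also have "\<bar>(W (Suc (Suc k)) - (r k * W (Suc k) + W k)) / W (Suc k)\<bar> \<le> K / W (Suc k)"
      unfolding abs_divide using K(2)[of k] pos K(1) by (auto intro!: divide_right_mono)
    finally show ?thesis by (simp add: q_def c_def)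
  qed
  have "(\<lambda>k. \<bar>W (Suc k) / W k - cf s k\<bar>) \<longlonglongrightarrow> 0"
  proof (rule perturbed_contraction[OF a])
    show "eventually (\<lambda>k. \<bar>W (Suc (Suc k)) / W (Suc k) - cf s (Suc k)\<bar> \<le> a * \<bar>W (Suc k) / W k - cf s k\<bar> + K / W (Suc k)) sequentially"
      using step by (auto simp: eventually_sequentially)
    have "filterlim (\<lambda>k. W (Suc k)) at_top sequentially" using W_lim by (simp add: filterlim_sequentially_Suc)
    then show "(\<lambda>k. K / W (Suc k)) \<longlonglongrightarrow> 0"
      by (intro tendsto_divide_0[OF tendsto_const] filterlim_at_top_imp_at_infinity)
  qed auto
  then show ?thesis by (simp only: tendsto_rabs_zero_iff)
qed

lemma W_Suc_le:
  assumes "\<eta> > 0"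
  shows "eventually (\<lambda>k. W (Suc k) \<le> (cf_limsup s + \<eta>) * W k) sequentially"
proof -
  have "eventually (\<lambda>k. \<bar>W (Suc k) / W k - cf s k\<bar> < \<eta> / 2) sequentially"
    using tendstoD[OF ratio_cf, of "\<eta> / 2"] assms by (simp add: dist_real_def)
  moreover have "eventually (\<lambda>k. W k \<ge> 1) sequentially" using W_lim by (simp add: filterlim_at_top)
  moreover have "eventually (\<lambda>k. cf s k \<le> cf_limsup s + \<eta> / 2) sequentially"
    using cf_limsup(1)[OF exps, of "\<eta> / 2"] assms by simp
  ultimately show ?thesis
  proof eventually_elim
    case (elim k)
    then have "W (Suc k) / W k \<le> cf_limsup s + \<eta>" by linarith
    then show ?case using elim by (simp add: divide_le_eq)
  qed
qed

lemma W_Suc_ge: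
  assumes "\<eta> > 0"
  shows "frequently (\<lambda>k. W (Suc k) \<ge> (cf_limsup s - \<eta>) * W k) sequentially"
proof -
  have "eventually (\<lambda>k. \<bar>W (Suc k) / W k - cf s k\<bar> < \<eta> / 2) sequentially"
    using tendstoD[OF ratio_cf, of "\<eta> / 2"] assms by (simp add: dist_real_def)
  moreover have "eventually (\<lambda>k. W k \<ge> 1) sequentially" using W_lim by (simp add: filterlim_at_top)
  ultimately have ev: "eventually (\<lambda>k. \<bar>W (Suc k) / W k - cf s k\<bar> < \<eta> / 2 \<and> W k \<ge> 1) sequentially"
    by (rule eventually_conj)
  have "frequently (\<lambda>k. cf s k \<ge> cf_limsup s - \<eta> / 2) sequentially"
    using cf_limsup(2)[OF exps, of "\<eta> / 2"] assms by simp
  from frequently_eventually_frequently[OF this ev] show ?thesis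
  proof (rule frequently_elim1)
    fix k assume k: "cf_limsup s - \<eta> / 2 \<le> cf s k \<and> \<bar>W (Suc k) / W k - cf s k\<bar> < \<eta> / 2 \<and> 1 \<le> W k"
    then have "W (Suc k) / W k \<ge> cf_limsup s - \<eta>" by linarith
    then show "W (Suc k) \<ge> (cf_limsup s - \<eta>) * W k" using k by (simp add: le_divide_eq)
  qed
qed

end

lemma cf_limsup_golden:
  assumes "sturm_exps s" shows "(cf_limsup s)\<^sup>2 \<ge> cf_limsup s + 1"
proof -
  obtain m :: int where "m \<ge> 1" "(cf_limsup s)\<^sup>2 \<ge> m * cf_limsup s + 1" using cf_limsup_bounds[OF assms] by blast
  moreover have "1 * cf_limsup s \<le> m * cf_limsup s"
    using \<open>m \<ge> 1\<close> cf_limsup(3)[OF assms] by (intro mult_right_mono) auto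
  ultimately show ?thesis by linarith
qed

lemma delta_less_iff:
  assumes "sturm_exps s"
  shows "\<delta> < sturm_sigma s / (1 + sturm_sigma s) \<longleftrightarrow> \<delta> * (cf_limsup s + 1) < 1"
  using cf_limsup(3)[OF assms] unfolding sturm_sigma_eq[OF assms] by (simp add: field_simps)

theorem (in sturmian_number) omega_2_sturmian:
  assumes "\<delta> * (cf_limsup s + 1) < 1"
  shows "omega_2 \<xi> = ereal (2 * cf_limsup s + 1 - \<delta> * (1 + cf_limsup s))"
  by (rule omega_2_eq) (use cf_limsup(3)[OF exps] cf_limsup_golden[OF exps] assms W_Suc_le W_Suc_ge in auto)

section \<open>The exponents lie in the three intervals\<close>

lemma sturmian_type_omega_2:
  assumes "sturmian_type \<xi>"
  obtains s \<delta> where "sturm_exps s" "\<delta> \<ge> 0" "\<delta> * (cf_limsup s + 1) < 1"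
    "omega_2 \<xi> = ereal (2 * cf_limsup s + 1 - \<delta> * (1 + cf_limsup s))"
proof -
  from assms obtain s w N \<delta> where *: "sturm_exps s" "sturm_seq s w" "admissible_with w N"
     "mult_growth s w" "\<not> mat_symmetric N"
     "filterlim (\<lambda>i. mat_height (w i)) at_top sequentially"
     "\<exists>C. \<forall>i\<ge>-2. mat_content (sturm_y s w N i) \<le> C"
     "\<delta> \<ge> 0" and d: "\<delta> < sturm_sigma s / (1 + sturm_sigma s)" and
     **: "\<exists>c1>0. \<exists>c2>0. \<forall>i. c1 * mat_height (w i) powr \<delta> \<le> of_int \<bar>det (w i)\<bar> \<and>
           of_int \<bar>det (w i)\<bar> \<le> c2 * mat_height (w i) powr \<delta>"
     "limitin proj_topology (\<lambda>n::nat. span {mat_point (sturm_y s w N (int n))})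
       (span {vector [1, \<xi>, \<xi>\<^sup>2]}) sequentially"
    unfolding sturmian_type_def by blast
  have d': "\<delta> * (cf_limsup s + 1) < 1" using d by (simp only: delta_less_iff[OF *(1)])
  have "\<delta> * 1 \<le> \<delta> * (cf_limsup s + 1)" using *(8) cf_limsup(3)[OF *(1)] by (intro mult_left_mono) auto
  then have "\<delta> < 1" using d' by linarith
  interpret sturmian_number s w N \<delta> \<xi>
    by unfold_locales (use * ** \<open>\<delta> < 1\<close> in blast)+
  show ?thesis using that[OF *(1,8) d' omega_2_sturmian[OF d']] .
qed

text \<open>Here m = 1 forces 2 L = 1 + sqrt 5; m = 2 gives 1 + sqrt 2 \<le> L \<le> 1 + sqrt 3; m
  \<ge> 3 gives 2 L \<ge> 3 + sqrt 13. The exponent is in (2 L, 2 L + 1].\<close>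

lemma sturmian_values_subset:
  assumes "sturmian_type \<xi>"
  shows "real_of_ereal (omega_2 \<xi>) \<in> {1 + sqrt 5 .. 2 + sqrt 5} \<union> {2 + 2 * sqrt 2 .. 3 + 2 * sqrt 3} \<union> {3 + sqrt 13 ..}"
proof -
  obtain s \<delta> where s: "sturm_exps s" and d: "\<delta> \<ge> 0" "\<delta> * (cf_limsup s + 1) < 1"
    and om: "omega_2 \<xi> = ereal (2 * cf_limsup s + 1 - \<delta> * (1 + cf_limsup s))"
    using sturmian_type_omega_2[OF assms] by blast
  define L where "L = cf_limsup s"
  define t where "t = real_of_ereal (omega_2 \<xi>)"
  have L1: "L \<ge> 1" using cf_limsup(3)[OF s] by (simp add: L_def)
  have "t = 2 * L + 1 - \<delta> * (L + 1)" by (simp add: t_def om L_def add.commute)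
  moreover have "0 \<le> \<delta> * (L + 1)" using d(1) L1 by simp
  ultimately have t: "2 * L < t" "t \<le> 2 * L + 1" using d(2) by (auto simp: L_def)
  obtain m :: int where m: "m \<ge> 1" "L\<^sup>2 \<ge> m * L + 1" "L\<^sup>2 \<le> m * L + m"
    using cf_limsup_bounds[OF s] unfolding L_def by blast
  consider "m = 1" | "m = 2" | "m \<ge> 3" using m(1) by linarith
  then show ?thesis
  proof cases
    case 1
    have "sqrt 5 \<le> 2 * L - 1" by (rule real_le_lsqrt) (use L1 m 1 in \<open>auto simp: power2_eq_square algebra_simps\<close>)
    moreover have "2 * L - 1 \<le> sqrt 5" by (rule real_le_rsqrt) (use L1 m 1 in \<open>auto simp: power2_eq_square algebra_simps\<close>)
    ultimately show ?thesis using t by (auto simp: t_def)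
  next
    case 2
    have "sqrt 2 \<le> L - 1" by (rule real_le_lsqrt) (use L1 m 2 in \<open>auto simp: power2_eq_square algebra_simps\<close>)
    moreover have "L - 1 \<le> sqrt 3" by (rule real_le_rsqrt) (use L1 m 2 in \<open>auto simp: power2_eq_square algebra_simps\<close>)
    ultimately show ?thesis using t by (auto simp: t_def)
  next
    case 3
    have "3 * L \<le> m * L" using 3 L1 by (intro mult_right_mono) auto
    then have L3: "L\<^sup>2 \<ge> 3 * L + 1" using m by linarith
    then have "3 * L \<le> L * L" by (simp add: power2_eq_square)
    then have "3 \<le> L" using L1 by simp
    then have "sqrt 13 \<le> 2 * L - 3" by (intro real_le_lsqrt) (use L3 in \<open>auto simp: power2_eq_square algebra_simps\<close>)
    then show ?thesis using t by (auto simp: t_def)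
  qed
qed

section \<open>Construction of examples\<close>

text \<open>The Wronskian \<open>W (k + 1) n k - W k n (k + 1)\<close> controls the oscillation of \<open>W / n\<close>.\<close>

lemma perturbed_recurrence:
  fixes W n :: "nat \<Rightarrow> real" and r :: "nat \<Rightarrow> nat"
  assumes r: "\<And>k. 1 \<le> r k" "\<And>k. r k \<le> R"
    and n: "n 0 = 1" "n 1 = 1" "\<And>k. n (Suc (Suc k)) = r k * n (Suc k) + n k"
    and W: "\<And>k. \<bar>W (Suc (Suc k)) - (r k * W (Suc k) + W k)\<bar> \<le> E"
  shows "\<exists>\<rho> C. \<forall>k. \<bar>W k - \<rho> * n k\<bar> \<le> C"
proof -
  have n_mono: "1 \<le> n k \<and> n k \<le> n (Suc k)" for k
  proof (induction k)
    case (Suc k)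
    have "1 * n (Suc k) \<le> r k * n (Suc k)" using r(1)[of k] Suc by (intro mult_right_mono) auto
    then show ?case using Suc n(3)[of k] by linarith
  qed (use n in auto)
  have n1: "n k \<ge> 1" for k using n_mono by blast
  have n_up: "n (Suc k) \<le> (real R + 1) * n k" for k
  proof (cases k)
    case 0
    then show ?thesis using n by simp
  next
    case (Suc j)
    have "r j * n (Suc j) \<le> R * n (Suc j)" using r(2)[of j] n1[of "Suc j"] by (intro mult_right_mono) auto
    then show ?thesis using n_mono[of j] unfolding Suc n(3) by (simp only: distrib_right mult_1_left) linarith
  qed
  define g where "g = 1 + 1 / (real R + 1)"
  have g: "g > 1" by (simp add: g_def)
  have n_low: "g * n (Suc k) \<le> n (Suc (Suc k))" for k
  proof -
    have "n (Suc k) / (real R + 1) \<le> n k" using n_up[of k] by (simp add: divide_le_eq mult.commute)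
    moreover have "1 * n (Suc k) \<le> r k * n (Suc k)" using r(1)[of k] n1[of "Suc k"] by (intro mult_right_mono) auto
    ultimately show ?thesis unfolding n(3) g_def by (simp add: distrib_right)
  qed
  define V where "V k = W (Suc k) * n k - W k * n (Suc k)" for k
  have E: "E \<ge> 0" using W[of 0] by linarith
  \<comment> \<open>The first summand makes E at most D / (R + 1) = D (g - 1), so the new error E is
    paid for by the growth factor g of n; the second starts the induction.\<close>
  define D where "D = E * (real R + 1) + \<bar>V 0\<bar>"
  have D: "D \<ge> 0" using E by (simp add: D_def)
  have V: "\<bar>V k\<bar> \<le> D * n (Suc k)" for k
  proof (induction k)
    case 0
    then show ?case using E n by (simp add: D_def)
  next
    case (Suc k)
    let ?e = "W (Suc (Suc k)) - (r k * W (Suc k) + W k)"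
    have "V (Suc k) = - V k + ?e * n (Suc k)" by (simp add: V_def n(3) algebra_simps)
    then have "\<bar>V (Suc k)\<bar> \<le> \<bar>V k\<bar> + \<bar>?e * n (Suc k)\<bar>" by linarith
    moreover have "\<bar>?e * n (Suc k)\<bar> \<le> E * n (Suc k)" unfolding abs_mult using W[of k] n1[of "Suc k"] by (intro mult_mono) auto
    ultimately have "\<bar>V (Suc k)\<bar> \<le> (D + E) * n (Suc k)" using Suc unfolding distrib_right by linarith
    also have "\<dots> \<le> D * g * n (Suc k)"
    proof (rule mult_right_mono)
      have "E \<le> D / (real R + 1)" by (simp add: D_def le_divide_eq)
      then show "D + E \<le> D * g" by (simp add: g_def distrib_left)
    qed (use n1[of "Suc k"] in simp)
    also have "\<dots> \<le> D * n (Suc (Suc k))" using n_low[of k] D by (simp add: mult.assoc mult_left_mono)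
    finally show ?case .
  qed
  define q where "q k = D / n k" for k
  obtain \<rho> where \<rho>: "\<And>i. i \<ge> 1 \<Longrightarrow> \<bar>W i / n i - \<rho>\<bar> \<le> q i / (1 - 1 / g)"
  proof (rule geometric_error_limit[of "1 / g" 1 "\<lambda>i. W i / n i" q])
    show "0 \<le> 1 / g" "1 / g < 1" using g by auto
    show "\<bar>W (Suc i) / n (Suc i) - W i / n i\<bar> \<le> q i" for i
    proof -
      have p: "n i > 0" "n (Suc i) > 0" using n1[of i] n1[of "Suc i"] by auto
      have "W (Suc i) / n (Suc i) - W i / n i = V i / (n (Suc i) * n i)"
        using p by (simp add: V_def diff_frac_eq)
      then have "\<bar>W (Suc i) / n (Suc i) - W i / n i\<bar> = \<bar>V i\<bar> / (n (Suc i) * n i)"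
        using p by (simp add: abs_mult)
      also have "\<dots> \<le> D * n (Suc i) / (n (Suc i) * n i)" using V[of i] p by (intro divide_right_mono) auto
      also have "\<dots> = q i" using p by (simp add: q_def)
      finally show ?thesis .
    qed
    show "q (Suc i) \<le> 1 / g * q i" if i1: "1 \<le> i" for i
    proof -
      obtain j where j: "i = Suc j" using i1 by (cases i) auto
      have "n i > 0" "n (Suc i) > 0" using n1[of i] n1[of "Suc i"] by linarith+
      then have "D / n (Suc i) \<le> D / (g * n i)"
        using n_low[of j] g D by (intro divide_left_mono) (auto simp: j intro!: mult_pos_pos)
      then show ?thesis by (simp add: q_def)
    qed
  qed blast
  have "\<bar>W k - \<rho> * n k\<bar> \<le> D / (1 - 1 / g) + \<bar>W 0 - \<rho>\<bar>" for k
  proof (cases "k = 0")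
    case True
    then show ?thesis using n D g by simp
  next
    case False
    have p: "n k > 0" using n1[of k] by simp
    have "\<bar>W k - \<rho> * n k\<bar> = \<bar>W k / n k - \<rho>\<bar> * n k"
      using p by (simp add: abs_mult_pos[symmetric] field_simps)
    also have "\<dots> \<le> q k / (1 - 1 / g) * n k" using \<rho>[of k] False p by (intro mult_right_mono) auto
    also have "\<dots> = D / (1 - 1 / g)" using p by (simp add: q_def)
    finally show ?thesis by linarith
  qed
  then show ?thesis by blast
qed

text \<open>The determinant is a for every x, and the second row vanishes modulo a.\<close>

definition letter :: "int \<Rightarrow> int \<Rightarrow> imat" where
  "letter a x = vector [vector [1, x], vector [a, a * (x + 1)]]"

lemma letter_nth [simp]: "letter a x $1$1 = 1" "letter a x $1$2 = x" "letter a x $2$1 = a" "letter a x $2$2 = a * (x + 1)"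
  by (simp_all add: letter_def)

locale construction =
  fixes s :: "nat \<Rightarrow> int" and a b :: int
  assumes exps: "sturm_exps s" and a: "a \<ge> 2" and b: "b \<ge> 1"
begin

fun w :: "nat \<Rightarrow> imat" where
  "w 0 = letter a b"
| "w (Suc 0) = letter a (b + 1)"
| "w (Suc (Suc k)) = mat_pow (w (Suc k)) (nat (s (k + 2))) ** w k"

text \<open>Admissibility amounts to three homogeneous linear equations in the four entries; this is
  an integer solution. Its off-diagonal entries differ by a.\<close>

definition N :: imat where
  "N = vector [vector [a * (b + 1) * (b + 2) - 1, - a * (b + 2)], vector [- a * (b + 1), a]]"

lemma N_nth [simp]: "N$1$1 = a * (b + 1) * (b + 2) - 1" "N$1$2 = - a * (b + 2)" "N$2$1 = - a * (b + 1)" "N$2$2 = a"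
  by (simp_all add: N_def)

lemma det_N: "det N = - a"
  by (simp add: det_2 algebra_simps)

text \<open>A multiplicative family of matrices whose largest entry is the last one. Their columns
  (resp. rows) have comparable entries, and modulo \<open>a\<close> they have rank one, with first row
  \<open>(1, *)\<close> and second row \<open>0\<close>.\<close>

definition G :: "imat set" where
  "G = {A. 1 \<le> A$1$1 \<and> A$1$1 \<le> A$1$2 \<and> A$1$1 \<le> A$2$1 \<and> A$1$2 \<le> A$2$2 \<and> A$2$1 \<le> A$2$2 \<and>
     A$2$1 \<le> 2 * a * A$1$1 \<and> A$2$2 \<le> 2 * a * A$1$2 \<and> A$1$2 \<le> (b + 2) * A$1$1 \<and> A$2$2 \<le> (b + 2) * A$2$1 \<and>
     a dvd A$1$1 - 1 \<and> a dvd A$2$1 \<and> a dvd A$2$2}"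

lemma letter_G: "b \<le> x \<Longrightarrow> x \<le> b + 1 \<Longrightarrow> letter a x \<in> G"
proof -
  assume x: "b \<le> x" "x \<le> b + 1"
  have "a * (x + 1) \<le> a * (2 * x)" "a * (x + 1) \<le> a * (b + 2)" "1 * (x + 1) \<le> a * (x + 1)" "a * 1 \<le> a * (x + 1)"
    using x a b by (auto intro!: mult_left_mono mult_right_mono)
  then show ?thesis using x a b by (auto simp: G_def algebra_simps)
qed

lemma G_mult:
  assumes "A \<in> G" "B \<in> G" shows "A ** B \<in> G"
proof -
  have A: "1 \<le> A$1$1" "A$1$1 \<le> A$1$2" "A$1$1 \<le> A$2$1" "A$1$2 \<le> A$2$2" "A$2$1 \<le> A$2$2"
     "A$2$1 \<le> 2 * a * A$1$1" "A$2$2 \<le> 2 * a * A$1$2" and dA: "a dvd A$1$1 - 1" "a dvd A$2$1" "a dvd A$2$2"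
    using assms(1) by (auto simp: G_def)
  have B: "1 \<le> B$1$1" "B$1$1 \<le> B$1$2" "B$1$1 \<le> B$2$1" "B$1$2 \<le> B$2$2" "B$2$1 \<le> B$2$2"
     "B$1$2 \<le> (b + 2) * B$1$1" "B$2$2 \<le> (b + 2) * B$2$1" and dB: "a dvd B$1$1 - 1" "a dvd B$2$1" "a dvd B$2$2"
    using assms(2) by (auto simp: G_def)
  have A0: "0 \<le> A$1$1" "0 \<le> A$1$2" "0 \<le> A$2$1" "0 \<le> A$2$2" using A by linarith+
  have B0: "0 \<le> B$1$1" "0 \<le> B$1$2" "0 \<le> B$2$1" "0 \<le> B$2$2" using B by linarith+
  have "1 * 1 \<le> A$1$1 * B$1$1" using A B by (intro mult_mono) auto
  moreover have "0 \<le> A$1$2 * B$2$1" using A0 B0 by simp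
  ultimately have "1 \<le> A$1$1 * B$1$1 + A$1$2 * B$2$1" by linarith
  moreover have "A$i$1 * B$1$1 + A$i$2 * B$2$1 \<le> A$i$1 * B$1$2 + A$i$2 * B$2$2" for i
    using A0 B exhaust_2[of i] by (intro add_mono mult_left_mono) auto
  moreover have "A$1$1 * B$1$j + A$1$2 * B$2$j \<le> A$2$1 * B$1$j + A$2$2 * B$2$j" for j
    using A B0 exhaust_2[of j] by (intro add_mono mult_right_mono) auto
  moreover have "A$2$1 * B$1$j + A$2$2 * B$2$j \<le> 2 * a * (A$1$1 * B$1$j + A$1$2 * B$2$j)" for j
  proof -
    have "A$2$1 * B$1$j + A$2$2 * B$2$j \<le> (2 * a * A$1$1) * B$1$j + (2 * a * A$1$2) * B$2$j"
      using A B0 exhaust_2[of j] by (intro add_mono mult_right_mono) auto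
    then show ?thesis by (simp add: algebra_simps)
  qed
  moreover have "A$i$1 * B$1$2 + A$i$2 * B$2$2 \<le> (b + 2) * (A$i$1 * B$1$1 + A$i$2 * B$2$1)" for i
  proof -
    have "A$i$1 * B$1$2 + A$i$2 * B$2$2 \<le> A$i$1 * ((b + 2) * B$1$1) + A$i$2 * ((b + 2) * B$2$1)"
      using A0 B exhaust_2[of i] by (intro add_mono mult_left_mono) auto
    then show ?thesis by (simp add: algebra_simps)
  qed
  moreover have "a dvd A$1$1 * B$1$1 + A$1$2 * B$2$1 - 1"
  proof -
    have eq: "A$1$1 * B$1$1 + A$1$2 * B$2$1 - 1 = (A$1$1 - 1) * B$1$1 + (B$1$1 - 1) + A$1$2 * B$2$1"
      by (simp add: algebra_simps)
    show ?thesis unfolding eq by (intro dvd_add) (use dA dB in auto)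
  qed
  moreover have "a dvd A$2$1 * B$1$j + A$2$2 * B$2$j" for j using dA by simp
  ultimately show ?thesis by (simp add: G_def mult_nth_2)
qed

lemma G_height: "A \<in> G \<Longrightarrow> mat_height A = of_int (A$2$2)"
  by (rule antisym) (use mat_height_ge[of A 2 2] in \<open>auto simp: G_def mat_height_le_iff\<close>)

text \<open>The height is the lower right entry, and with positive entries the product of two of
  these cannot be reduced by cancellation.\<close>

lemma G_height_mult:
  assumes "A \<in> G" "B \<in> G"
  shows "mat_height A * mat_height B \<le> mat_height (A ** B)"
proof -
  have "0 \<le> A$2$1 * B$1$2" using assms by (intro mult_nonneg_nonneg) (auto simp: G_def)
  then have "A$2$2 * B$2$2 \<le> (A ** B)$2$2" by (simp add: mult_nth_2)
  then show ?thesis using assms G_mult by (simp add: G_height flip: of_int_mult)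
qed

lemma G_pow: "A \<in> G \<Longrightarrow> B \<in> G \<Longrightarrow> mat_pow A n ** B \<in> G"
  by (induction n) (auto simp: matrix_mul_assoc[symmetric] intro: G_mult)

lemma w_G: "w k \<in> G"
  by (induction k rule: w.induct) (auto intro: letter_G G_pow)

text \<open>The length of \<open>w k\<close> as a word in the two letters \<open>w 0\<close> and
  \<open>w 1\<close>.\<close>

fun n :: "nat \<Rightarrow> nat" where
  "n 0 = 1" | "n (Suc 0) = 1" | "n (Suc (Suc k)) = nat (s (k + 2)) * n (Suc k) + n k"

lemma det_letter: "det (letter a x) = a"
  by (simp add: det_2 algebra_simps)

lemma det_w: "det (w k) = a ^ n k"
  by (induction k rule: w.induct) (simp_all add: det_letter det_mul det_mat_pow power_add mult.commute flip: power_mult)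

lemma seq: "sturm_seq s w"
proof -
  have "w (i + 1) = mat_pow (w i) (nat (s (i + 1))) ** w (i - 1)" if "i \<ge> 1" for i
    using that by (cases i) auto
  then show ?thesis using a by (simp add: sturm_seq_def mat_monoid_def det_w)
qed

lemma adm: "admissible_with w N"
  using a by (auto simp: admissible_with_def mat_monoid_def det_N mat_symmetric_iff mult_nth_2 transpose_def algebra_simps)

lemma not_sym: "\<not> mat_symmetric N"
  using a by (simp add: mat_symmetric_iff)

lemma growth: "mult_growth s w"
  unfolding mult_growth_def
proof (rule exI[of _ 1], intro conjI, simp, rule exI[of _ 2], intro conjI allI impI)
  fix k l :: nat assume "1 \<le> k" and l: "1 \<le> l \<and> int l \<le> s (k + 1) + 1"
  then obtain j where j: "l = Suc j" by (cases l) auto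
  let ?M = "mat_pow (w k) j ** w (k - 1)"
  have eq: "mat_pow (w k) l ** w (k - 1) = w k ** ?M" by (simp add: j matrix_mul_assoc)
  show "1 * mat_height (w k) * mat_height (mat_pow (w k) (l - 1) ** w (k - 1)) \<le> mat_height (mat_pow (w k) l ** w (k - 1))"
    unfolding eq using G_height_mult[OF w_G G_pow[OF w_G w_G], of k k j "k - 1"] by (simp add: j)
  show "mat_height (mat_pow (w k) l ** w (k - 1)) \<le> 2 * mat_height (w k) * mat_height (mat_pow (w k) (l - 1) ** w (k - 1))"
    unfolding eq using mat_height_mult[of "w k" ?M] by (simp add: j)
qed auto

lemma s_pos: "1 \<le> s (Suc k)"
  using exps by (simp add: sturm_exps_def)

lemma s_bound: "\<exists>R. \<forall>k. nat (s (k + 2)) \<le> R"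
proof -
  obtain c where "\<And>k. \<bar>s k\<bar> \<le> c" using exps by (auto simp: sturm_exps_def)
  then have "nat (s (k + 2)) \<le> nat c" for k by (metis abs_ge_self nat_mono order_trans)
  then show ?thesis by blast
qed

lemma n_ge: "1 \<le> n k \<and> n k \<le> n (Suc k) \<and> k \<le> n (Suc k)"
proof (induction k)
  case (Suc k)
  have "1 * n (Suc k) \<le> nat (s (k + 2)) * n (Suc k)" using s_pos[of "Suc k"] by (intro mult_right_mono) auto
  moreover have "n (Suc (Suc k)) = nat (s (k + 2)) * n (Suc k) + n k" by simp
  ultimately show ?case using Suc by linarith
qed auto

section \<open>Growth of the heights of the words\<close>

definition W :: "nat \<Rightarrow> real" where "W k = ln (mat_height (w k))"

lemma G_height_ge_1: "A \<in> G \<Longrightarrow> 1 \<le> mat_height A"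
  by (auto simp: G_height G_def)

lemma ln_height_pow:
  assumes "A \<in> G" "B \<in> G"
  shows "j * ln (mat_height A) + ln (mat_height B) \<le> ln (mat_height (mat_pow A j ** B))"
    and "ln (mat_height (mat_pow A j ** B)) \<le> j * (ln (mat_height A) + ln 2) + ln (mat_height B)"
proof (induction j)
  case (Suc j)
  let ?M = "mat_pow A j ** B"
  have M: "?M \<in> G" by (rule G_pow[OF assms])
  have eq: "mat_pow A (Suc j) ** B = A ** ?M" by (rule mat_pow_Suc_mult)
  have pos: "0 < mat_height A" "0 < mat_height ?M" "0 < mat_height (A ** ?M)"
    using G_height_ge_1[OF assms(1)] G_height_ge_1[OF M] G_height_ge_1[OF G_mult[OF assms(1) M]] by linarith+
  {
    case 1
    have "ln (mat_height A * mat_height ?M) \<le> ln (mat_height (A ** ?M))"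
      using G_height_mult[OF assms(1) M] pos by (subst ln_le_cancel_iff) auto
    then show ?case using Suc(1) pos unfolding eq by (simp add: ln_mult algebra_simps)
  next
    case 2
    have "ln (mat_height (A ** ?M)) \<le> ln (2 * mat_height A * mat_height ?M)"
      using mat_height_mult[of A ?M] pos by (subst ln_le_cancel_iff) auto
    then show ?case using Suc(2) pos unfolding eq by (simp add: ln_mult algebra_simps)
  }
qed auto

lemma W_rec:
  "nat (s (k + 2)) * W (Suc k) + W k \<le> W (Suc (Suc k))"
  "W (Suc (Suc k)) \<le> nat (s (k + 2)) * (W (Suc k) + ln 2) + W k"
  using ln_height_pow[OF w_G w_G, where j = "nat (s (k + 2))"] by (auto simp: W_def)

lemma W_0: "W 0 = ln (a * (b + 1))" "W 1 = ln (a * (b + 2))"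
  using G_height[OF w_G[of 0]] G_height[OF w_G[of 1]] by (simp_all add: W_def add.commute)

lemma W_lower: "n k * ln (a * (b + 1)) \<le> W k"
proof (induction k rule: n.induct)
  case 2
  have "ln (real_of_int (a * (b + 1))) \<le> ln (real_of_int (a * (b + 2)))" using a b by (subst ln_le_cancel_iff) auto
  then show ?case using W_0 by simp
next
  case (3 k)
  let ?l = "ln (real_of_int (a * (b + 1)))" and ?s = "nat (s (k + 2))"
  have "real (n (Suc (Suc k))) * ?l = ?s * (n (Suc k) * ?l) + n k * ?l" by (simp add: algebra_simps)
  also have "\<dots> \<le> ?s * W (Suc k) + W k" using 3 by (intro add_mono mult_left_mono) auto
  also have "\<dots> \<le> W (Suc (Suc k))" by (rule W_rec)
  finally show ?case .
qed (simp add: W_0)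

text \<open>Adding ln 2 absorbs the factor 2 lost in each product, so \<open>W k + ln 2\<close> is
  subadditive along the recursion.\<close>

lemma W_upper: "W k + ln 2 \<le> n k * ln (2 * a * (b + 2))"
proof (induction k rule: n.induct)
  case 1
  have "W 0 + ln 2 = ln (real_of_int (2 * (a * (b + 1))))" using a b by (simp add: W_0 ln_mult)
  also have "\<dots> \<le> ln (real_of_int (2 * a * (b + 2)))" using a b by (subst ln_le_cancel_iff) auto
  finally show ?case by simp
next
  case 2
  have "W 1 + ln 2 = ln (real_of_int (2 * (a * (b + 2))))" using a b W_0(2) by (simp add: ln_mult)
  then show ?case by (simp add: mult.assoc)
next
  case (3 k)
  let ?l = "ln (real_of_int (2 * a * (b + 2)))" and ?s = "nat (s (k + 2))"
  have "W (Suc (Suc k)) + ln 2 \<le> ?s * (W (Suc k) + ln 2) + (W k + ln 2)" using W_rec(2)[of k] by simp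
  also have "\<dots> \<le> ?s * (n (Suc k) * ?l) + n k * ?l" using 3 by (intro add_mono mult_left_mono) auto
  also have "\<dots> = real (n (Suc (Suc k))) * ?l" by (simp add: algebra_simps)
  finally show ?case .
qed

text \<open>A bounded error in W = \<rho> n is essential: determinants are powers of a with exponent
  \<open>n k\<close>, and they must be comparable to a power of the height up to constant
  factors.\<close>

lemma growth_rate:
  "\<exists>(\<rho> :: real) C. (\<forall>k. \<bar>W k - \<rho> * n k\<bar> \<le> C) \<and> ln (a * (b + 1)) \<le> \<rho> \<and> \<rho> \<le> ln (2 * a * (b + 2))"
proof -
  obtain R where R: "\<forall>k. nat (s (k + 2)) \<le> R" using s_bound by blast
  have "\<exists>\<rho> C. \<forall>k. \<bar>W k - \<rho> * real (n k)\<bar> \<le> C"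
  proof (rule perturbed_recurrence[where r = "\<lambda>k. nat (s (k + 2))" and R = R and E = "R * ln 2"])
    show "1 \<le> nat (s (k + 2))" for k using s_pos[of "Suc k"] by simp
    show "\<bar>W (Suc (Suc k)) - (nat (s (k + 2)) * W (Suc k) + W k)\<bar> \<le> R * ln 2" for k
    proof -
      have "nat (s (k + 2)) * ln 2 \<le> R * (ln 2 :: real)" using R by (intro mult_right_mono) auto
      then show ?thesis using W_rec[of k] by (simp only: distrib_left abs_le_iff) linarith
    qed
  qed (use R in auto)
  then obtain \<rho> C :: real where C: "\<forall>k. \<bar>W k - \<rho> * n k\<bar> \<le> C" by blast
  have C': "\<bar>W k - n k * \<rho>\<bar> \<le> C" for k using C by (simp add: mult.commute)
  \<comment> \<open>Since \<open>n\<close> is unbounded, a bounded additive error does not affect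
    the comparison of slopes.\<close>
  have slope: "x \<le> z" if "\<And>k. n k * x \<le> n k * z + C + 1" for x z :: real
  proof (rule ccontr)
    assume "\<not> x \<le> z"
    then have xz: "x - z > 0" by simp
    obtain k :: nat where k: "(C + 1) / (x - z) < k" using reals_Archimedean2 by blast
    have "real k \<le> n (Suc k)" using n_ge[of k] by simp
    then have "(C + 1) / (x - z) < n (Suc k)" using k by linarith
    then have "C + 1 < n (Suc k) * (x - z)" using xz by (simp add: divide_less_eq)
    then show False using that[of "Suc k"] by (simp add: algebra_simps)
  qed
  have "ln (a * (b + 1)) \<le> \<rho>"
  proof (rule slope)
    show "n k * ln (a * (b + 1)) \<le> n k * \<rho> + C + 1" for k
      using W_lower[of k] C'[of k] by linarith
  qed
  moreover have "\<rho> \<le> ln (2 * a * (b + 2))"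
  proof (rule slope)
    have "ln 2 \<ge> (0::real)" by simp
    then show "n k * \<rho> \<le> n k * ln (2 * a * (b + 2)) + C + 1" for k
      using W_upper[of k] C'[of k] by linarith
  qed
  ultimately show ?thesis using C by blast
qed

lemma height_lim: "filterlim (\<lambda>i. mat_height (w i)) at_top sequentially"
  unfolding filterlim_at_top
proof
  fix Z :: real
  have "2 \<le> real_of_int (a * (b + 1))"
  proof -
    have "2 * 1 \<le> a * (b + 1)" using a b by (intro mult_mono) auto
    then show ?thesis by linarith
  qed
  then have l: "ln 2 \<le> ln (real_of_int (a * (b + 1)))" by (subst ln_le_cancel_iff) auto
  show "eventually (\<lambda>i. Z \<le> mat_height (w i)) sequentially"
  proof (rule eventually_sequentiallyI[of "Suc (nat \<lceil>Z / ln 2\<rceil>)"])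
    fix i assume i: "Suc (nat \<lceil>Z / ln 2\<rceil>) \<le> i"
    then obtain k where k: "i = Suc k" by (cases i) auto
    have "Z / ln 2 \<le> real k" using i k by linarith
    also have "\<dots> \<le> n i" using n_ge[of k] k by simp
    finally have "Z \<le> n i * ln 2" by (simp add: divide_le_eq)
    also have "\<dots> \<le> n i * ln (a * (b + 1))" using l by (intro mult_left_mono) auto
    also have "\<dots> \<le> W i" by (rule W_lower)
    also have "\<dots> \<le> mat_height (w i)" using G_height_ge_1[OF w_G[of i]] unfolding W_def by (intro ln_bound) auto
    finally show "Z \<le> mat_height (w i)" .
  qed
qed

text \<open>Multiplying y = A M by the adjugate of \<open>M\<close> shows that the content c divides
  a times every entry of \<open>A\<close>, so c^2 divides a^2 det A, up to sign a power of a. The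
  entry A11 is 1 modulo a, hence coprime to a and therefore to c. As c divides a A11, it divides
  a.\<close>

lemma content_bound:
  assumes y: "y = A ** M" "A \<in> G" "M = N \<or> M = transpose N" "mat_symmetric y" "\<bar>det A\<bar> = a ^ k"
  shows "mat_content y \<le> a"
proof -
  let ?c = "mat_content y"
  have "?c dvd y$1$1" "?c dvd y$1$2" "?c dvd y$2$2"
    unfolding mat_content_def by (meson gcd_dvd1 gcd_dvd2 dvd_trans)+
  then have dvd: "?c dvd y$i$j" for i j
    using y(4) exhaust_2[of i] exhaust_2[of j] by (auto simp: mat_symmetric_iff)
  have dM: "det M = - a" using y(3) by (auto simp: det_N det_transpose)
  have dA: "?c dvd a * A$i$j" for i j
  proof -
    have "a * A$i$1 = y$i$2 * M$2$1 - y$i$1 * M$2$2" "a * A$i$2 = y$i$1 * M$1$2 - y$i$2 * M$1$1"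
      using dM unfolding y(1) mult_nth_2 det_2 by algebra+
    then show ?thesis using dvd[of i 1] dvd[of i 2] exhaust_2[of j] by (metis dvd_diff dvd_mult2)
  qed
  have "a * a * det A = (a * A$1$1) * (a * A$2$2) - (a * A$1$2) * (a * A$2$1)" by (simp add: det_2 algebra_simps)
  then have "?c * ?c dvd a * a * det A" using dA by (simp add: mult_dvd_mono)
  then have "?c * ?c dvd a * a * \<bar>det A\<bar>" by (simp add: abs_if)
  then have cc: "?c * ?c dvd a ^ (k + 2)" by (simp add: y(5) power_add power2_eq_square mult_ac)
  have a1: "a dvd A$1$1 - 1" using y(2) by (simp add: G_def)
  have "coprime (A$1$1) a"
  proof (rule coprimeI)
    fix d assume d: "d dvd A$1$1" "d dvd a"
    have "d dvd A$1$1 - (A$1$1 - 1)" by (rule dvd_diff[OF d(1) dvd_trans[OF d(2) a1]])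
    then show "is_unit d" by simp
  qed
  then have "coprime (A$1$1) (a ^ (k + 2))" by simp
  then have "coprime (A$1$1) (?c * ?c)" using cc by (meson coprime_divisors dvd_refl)
  then have "coprime ?c (A$1$1)" by (simp add: coprime_commute)
  then have "?c dvd a" using dA[of 1 1] by (metis coprime_dvd_mult_left_iff)
  then show ?thesis using a zdvd_imp_le by simp
qed

text \<open>With \<delta> = ln a / \<rho>, the determinant a^(n k) is exp (\<delta> \<rho> n k),
  comparable to the height to the power \<delta>. Since only an enclosure of \<rho> is known, the
  bound on \<delta> required for Sturmian type stays a premise, to be checked by whoever chooses a
  and b.\<close>

lemma sturmian_type_exists:
  obtains \<delta> where "ln a / ln (2 * a * (b + 2)) \<le> \<delta>" "\<delta> \<le> ln a / ln (a * (b + 1))"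
    "\<delta> * (cf_limsup s + 1) < 1 \<Longrightarrow> \<exists>\<xi>. sturmian_type \<xi> \<and> omega_2 \<xi> = ereal (2 * cf_limsup s + 1 - \<delta> * (1 + cf_limsup s))"
proof -
  obtain \<rho> C :: real where C: "\<forall>k. \<bar>W k - \<rho> * n k\<bar> \<le> C" and \<rho>: "ln (a * (b + 1)) \<le> \<rho>" "\<rho> \<le> ln (2 * a * (b + 2))"
    using growth_rate by blast
  have la: "ln a > 0" using a by simp
  have "a * 1 < a * (b + 1)" using a b by (intro mult_strict_left_mono) auto
  then have lb: "ln a < ln (a * (b + 1))" using a by (subst ln_less_cancel_iff) auto
  have \<rho>0: "\<rho> > 0" using \<rho>(1) la lb by linarith
  define \<delta> where "\<delta> = ln a / \<rho>"
  have \<delta>: "0 \<le> \<delta>" "\<delta> < 1" using la lb \<rho>(1) \<rho>0 by (auto simp: \<delta>_def divide_less_eq)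
  have det_growth: "exp (- (\<delta> * C)) * mat_height (w i) powr \<delta> \<le> of_int \<bar>det (w i)\<bar> \<and>
      of_int \<bar>det (w i)\<bar> \<le> exp (\<delta> * C) * mat_height (w i) powr \<delta>" for i
  proof -
    have h: "mat_height (w i) powr \<delta> = exp (\<delta> * W i)"
      using G_height_ge_1[OF w_G[of i]] by (simp add: powr_def W_def)
    have d: "real_of_int \<bar>det (w i)\<bar> = exp (\<delta> * (\<rho> * n i))"
    proof -
      have eq: "\<delta> * (\<rho> * n i) = n i * ln a" using \<rho>0 by (simp add: \<delta>_def)
      have "exp (\<delta> * (\<rho> * n i)) = of_int a ^ n i" unfolding eq exp_of_nat_mult using a by simp
      then show ?thesis using a by (simp add: det_w)
    qed
    have "\<delta> * \<bar>W i - \<rho> * n i\<bar> \<le> \<delta> * C" using C \<delta> by (intro mult_left_mono) auto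
    then have "\<bar>\<delta> * W i - \<delta> * (\<rho> * n i)\<bar> \<le> \<delta> * C" using \<delta> by (simp add: abs_mult right_diff_distrib[symmetric])
    then show ?thesis unfolding h d exp_add[symmetric] by auto
  qed
  interpret S: sturmian s w N \<delta>
  proof unfold_locales
    show "\<exists>c1>0. \<exists>c2>0. \<forall>i. c1 * mat_height (w i) powr \<delta> \<le> of_int \<bar>det (w i)\<bar> \<and>
           of_int \<bar>det (w i)\<bar> \<le> c2 * mat_height (w i) powr \<delta>"
      using det_growth by (intro exI[of _ "exp (- (\<delta> * C))"] conjI exI[of _ "exp (\<delta> * C)"] allI) auto
  qed (use exps seq adm growth not_sym height_lim \<delta> in auto)
  have y_form: "\<exists>A M k. S.y i = A ** M \<and> A \<in> G \<and> (M = N \<or> M = transpose N) \<and> \<bar>det A\<bar> = a ^ k" for i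
  proof -
    obtain k l where "S.y i = S.u k (Suc l)" using S.y_cases[of i] by metis
    moreover have "\<bar>det (mat_pow (w (Suc k)) (Suc l) ** w k)\<bar> = a ^ (n (Suc k) * Suc l + n k)"
      using a by (simp add: det_mul det_mat_pow det_w power_add abs_mult power_abs flip: power_mult)
    moreover have "mat_pow (w (Suc k)) (Suc l) ** w k \<in> G" by (rule G_pow[OF w_G w_G])
    ultimately show ?thesis by (auto simp: S.u_def sturm_N_def simp del: mat_pow.simps)
  qed
  have content: "\<exists>K. \<forall>i\<ge>-2. mat_content (sturm_y s w N i) \<le> K"
  proof (intro exI allI impI)
    \<comment> \<open>The two initial points are not of the form treated by
      \<open>content_bound\<close>; their contents are simply added.\<close>
    let ?K = "a + mat_content (sturm_y s w N (-2)) + mat_content (sturm_y s w N (-1))"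
    have nn: "0 \<le> mat_content A" for A by (simp add: mat_content_def)
    fix i :: int assume "i \<ge> -2"
    then have "i = -2 \<or> i = -1 \<or> i = int (nat i)" by linarith
    then consider "i = -2" | "i = -1" | j where "i = int j" by blast
    then show "mat_content (sturm_y s w N i) \<le> ?K"
    proof cases
      case 3
      obtain A M k where "S.y j = A ** M" "A \<in> G" "M = N \<or> M = transpose N" "\<bar>det A\<bar> = a ^ k" using y_form by blast
      then have "mat_content (S.y j) \<le> a" using content_bound[of "S.y j" A M k] S.y_sym by blast
      then show ?thesis using nn[of "sturm_y s w N (-2)"] nn[of "sturm_y s w N (-1)"] by (simp add: 3 S.y_def)
    qed (use a nn[of "sturm_y s w N (-2)"] nn[of "sturm_y s w N (-1)"] in auto)
  qed
  define H where "H = mat_height N"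
  \<comment> \<open>\<open>approximation\<close> needs the first coordinate to be comparable to the
    height. As y = A M, the second row of y is \<theta> = A21 / A11 times the first, up to an error
    \<epsilon> controlled by |det y| / height. By symmetry a small y11 would make y12 and then y22
    small too.\<close>
  have first: "mat_height (S.y i) \<le> 4 * (of_int a)\<^sup>2 * \<bar>of_int (S.y i $1$1)\<bar> + (2 * a + 1) * (of_int \<bar>det (S.y i)\<bar> * (4 * a * (b + 2) * H\<^sup>2) / mat_height (S.y i))" for i
  proof -
    obtain A M k where A: "S.y i = A ** M" "A \<in> G" and M: "M = N \<or> M = transpose N" using y_form by blast
    let ?y = "S.y i"
    have hM: "mat_height M = H" using M by (auto simp: H_def mat_height_transpose)
    have dM: "det M = - a" using M by (auto simp: det_N det_transpose)
    have s: "?y$2$1 = ?y$1$2" using S.y_sym[of i] by (simp add: mat_symmetric_iff)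
    have A1: "1 \<le> A$1$1" "0 \<le> A$2$1" "A$2$1 \<le> 2 * a * A$1$1" "A$2$2 \<le> 2 * a * A$1$2" "A$1$2 \<le> (b + 2) * A$1$1"
      using A(2) by (auto simp: G_def)
    have e: "of_int (?y$2$j) * of_int (A$1$1) - of_int (A$2$1) * of_int (?y$1$j) = real_of_int (det A) * of_int (M$2$j)" for j
    proof -
      have "?y$2$j * A$1$1 - A$2$1 * ?y$1$j = det A * M$2$j" unfolding A(1) by (simp add: mult_nth_2 det_2 algebra_simps)
      from arg_cong[OF this, of real_of_int] show ?thesis by simp
    qed
    define \<theta> where "\<theta> = real_of_int (A$2$1) / of_int (A$1$1)"
    have A11: "real_of_int (A$1$1) \<ge> 1" using A1(1) by linarith
    have \<theta>: "0 \<le> \<theta>" "\<theta> \<le> 2 * a"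
    proof -
      show "0 \<le> \<theta>" using A1 A11 by (simp add: \<theta>_def)
      have "real_of_int (A$2$1) \<le> of_int (2 * a * A$1$1)" using A1(3) by (rule of_int_le_iff[THEN iffD2])
      then show "\<theta> \<le> 2 * a" using A11 by (simp add: \<theta>_def divide_le_eq)
    qed
    define \<epsilon> where "\<epsilon> = of_int \<bar>det ?y\<bar> * (4 * a * (b + 2) * H\<^sup>2) / mat_height ?y"
    have H1: "H \<ge> 1" unfolding H_def by (rule mat_height_ge_1) (use a in \<open>simp add: det_N\<close>)
    have near: "\<bar>of_int (?y$2$j) - \<theta> * of_int (?y$1$j)\<bar> \<le> \<epsilon>" for j
    proof -
      have "of_int (?y$2$j) - \<theta> * of_int (?y$1$j) = (of_int (?y$2$j) * of_int (A$1$1) - of_int (A$2$1) * of_int (?y$1$j)) / of_int (A$1$1)"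
        using A11 by (simp add: \<theta>_def field_simps)
      also have "\<dots> = of_int (det A) * of_int (M$2$j) / of_int (A$1$1)" unfolding e ..
      finally have "\<bar>of_int (?y$2$j) - \<theta> * of_int (?y$1$j)\<bar> = \<bar>of_int (det A)\<bar> * \<bar>of_int (M$2$j)\<bar> / of_int (A$1$1)"
        using A11 by (simp add: abs_mult)
      also have "\<dots> \<le> \<bar>of_int (det A)\<bar> * H / of_int (A$1$1)"
        using mat_height_ge[of M 2 j] A11 unfolding hM by (intro divide_right_mono mult_left_mono) auto
      also have "\<dots> \<le> \<bar>of_int (det A)\<bar> * H * (4 * a * (b + 2) * H / mat_height ?y)"
      proof -
        have "mat_height A \<le> of_int (2 * a * (b + 2)) * of_int (A$1$1)"
        proof -
          have "A$2$2 \<le> 2 * a * ((b + 2) * A$1$1)"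
            using A1(4) mult_left_mono[OF A1(5), of "2 * a"] a by linarith
          then have "real_of_int (A$2$2) \<le> of_int (2 * a * ((b + 2) * A$1$1))" by (rule of_int_le_iff[THEN iffD2])
          then show ?thesis by (simp add: G_height[OF A(2)] mult.assoc)
        qed
        then have "2 * mat_height A * H \<le> 2 * (of_int (2 * a * (b + 2)) * of_int (A$1$1)) * H"
          using H1 by (intro mult_right_mono mult_left_mono) auto
        moreover have "mat_height ?y \<le> 2 * mat_height A * H"
          using mat_height_mult[of A M] unfolding A(1) hM .
        moreover have "2 * (of_int (2 * a * (b + 2)) * of_int (A$1$1)) * H = (4 * a * (b + 2) * H) * of_int (A$1$1)"
          by simp
        ultimately have "mat_height ?y \<le> (4 * a * (b + 2) * H) * of_int (A$1$1)" by linarith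
        then have "1 / of_int (A$1$1) \<le> 4 * a * (b + 2) * H / mat_height ?y"
          using A11 S.height_y_ge_1[of i] by (simp add: divide_le_eq le_divide_eq)
        then have "\<bar>of_int (det A)\<bar> * H * (1 / of_int (A$1$1)) \<le> \<bar>of_int (det A)\<bar> * H * (4 * a * (b + 2) * H / mat_height ?y)"
          using H1 by (intro mult_left_mono) auto
        then show ?thesis by simp
      qed
      also have "\<dots> \<le> \<epsilon>"
      proof -
        have "1 * \<bar>det A\<bar> \<le> a * \<bar>det A\<bar>" using a by (intro mult_right_mono) auto
        also have "\<dots> = \<bar>det ?y\<bar>" using a by (simp add: A(1) det_mul dM abs_mult)
        finally have "real_of_int \<bar>det A\<bar> \<le> of_int \<bar>det ?y\<bar>" by linarith
        then have "real_of_int \<bar>det A\<bar> * (4 * a * (b + 2) * H\<^sup>2 / mat_height ?y) \<le> of_int \<bar>det ?y\<bar> * (4 * a * (b + 2) * H\<^sup>2 / mat_height ?y)"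
          using a b mat_height_nonneg[of ?y] by (intro mult_right_mono) auto
        then show ?thesis by (simp add: \<epsilon>_def power2_eq_square mult_ac)
      qed
      finally show ?thesis .
    qed
    have \<epsilon>0: "\<epsilon> \<ge> 0" using near[of 1] by linarith
    let ?p = "\<bar>real_of_int (?y$1$1)\<bar>" and ?a = "real_of_int a"
    have a2: "?a \<ge> 2" using a by simp
    have 1: "\<bar>of_int (?y$1$2)\<bar> \<le> 2 * ?a * ?p + \<epsilon>"
    proof -
      have "\<bar>\<theta> * of_int (?y$1$1)\<bar> \<le> 2 * ?a * ?p" unfolding abs_mult using \<theta> by (intro mult_right_mono) auto
      then show ?thesis using near[of 1] unfolding s by linarith
    qed
    have 2: "\<bar>of_int (?y$2$2)\<bar> \<le> 2 * ?a * (2 * ?a * ?p + \<epsilon>) + \<epsilon>"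
    proof -
      have "\<bar>\<theta> * of_int (?y$1$2)\<bar> \<le> 2 * ?a * (2 * ?a * ?p + \<epsilon>)" unfolding abs_mult using \<theta> 1 by (intro mult_mono) auto
      then show ?thesis using near[of 2] by linarith
    qed
    have z: "0 \<le> 2 * ?a * ?p + \<epsilon>" using a2 \<epsilon>0 by simp
    then have 3: "1 * (2 * ?a * ?p + \<epsilon>) \<le> 2 * ?a * (2 * ?a * ?p + \<epsilon>)" using a2 by (intro mult_right_mono) auto
    have 4: "1 * ?p \<le> 2 * ?a * ?p" using a2 by (intro mult_right_mono) auto
    have gen: "p \<le> Y + \<epsilon> \<and> q \<le> Y + \<epsilon> \<and> r \<le> Y + \<epsilon>"
      if "q \<le> X + \<epsilon>" "r \<le> Y + \<epsilon>" "1 * (X + \<epsilon>) \<le> Y" "1 * p \<le> X" for p q r X Y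
      using that \<epsilon>0 by auto
    have "mat_height ?y \<le> 2 * ?a * (2 * ?a * ?p + \<epsilon>) + \<epsilon>"
      unfolding mat_height_sym[OF S.y_sym] max.bounded_iff by (rule gen[OF 1 2 3 4])
    also have "\<dots> = 4 * ?a\<^sup>2 * ?p + (2 * ?a + 1) * \<epsilon>" by (simp add: power2_eq_square algebra_simps)
    finally show ?thesis unfolding \<epsilon>_def by simp
  qed
  obtain K where K: "K \<ge> 0" "\<And>i. of_int \<bar>det (S.y i)\<bar> \<le> exp (\<delta> * S.\<Lambda> i + K)" using S.det_y_le by blast
  define J where "J = (2 * a + 1) * (exp K * (4 * a * (b + 2) * H\<^sup>2))"
  have y0: "eventually (\<lambda>i. 1 / (8 * (of_int a)\<^sup>2) * mat_height (S.y i) \<le> \<bar>of_int (S.y i $1$1)\<bar>) sequentially"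
  proof -
    \<comment> \<open>The height exp \<Lambda> is at least \<Lambda> \<ge> 2 J, so the error term J
      takes at most half of it.\<close>
    have "eventually (\<lambda>i. S.\<Lambda> i \<ge> 2 * J) sequentially" using S.\<Lambda>_lim by (simp add: filterlim_at_top)
    then show ?thesis
    proof eventually_elim
      case (elim i)
      have c: "(0::real) \<le> 2 * a + 1" "(0::real) \<le> 4 * a * (b + 2) * H\<^sup>2" using a b by auto
      have \<Lambda>0: "0 \<le> S.\<Lambda> i" using S.height_y_ge_1[of i] by (simp add: S.\<Lambda>_def)
      have "of_int \<bar>det (S.y i)\<bar> \<le> exp K * mat_height (S.y i)"
      proof -
        have "\<delta> * S.\<Lambda> i \<le> S.\<Lambda> i" using \<delta> \<Lambda>0 by (simp add: mult_left_le_one_le)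
        then have "exp (\<delta> * S.\<Lambda> i + K) \<le> exp (K + S.\<Lambda> i)" by simp
        then have "of_int \<bar>det (S.y i)\<bar> \<le> exp (K + S.\<Lambda> i)" using K(2)[of i] by linarith
        then show ?thesis by (simp only: exp_add S.exp_\<Lambda>)
      qed
      then have "of_int \<bar>det (S.y i)\<bar> * (4 * a * (b + 2) * H\<^sup>2) \<le> exp K * mat_height (S.y i) * (4 * a * (b + 2) * H\<^sup>2)"
        using c(2) by (intro mult_right_mono) auto
      then have "of_int \<bar>det (S.y i)\<bar> * (4 * a * (b + 2) * H\<^sup>2) / mat_height (S.y i) \<le> exp K * (4 * a * (b + 2) * H\<^sup>2)"
        using S.height_y_ge_1[of i] by (simp add: divide_le_eq mult_ac)
      then have "(2 * a + 1) * (of_int \<bar>det (S.y i)\<bar> * (4 * a * (b + 2) * H\<^sup>2) / mat_height (S.y i)) \<le> J"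
        unfolding J_def using c(1) by (intro mult_left_mono) auto
      moreover have "J \<le> mat_height (S.y i) / 2"
        using elim exp_ge_add_one_self[of "S.\<Lambda> i"] by (simp add: S.exp_\<Lambda>)
      ultimately have "mat_height (S.y i) / 2 \<le> 4 * (of_int a)\<^sup>2 * \<bar>of_int (S.y i $1$1)\<bar>" using first[of i] by linarith
      then show ?case using a by (simp add: divide_le_eq mult_ac)
    qed
  qed
  have c0: "0 < 1 / (8 * (real_of_int a)\<^sup>2)" using a by simp
  show ?thesis
  proof (rule that[of \<delta>])
    show "ln a / ln (2 * a * (b + 2)) \<le> \<delta>" "\<delta> \<le> ln a / ln (a * (b + 1))"
      unfolding \<delta>_def using \<rho> la lb \<rho>0 by (auto intro!: divide_left_mono mult_pos_pos)
    assume d: "\<delta> * (cf_limsup s + 1) < 1"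
    show "\<exists>\<xi>. sturmian_type \<xi> \<and> omega_2 \<xi> = ereal (2 * cf_limsup s + 1 - \<delta> * (1 + cf_limsup s))"
    proof (rule S.approximation[OF c0 y0])
      fix \<xi> K i0
      assume lim1: "(\<lambda>i. real_of_int (S.y i $1$2) / of_int (S.y i $1$1)) \<longlonglongrightarrow> \<xi>"
        and lim2: "(\<lambda>i. real_of_int (S.y i $2$2) / of_int (S.y i $1$1)) \<longlonglongrightarrow> \<xi>\<^sup>2"
      have nz: "eventually (\<lambda>i. S.y i $1$1 \<noteq> 0) sequentially"
        using y0
      proof eventually_elim
        case (elim i)
        have "0 < 1 / (8 * (real_of_int a)\<^sup>2) * mat_height (S.y i)" using c0 S.height_y_ge_1[of i] by simp
        then show ?case using elim by auto
      qed
      have lim: "limitin proj_topology (\<lambda>n::nat. span {mat_point (sturm_y s w N (int n))}) (span {vector [1, \<xi>, \<xi>\<^sup>2]}) sequentially"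
        by (rule limitin_projI) (use nz lim1 lim2 in \<open>simp_all add: mat_point_def vector_3 S.y_def\<close>)
      interpret S': sturmian_number s w N \<delta> \<xi>
        by unfold_locales (rule content, rule lim)
      have "sturmian_type \<xi>"
        unfolding sturmian_type_def using exps seq adm growth not_sym height_lim content lim \<delta> S.det_growth d
        unfolding delta_less_iff[OF exps, symmetric] by blast
      then show ?thesis using S'.omega_2_sturmian[OF d] by blast
    qed
  qed
qed

end

section \<open>The set of exponents\<close>

definition periodic_exps :: "int \<Rightarrow> int \<Rightarrow> nat \<Rightarrow> int" where
  "periodic_exps p q k = (if k = 0 then -1 else if k = 1 then 1 else if even k then p else q)"

lemma sturm_exps_periodic:
  assumes "p \<ge> 1" "q \<ge> 1" shows "sturm_exps (periodic_exps p q)"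
proof -
  have "\<bar>periodic_exps p q k\<bar> \<le> p + q" for k using assms by (simp add: periodic_exps_def)
  then have "\<exists>B. \<forall>k. \<bar>periodic_exps p q k\<bar> \<le> B" by blast
  then show ?thesis unfolding sturm_exps_def using assms by (simp add: periodic_exps_def)
qed

text \<open>The hypothesis on L says L = p + 1 / M with M = q + 1 / L, the purely periodic value.
  The continued fractions approach L and M alternately, and q \<le> p makes L the larger
  one.\<close>

lemma cf_limsup_periodic:
  assumes pq: "1 \<le> q" "q \<le> p" and L: "L > 0" "of_int q * L\<^sup>2 = of_int p * of_int q * L + of_int p"
  shows "cf_limsup (periodic_exps p q) = L"
proof -
  let ?s = "periodic_exps p q"
  have exps: "sturm_exps ?s" using pq by (intro sturm_exps_periodic) auto
  define M where "M = of_int q + 1 / L"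
  have p1: "real_of_int p \<ge> 1" and q1: "real_of_int q \<ge> 1" using pq by auto
  have M0: "M > 0" using L q1 by (simp add: M_def add_pos_pos)
  have LM: "L = of_int p + 1 / M"
  proof -
    have "(of_int q * L + 1) * L = (of_int q * L + 1) * of_int p + L" using L(2) by (simp add: algebra_simps power2_eq_square)
    moreover have "of_int q * L + 1 > 0" using L q1 by (simp add: add_pos_pos)
    ultimately have "L = of_int p + L / (of_int q * L + 1)" by (simp add: field_simps)
    moreover have "1 / M = L / (of_int q * L + 1)" using L by (simp add: M_def field_simps)
    ultimately show ?thesis by simp
  qed
  have "1 / M > 0" using M0 by simp
  then have L1: "L > 1" using LM p1 by linarith
  define g where "g = 1 + 1 / L"
  have g: "g > 1" "g \<le> M" using L q1 by (auto simp: g_def M_def)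
  have M_le_L: "M \<le> L"
  proof (cases "p = q")
    case True
    have "of_int q * (L * L) = of_int q * (of_int q * L + 1)" using L(2) True by (simp add: power2_eq_square algebra_simps)
    then have "L * L = of_int q * L + 1" using q1 by simp
    then have "L = M" using L by (simp add: M_def field_simps)
    then show ?thesis by simp
  next
    case False
    then have "q + 1 \<le> p" using pq by simp
    then have "real_of_int q + 1 \<le> of_int p" by linarith
    moreover have "1 / L \<le> 1" using L1 by simp
    ultimately show ?thesis using LM \<open>1 / M > 0\<close> unfolding M_def by linarith
  qed
  \<comment> \<open>\<open>cf s (Suc k)\<close> begins with \<open>s (k + 2)\<close>, which is p for
    even k; so the value L sits at odd indices.\<close>
  define \<tau> where "\<tau> k = (if odd k then L else M)" for k :: nat
  have \<tau>: "\<tau> k \<ge> g" for k using g M_le_L by (simp add: \<tau>_def)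
  have \<tau>_Suc: "\<tau> (Suc k) = of_int (?s (k + 2)) + 1 / \<tau> k" for k
  proof (cases "even k")
    case True
    then show ?thesis using LM by (simp add: \<tau>_def periodic_exps_def)
  next
    case False
    then show ?thesis by (cases "k = 0") (simp_all add: \<tau>_def periodic_exps_def M_def)
  qed
  have "(\<lambda>k. \<bar>cf ?s k - \<tau> k\<bar>) \<longlonglongrightarrow> 0"
  proof (rule perturbed_contraction[of "1 / g" _ "\<lambda>_. 0"])
    show "eventually (\<lambda>k. \<bar>cf ?s (Suc k) - \<tau> (Suc k)\<bar> \<le> 1 / g * \<bar>cf ?s k - \<tau> k\<bar> + 0) sequentially"
    proof (intro always_eventually allI)
      fix k
      define c t where "c = cf ?s k" and "t = \<tau> k"
      have ct: "c \<ge> 1" "t \<ge> g" using cf_ge_1[OF exps, of k] \<tau>[of k] by (auto simp: c_def t_def)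
      have pos: "c > 0" "t > 0" using ct g by linarith+
      have "cf ?s (Suc k) - \<tau> (Suc k) = 1 / c - 1 / t" by (simp add: cf_Suc \<tau>_Suc c_def t_def)
      also have "\<dots> = (t - c) / (c * t)" using pos by (simp add: diff_frac_eq)
      finally have "\<bar>cf ?s (Suc k) - \<tau> (Suc k)\<bar> = \<bar>c - t\<bar> / (c * t)"
        using pos by (simp add: abs_divide abs_minus_commute)
      also have "\<dots> \<le> \<bar>c - t\<bar> / (1 * g)" using ct pos g by (intro divide_left_mono mult_mono mult_pos_pos) auto
      finally show "\<bar>cf ?s (Suc k) - \<tau> (Suc k)\<bar> \<le> 1 / g * \<bar>cf ?s k - \<tau> k\<bar> + 0" by (simp add: c_def t_def)
    qed
  qed (use g in auto)
  then have near: "eventually (\<lambda>k. \<bar>cf ?s k - \<tau> k\<bar> < \<eta>) sequentially" if "\<eta> > 0" for \<eta>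
    using that by (rule order_tendstoD)
  have "limsup (\<lambda>k. ereal (cf ?s k)) = ereal L"
  proof (rule limsup_ereal_eqI)
    fix \<eta> :: real assume \<eta>: "\<eta> > 0"
    show "eventually (\<lambda>k. cf ?s k \<le> L + \<eta>) sequentially"
      using near[OF \<eta>]
    proof eventually_elim
      case (elim k)
      moreover have "\<tau> k \<le> L" using M_le_L by (simp add: \<tau>_def)
      ultimately show ?case by linarith
    qed
    have "frequently (odd :: nat \<Rightarrow> bool) sequentially"
      unfolding frequently_sequentially by (metis even_Suc le_SucI order_refl)
    from frequently_eventually_frequently[OF this near[OF \<eta>]]
    show "frequently (\<lambda>k. L - \<eta> \<le> cf ?s k) sequentially"
    proof (rule frequently_elim1)
      fix k assume k: "odd k \<and> \<bar>cf ?s k - \<tau> k\<bar> < \<eta>"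
      then have "\<tau> k = L" by (simp add: \<tau>_def)
      then show "L - \<eta> \<le> cf ?s k" using k by linarith
    qed
  qed
  then show ?thesis by (simp add: cf_limsup_def[OF exps])
qed

text \<open>Take a rational v / m in the interval, a = p^v and b + 1 = p^(m-v): the upper ratio is
  then exactly v / m. The lower one differs only through an extra ln 4 in the denominator,
  negligible for large p.\<close>

lemma log_ratio_dense:
  assumes "0 \<le> \<alpha>" "\<alpha> < \<beta>" "\<beta> \<le> 1"
  obtains a b :: int where "a \<ge> 2" "b \<ge> 1" "\<alpha> < ln a / ln (2 * a * (b + 2))" "ln a / ln (a * (b + 1)) < \<beta>"
proof -
  obtain x where x: "x \<in> \<rat>" "\<alpha> < x" "x < \<beta>" using Rats_dense_in_real[OF assms(2)] by blast
  obtain v m :: nat where vm: "m \<noteq> 0" "\<bar>x\<bar> = real v / real m" using Rats_abs_nat_div_natE[OF x(1)] by metis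
  have xv: "x = v / m" using vm(2) x assms by simp
  have "v > 0" using xv x(2) assms(1) by (cases "v = 0") auto
  have "x < 1" using x(3) assms(3) by linarith
  then have "real v < real m" using vm(1) unfolding xv by (simp add: divide_less_eq)
  then have "v < m" by simp
  define u where "u = m - v"
  have u: "u > 0" "v + u = m" using \<open>v < m\<close> by (auto simp: u_def)
  have av: "v - \<alpha> * m > 0" using x(2) vm(1) unfolding xv by (simp add: less_divide_eq)
  \<comment> \<open>The threshold for ln p beyond which \<alpha> (ln 4 + m ln p) < v ln p.\<close>
  define c where "c = \<alpha> * ln 4 / (v - \<alpha> * m)"
  define p :: int where "p = max 2 (\<lceil>exp c\<rceil> + 1)"
  have p: "p \<ge> 2" by (simp add: p_def)
  have "exp c < p" unfolding p_def by linarith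
  then have "ln (exp c) < ln p" using p by (subst ln_less_cancel_iff) auto
  then have "c < ln p" by simp
  then have key: "\<alpha> * ln 4 < (v - \<alpha> * m) * ln p" using av by (simp add: c_def divide_less_eq mult.commute)
  have lp: "ln p > 0" using p by simp
  define a where "a = p ^ v"
  define b where "b = p ^ u - 1"
  have pu: "p ^ u \<ge> 2" "p ^ v \<ge> 2"
    using p u \<open>v > 0\<close> self_le_power[of p u] self_le_power[of p v] by auto
  have lna: "ln a = v * ln p" using p by (simp add: a_def ln_realpow)
  have "a * (b + 1) = p ^ m" using u(2) by (simp add: a_def b_def flip: power_add)
  then have lnab: "ln (a * (b + 1)) = m * ln p" using p by (simp add: ln_realpow flip: of_int_mult)
  have "ln (2 * a * (b + 2)) \<le> ln (4 * real_of_int p ^ m)"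
  proof -
    have "2 * a * (b + 2) \<le> 2 * a * (2 * p ^ u)" using pu by (intro mult_left_mono) (auto simp: a_def b_def)
    also have "\<dots> = 4 * p ^ m" using u(2) by (simp add: a_def flip: power_add)
    finally have "real_of_int (2 * a * (b + 2)) \<le> of_int (4 * p ^ m)" by (rule of_int_le_iff[THEN iffD2])
    moreover have "0 < 2 * a * (b + 2)" using pu by (simp add: a_def b_def)
    then have "0 < real_of_int (2 * a * (b + 2))" by linarith
    moreover have "ln y \<le> ln z" if "y \<le> z" "0 < y" for y z :: real using that by simp
    ultimately have "ln (real_of_int (2 * a * (b + 2))) \<le> ln (real_of_int (4 * p ^ m))" by blast
    then show ?thesis by simp
  qed
  also have "\<dots> = ln 4 + m * ln p" using p by (simp add: ln_mult ln_realpow)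
  finally have l2: "ln (2 * a * (b + 2)) \<le> ln 4 + m * ln p" .
  have pos: "ln (2 * a * (b + 2)) > 0"
  proof -
    have "1 * 1 < 2 * a * (b + 2)" using pu by (intro mult_strict_mono) (auto simp: a_def b_def)
    then have "1 < real_of_int (2 * a * (b + 2))" by linarith
    then show ?thesis by simp
  qed
  show ?thesis
  proof (rule that[of a b])
    have "\<alpha> * ln (2 * a * (b + 2)) \<le> \<alpha> * (ln 4 + m * ln p)" using l2 assms(1) by (rule mult_left_mono)
    also have "\<dots> < v * ln p" using key by (simp add: algebra_simps)
    finally show "\<alpha> < ln a / ln (2 * a * (b + 2))" using pos by (simp add: lna less_divide_eq)
    show "ln a / ln (a * (b + 1)) < \<beta>" unfolding lna lnab using lp x(3) xv by simp
  qed (use pu in \<open>auto simp: a_def b_def\<close>)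
qed

abbreviation sturmian_values :: "real set" where
  "sturmian_values \<equiv> (\<lambda>\<xi>. real_of_ereal (omega_2 \<xi>)) ` {\<xi>. sturmian_type \<xi>}"

lemma interval_in_closure:
  assumes pq: "1 \<le> q" "q \<le> p" and L: "L > 0" "of_int q * L\<^sup>2 = of_int p * of_int q * L + of_int p"
    and t: "2 * L \<le> t" "t \<le> 2 * L + 1"
  shows "t \<in> closure sturmian_values"
  unfolding closure_approachable
proof (intro allI impI)
  fix e :: real assume e: "e > 0"
  let ?s = "periodic_exps p q"
  have exps: "sturm_exps ?s" using pq by (intro sturm_exps_periodic) auto
  have cf: "cf_limsup ?s = L" by (rule cf_limsup_periodic[OF pq L])
  \<comment> \<open>The \<delta> for which the exponent would be exactly t. The window of radius e /
    (1 + L) around it is cut to the admissible range, which leaves a non-empty open interval even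
    when t = 2 L and \<open>d0\<close> itself is excluded.\<close>
  define d0 where "d0 = (2 * L + 1 - t) / (1 + L)"
  have d0: "0 \<le> d0" "d0 \<le> 1 / (1 + L)" using t L by (auto simp: d0_def divide_right_mono)
  define \<alpha> where "\<alpha> = max 0 (d0 - e / (1 + L))"
  define \<beta> where "\<beta> = min (1 / (1 + L)) (d0 + e / (1 + L))"
  have e': "e / (1 + L) > 0" "1 / (1 + L) > 0" using e L by auto
  have "\<beta> \<le> 1 / (1 + L)" "1 / (1 + L) \<le> 1" using L by (auto simp: \<beta>_def)
  then have "\<beta> \<le> 1" by linarith
  then have ab: "0 \<le> \<alpha>" "\<alpha> < \<beta>" "\<beta> \<le> 1" using d0 e' unfolding \<alpha>_def \<beta>_def by auto
  obtain a b :: int where *: "a \<ge> 2" "b \<ge> 1" "\<alpha> < ln a / ln (2 * a * (b + 2))" "ln a / ln (a * (b + 1)) < \<beta>"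
    using log_ratio_dense[OF ab] by blast
  interpret construction ?s a b by unfold_locales (use exps * in auto)
  show "\<exists>y\<in>sturmian_values. dist y t < e"
  proof (rule sturmian_type_exists)
    fix \<delta> assume \<delta>: "ln a / ln (2 * a * (b + 2)) \<le> \<delta>" "\<delta> \<le> ln a / ln (a * (b + 1))"
      and ex: "\<delta> * (cf_limsup ?s + 1) < 1 \<Longrightarrow> \<exists>\<xi>. sturmian_type \<xi> \<and> omega_2 \<xi> = ereal (2 * cf_limsup ?s + 1 - \<delta> * (1 + cf_limsup ?s))"
    have d: "d0 - e / (1 + L) < \<delta>" "\<delta> < d0 + e / (1 + L)" "\<delta> < 1 / (1 + L)"
      using \<delta> *(3,4) unfolding \<alpha>_def \<beta>_def by linarith+
    have "\<delta> * (L + 1) < 1" using d(3) L by (simp add: less_divide_eq add.commute)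
    then obtain \<xi> where \<xi>: "sturmian_type \<xi>" "omega_2 \<xi> = ereal (2 * L + 1 - \<delta> * (1 + L))" using ex unfolding cf by blast
    have "\<bar>\<delta> - d0\<bar> < e / (1 + L)" using d by linarith
    then have "\<bar>\<delta> - d0\<bar> * (1 + L) < e" using L by (simp add: less_divide_eq)
    moreover have "2 * L + 1 - \<delta> * (1 + L) - t = - ((\<delta> - d0) * (1 + L))" using L by (simp add: d0_def field_simps)
    then have "\<bar>2 * L + 1 - \<delta> * (1 + L) - t\<bar> = \<bar>\<delta> - d0\<bar> * (1 + L)" using L by (simp add: abs_mult)
    ultimately have "dist (real_of_ereal (omega_2 \<xi>)) t < e" by (simp add: \<xi>(2) dist_real_def)
    then show ?thesis using \<xi>(1) by blast
  qed
qed

lemma quadratic_root: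
  fixes p c :: real
  assumes "p \<ge> 0" "c \<ge> 0"
  shows "((p + sqrt (p\<^sup>2 + 4 * c)) / 2)\<^sup>2 = p * ((p + sqrt (p\<^sup>2 + 4 * c)) / 2) + c"
proof -
  define r where "r = sqrt (p\<^sup>2 + 4 * c)"
  have "r * r = p * p + 4 * c" using assms by (simp add: r_def power2_eq_square)
  moreover have "((p + r) / 2)\<^sup>2 = (p * p + 2 * (p * r) + r * r) / 4" by (simp add: power2_eq_square field_simps)
  ultimately show ?thesis unfolding r_def[symmetric] by (simp add: field_simps)
qed

lemma root_interval_in_closure:
  fixes p q :: int
  assumes pq: "1 \<le> q" "q \<le> p"
    and t: "p + sqrt ((of_int p)\<^sup>2 + 4 * (p / q)) \<le> t" "t \<le> p + sqrt ((of_int p)\<^sup>2 + 4 * (p / q)) + 1"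
  shows "t \<in> closure sturmian_values"
proof -
  define L where "L = (p + sqrt ((of_int p)\<^sup>2 + 4 * (p / q))) / 2"
  have pq': "real_of_int p \<ge> 1" "real_of_int q \<ge> 1" using pq by auto
  have "L\<^sup>2 = p * L + p / q" unfolding L_def using quadratic_root[of p "p / q"] pq' by simp
  then have "of_int q * L\<^sup>2 = of_int p * of_int q * L + of_int p" using pq' by (simp add: field_simps)
  moreover have "L > 0" using pq' by (auto simp: L_def intro!: add_pos_nonneg)
  moreover have "2 * L = p + sqrt ((of_int p)\<^sup>2 + 4 * (p / q))" unfolding L_def by simp
  ultimately show ?thesis using t by (intro interval_in_closure[OF pq, of L]) linarith+
qed

text \<open>\<open>f j\<close> is 2 L for p = q = j + 3. For p = m \<ge> 3, the choices q = m, 2, 1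
  give three overlapping intervals of length 1, and the last one reaches the first interval for p =
  m + 1 because x^2 + 2 x + 5 \<le> x^2 + 4 x for x \<ge> 3. For x = 2 this inequality fails, whence
  the gap before 3 + sqrt 13.\<close>

lemma large_in_closure:
  assumes "3 + sqrt 13 \<le> t" shows "t \<in> closure sturmian_values"
proof -
  define f where "f j = real j + 3 + sqrt ((real j + 3)\<^sup>2 + 4)" for j
  have f0: "f 0 \<le> t" using assms by (simp add: f_def power2_eq_square)
  have "\<exists>j. t < f (Suc j)"
  proof -
    obtain j :: nat where "t < j" using reals_Archimedean2 by blast
    moreover have "real j \<le> f (Suc j)" by (simp add: f_def add_nonneg_nonneg)
    ultimately show ?thesis by (meson less_le_trans)
  qed
  then obtain j where j: "t < f (Suc j)" "\<And>i. i < j \<Longrightarrow> f (Suc i) \<le> t"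
    using exists_least_iff[of "\<lambda>j. t < f (Suc j)"] by (auto simp: not_less)
  have fj: "f j \<le> t" using f0 j(2)[of "j - 1"] by (cases j) auto
  define m where "m = int j + 3"
  define x where "x = real_of_int m"
  have m: "m \<ge> 3" and x: "x \<ge> 3" by (auto simp: m_def x_def)
  have f_x: "f j = x + sqrt (x\<^sup>2 + 4)" "f (Suc j) = x + 1 + sqrt ((x + 1)\<^sup>2 + 4)"
    by (auto simp: f_def x_def m_def add_ac)
  have s1: "sqrt (x\<^sup>2 + 2 * x) \<le> sqrt (x\<^sup>2 + 4) + 1"
  proof -
    have "sqrt (x\<^sup>2 + 2 * x) \<le> x + 1" using x by (intro real_le_lsqrt) (auto simp: power2_eq_square algebra_simps)
    moreover have "x \<le> sqrt (x\<^sup>2 + 4)" by (intro real_le_rsqrt) auto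
    ultimately show ?thesis by linarith
  qed
  have s2: "sqrt (x\<^sup>2 + 4 * x) \<le> sqrt (x\<^sup>2 + 2 * x) + 1"
  proof (rule real_le_lsqrt)
    have "x \<le> sqrt (x\<^sup>2 + 2 * x)" using x by (intro real_le_rsqrt) auto
    moreover have "(sqrt (x\<^sup>2 + 2 * x) + 1)\<^sup>2 = x\<^sup>2 + 2 * x + 2 * sqrt (x\<^sup>2 + 2 * x) + 1"
      using x by (simp add: power2_sum)
    ultimately show "x\<^sup>2 + 4 * x \<le> (sqrt (x\<^sup>2 + 2 * x) + 1)\<^sup>2" by linarith
  qed (use x in simp)
  have s3: "sqrt ((x + 1)\<^sup>2 + 4) \<le> sqrt (x\<^sup>2 + 4 * x)"
    using x by (simp add: power2_eq_square algebra_simps)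
  consider "t \<le> x + sqrt (x\<^sup>2 + 4) + 1" | "x + sqrt (x\<^sup>2 + 4) + 1 \<le> t" "t \<le> x + sqrt (x\<^sup>2 + 2 * x) + 1"
    | "x + sqrt (x\<^sup>2 + 2 * x) + 1 \<le> t" by linarith
  then show ?thesis
  proof cases
    case 1
    then show ?thesis using m x fj unfolding f_x by (intro root_interval_in_closure[of m m]) (auto simp: x_def)
  next
    case 2
    have "x + sqrt (x\<^sup>2 + 2 * x) \<le> t" using 2(1) s1 by linarith
    then show ?thesis using m 2(2) by (intro root_interval_in_closure[of 2 m]) (auto simp: x_def)
  next
    case 3
    have "x + sqrt (x\<^sup>2 + 4 * x) \<le> t" using 3 s2 by linarith
    moreover have "t \<le> x + sqrt (x\<^sup>2 + 4 * x) + 1" using s3 j(1) unfolding f_x by linarith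
    ultimately show ?thesis using m by (intro root_interval_in_closure[of 1 m]) (auto simp: x_def)
  qed
qed

theorem corollary1p3:
  shows "closure ((\<lambda>\<xi>. real_of_ereal (omega_2 \<xi>)) ` {\<xi>. sturmian_type \<xi>}) =
    {1 + sqrt 5 .. 2 + sqrt 5} \<union> {2 + 2 * sqrt 2 .. 3 + 2 * sqrt 3} \<union> {3 + sqrt 13 ..}"
    (is "_ = ?R")
proof
  show "closure sturmian_values \<subseteq> ?R"
  proof (rule closure_minimal)
    show "sturmian_values \<subseteq> ?R" using sturmian_values_subset by blast
    show "closed ?R" by (intro closed_Un closed_atLeastAtMost closed_atLeast)
  qed
  show "?R \<subseteq> closure sturmian_values"
  proof
    fix t assume "t \<in> ?R"
    then consider "1 + sqrt 5 \<le> t" "t \<le> 2 + sqrt 5" | "2 + 2 * sqrt 2 \<le> t" "t \<le> 3 + 2 * sqrt 3" | "3 + sqrt 13 \<le> t"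
      by auto
    then show "t \<in> closure sturmian_values"
    proof cases
      case 1
      then show ?thesis by (intro root_interval_in_closure[of 1 1]) auto
    next
      case 2
      have r: "sqrt 8 = 2 * sqrt 2" "sqrt 12 = 2 * sqrt 3"
        using real_sqrt_mult[of 4 2] real_sqrt_mult[of 4 3] by simp_all
      show ?thesis
      proof (cases "t \<le> 3 + 2 * sqrt 2")
        case True
        then show ?thesis using 2 r by (intro root_interval_in_closure[of 2 2]) auto
      next
        case False
        \<comment> \<open>For p = 2 the intervals for q = 2 and q = 1 overlap: 2 + 2 sqrt 3 \<le> 3
          + 2 sqrt 2.\<close>
        have "sqrt 3 \<le> sqrt 2 + 1 / 2"
        proof (rule real_le_lsqrt)
          have "1 \<le> sqrt 2" by simp
          moreover have "(sqrt 2 + 1 / 2)\<^sup>2 = 2 + sqrt 2 + 1 / 4" by (simp add: power2_eq_square algebra_simps)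
          ultimately show "3 \<le> (sqrt 2 + 1 / 2)\<^sup>2" by linarith
        qed simp
        then show ?thesis using 2 False r by (intro root_interval_in_closure[of 1 2]) auto
      qed
    next
      case 3
      then show ?thesis by (rule large_in_closure)
    qed
  qed
qed

end
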